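(* Let $n\ge 3$, let $a$ be the smallest prime divisor of $n$, let $q_1,q_2$ be powers of a prime $p$, let $q=q_1\otimes q_2=q_1^d$, and let $R=A(n,q_1,q_2)$. If $d<n-(n/a)$, then $\sigma(R)\le\sigma(M_n(\mathbb{F}_{q_1}))$, with equality only when $n=3$ and $q_1=2$. Consequently, if $d<n-(n/a)$ and $(n,q_1)\ne(3,2)$, then $R$ is $\sigma$-elementary.
   Context: Rings are associative and need not have an identity; a subring is an additive subgroup closed under multiplication. A cover of a ring $R$ is a collection of proper subrings whose union is $R$; $\sigma(R)$ is the minimum cardinality of a cover ($\infty$ if none exists). $R$ is $\sigma$-elementary if $\sigma(R)<\sigma(R/I)$ for every nonzero two-sided ideal $I$. For powers $q_1=p^{d_1}$, $q_2=p^{d_2}$ of a prime $p$, $q_1\otimes q_2:=p^{\operatorname{lcm}(d_1,d_2)}$; $\mathbb{F}_{q_1},\mathbb{F}_{q_2}$ are subfields of $\mathbb{F}_q$. $A(n,q_1,q_2)$ is the subring of $M_{n+1}(\mathbb{F}_q)$ of all block matrices $\begin{pmatrix} A & v\\ 0 & b\end{pmatrix}$ with $A\in M_n(\mathbb{F}_{q_1})$, $v\in M_{n\times 1}(\mathbb{F}_q)$, $b\in\mathbb{F}_{q_2}$. *)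

theory Defs
  imports "Jordan_Normal_Form.Matrix" "HOL-Algebra.QuotRing" "HOL-Library.Extended_Nat"
    "HOL-Computational_Algebra.Primes"
begin

text \<open>Rings are associative, not necessarily unital; we use HOL-Algebra ring records and
ignore the one field. A subring is an additive subgroup closed under multiplication.\<close>

definition subrng :: "('a, 'b) ring_scheme \<Rightarrow> 'a set \<Rightarrow> bool" where
  "subrng R S \<longleftrightarrow> S \<subseteq> carrier R \<and> \<zero>\<^bsub>R\<^esub> \<in> S \<and>
     (\<forall>x\<in>S. \<ominus>\<^bsub>R\<^esub> x \<in> S) \<and>
     (\<forall>x\<in>S. \<forall>y\<in>S. x \<oplus>\<^bsub>R\<^esub> y \<in> S \<and> x \<otimes>\<^bsub>R\<^esub> y \<in> S)"

definition ideal_rng :: "('a, 'b) ring_scheme \<Rightarrow> 'a set \<Rightarrow> bool" where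
  "ideal_rng R I \<longleftrightarrow> subrng R I \<and>
     (\<forall>x\<in>carrier R. \<forall>i\<in>I. x \<otimes>\<^bsub>R\<^esub> i \<in> I \<and> i \<otimes>\<^bsub>R\<^esub> x \<in> I)"

definition is_cover :: "('a, 'b) ring_scheme \<Rightarrow> 'a set set \<Rightarrow> bool" where
  "is_cover R C \<longleftrightarrow> (\<forall>S\<in>C. subrng R S \<and> S \<noteq> carrier R) \<and> \<Union>C = carrier R"

text \<open>Covering number; infinity if there is no cover (Inf of the empty set is top).\<close>
definition sigma :: "('a, 'b) ring_scheme \<Rightarrow> enat" where
  "sigma R = (INF C \<in> {C. is_cover R C}. (if finite C then enat (card C) else \<infinity>))"

definition sigma_elementary :: "('a, 'b) ring_scheme \<Rightarrow> bool" where
  "sigma_elementary R \<longleftrightarrow>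
     (\<forall>I. ideal_rng R I \<and> I \<noteq> {\<zero>\<^bsub>R\<^esub>} \<longrightarrow> sigma R < sigma (R Quot I))"

definition is_subfield :: "('k::field) set \<Rightarrow> bool" where
  "is_subfield K \<longleftrightarrow> 0 \<in> K \<and> 1 \<in> K \<and>
     (\<forall>x\<in>K. \<forall>y\<in>K. x + y \<in> K \<and> x - y \<in> K \<and> x * y \<in> K) \<and>
     (\<forall>x\<in>K. x \<noteq> 0 \<longrightarrow> inverse x \<in> K)"

definition matring :: "nat \<Rightarrow> ('k::field) set \<Rightarrow> 'k mat ring" where
  "matring n K = (ring_mat TYPE('k) n ())
     \<lparr>carrier := {M \<in> carrier_mat n n. \<forall>i<n. \<forall>j<n. M $$ (i, j) \<in> K}\<rparr>"

text \<open>A(n,q1,q2) inside M_{n+1}(F_q), with F_q1 = K1, F_q2 = K2 subfields of 'k = F_q.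
Indices 0..n-1 form the A block, index n the last row/column.\<close>
definition Aring :: "nat \<Rightarrow> ('k::field) set \<Rightarrow> 'k set \<Rightarrow> 'k mat ring" where
  "Aring n K1 K2 = (ring_mat TYPE('k) (n + 1) ())
     \<lparr>carrier := {M \<in> carrier_mat (n + 1) (n + 1).
        (\<forall>i<n. \<forall>j<n. M $$ (i, j) \<in> K1) \<and> (\<forall>j<n. M $$ (n, j) = 0) \<and> M $$ (n, n) \<in> K2}\<rparr>"

end

theory Submission
  imports Defs "HOL-Algebra.Algebraic_Closure_Type" "HOL-Algebra.Multiplicative_Group"
    "Jordan_Normal_Form.Char_Poly"
begin

text \<open>
  Upper bound: let \<open>q\<close> be the order of the ambient field. Every matrix in the ring has its last diagonal
  entry as an eigenvalue, so the stabilizers of the \<open>(q ^ (n + 1) - 1) / (q - 1)\<close> points of projective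
  space form a cover.

  Lower bound: write \<open>q\<close> for the order of \<open>K1\<close> and let \<open>K\<close> be the extension of \<open>K1\<close> of degree \<open>n\<close>. The
  matrix ring is the ring of \<open>K1\<close>-linear maps on \<open>K\<close>, which are exactly the polynomials
  \<open>\<Sum>i<n. c i * z ^ q ^ i\<close>. A proper subring containing the multiplication by a generator \<open>x\<close> of \<open>K\<close> is
  spanned over \<open>K\<close> by the maps \<open>z ^ q ^ i\<close> with \<open>m dvd i\<close> for a divisor \<open>m \<ge> 2\<close> of \<open>n\<close>, so it
  centralizes the subfield of order \<open>q ^ m\<close>. An element of \<open>GL\<close> that conjugates \<open>x\<close> into this
  subring therefore has its coefficients supported in one residue class modulo \<open>m\<close>, which bounds the
  number of conjugates of \<open>x\<close> in a member of a cover. For \<open>n = 3\<close> and \<open>q = 2\<close> the seven maps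
  \<open>z \<mapsto> c * z ^ 2\<close> are needed in addition.

  Every nonzero ideal of the ring contains the last column. A cover of a proper quotient thus lifts to a
  cover by subrings containing that column, and the lower bound applies to the conjugates of \<open>x\<close> paired with
  a generator of \<open>K2\<close>.
\<close>

text \<open>The comparison of the bounds shows where \<open>d < n - n div a\<close> enters. The
  order of \<open>GL\<close> is \<open>q ^ n - 1\<close> times the product of the
  \<open>q ^ n - q ^ i\<close> for \<open>0 < i < n\<close>, and one member of a cover accounts for
  at most \<open>(q ^ n - 1) * m * q ^ (n * (n div m - 1))\<close> conjugating elements. The factor
  \<open>q ^ n - 1\<close> cancels, and a cover has at least
  \<open>q ^ (n * (n - n div m)) / (4 * m)\<close> members. There are fewer than
  \<open>2 * q ^ (d * n)\<close> projective points over the ambient field. Since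
  \<open>m \<ge> a\<close>, the hypothesis leaves a spare factor \<open>q ^ n\<close>, which has to
  beat \<open>8 * m\<close>. For \<open>n = 3\<close> and \<open>q = 2\<close> the conjugates of
  \<open>x\<close> account for only 8 subrings against 15 points, and the seven extra maps supply
  exactly the difference. Subrings need not contain an identity. Generators are therefore used
  through positive powers.\<close>

no_notation fps_nth (infixl \<open>$\<close> 75)
hide_const (open) Divisibility.prime Ring_Divisibility.mult_of

section \<open>Linear endomorphisms of a finite field extension\<close>

text \<open>There are too many roots for the degree. Exponents \<open>i\<close> tested on the
  \<open>n\<close> conjugates of \<open>x\<close> make the powers of \<open>x\<close> independent;
  exponents \<open>q ^ i\<close> tested on \<open>K\<close> make the coefficients of a linear map
  unique.\<close>

lemma sparse_poly_zero:
  fixes c :: "'i \<Rightarrow> 'w::field"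
  assumes "finite I" "inj_on e I" and deg: "\<And>i. i \<in> I \<Longrightarrow> e i < card A"
    and zero: "\<And>z. z \<in> A \<Longrightarrow> (\<Sum>i\<in>I. c i * z ^ e i) = 0" and "i \<in> I"
  shows "c i = 0"
proof (rule ccontr)
  assume "c i \<noteq> 0"
  define P where "P = (\<Sum>j\<in>I. monom (c j) (e j))"
  have "coeff P (e i) = (\<Sum>j\<in>I. if j = i then c j else 0)"
    unfolding P_def coeff_sum coeff_monom
    by (rule sum.cong) (use \<open>inj_on e I\<close> \<open>i \<in> I\<close> in \<open>auto simp: inj_on_def\<close>)
  hence nz: "P \<noteq> 0" using \<open>c i \<noteq> 0\<close> \<open>i \<in> I\<close> \<open>finite I\<close> by auto
  have "degree P < card A"
  proof -
    have "degree (monom (c j) (e j)) \<le> card A - 1" if "j \<in> I" for j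
      using deg[OF that] degree_monom_le[of "c j" "e j"] by linarith
    hence "degree P \<le> card A - 1" unfolding P_def by (intro degree_sum_le \<open>finite I\<close>) auto
    thus ?thesis using deg[OF \<open>i \<in> I\<close>] by linarith
  qed
  moreover have "A \<subseteq> {z. poly P z = 0}"
    using zero by (auto simp: P_def poly_sum poly_monom)
  hence "card A \<le> degree P"
    by (rule le_trans[OF card_mono[OF poly_roots_finite[OF nz]] card_poly_roots_bound[OF nz]])
  ultimately show False by simp
qed

text \<open>Euclidean descent: for \<open>t = m + s\<close>,
  \<open>q ^ t - 1 = q ^ s * (q ^ m - 1) + (q ^ s - 1)\<close>, so \<open>t\<close> may be reduced
  modulo \<open>m\<close>.\<close>

lemma power_minus_one_dvd_iff:
  fixes q m t :: nat
  assumes q: "q \<ge> 2" and m: "m \<ge> 1" and d: "q ^ m - 1 dvd q ^ t - 1"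
  shows "m dvd t"
  using d
proof (induction t rule: less_induct)
  case (less t)
  show ?case
  proof (cases "t < m")
    case True
    hence "q ^ t < q ^ m" using q by (simp add: power_strict_increasing)
    moreover have "q ^ t \<ge> 1" using q by simp
    ultimately have "q ^ t - 1 = 0" using less.prems by (metis diff_less_mono dvd_imp_le not_less neq0_conv)
    hence "q ^ t = 1" using \<open>q ^ t \<ge> 1\<close> by linarith
    hence "t = 0" using q by simp
    thus ?thesis by simp
  next
    case False
    then obtain s where s: "t = m + s" using le_Suc_ex not_less by blast
    have ge: "q ^ s \<ge> 1" "q ^ m \<ge> 1" using q by simp_all
    hence "q ^ t - 1 = q ^ s * (q ^ m - 1) + (q ^ s - 1)"
      by (simp add: s power_add algebra_simps diff_mult_distrib2)
    hence "q ^ m - 1 dvd q ^ s - 1" using less.prems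
      by (metis dvd_add_right_iff dvd_triv_right)
    hence "m dvd s" using less.IH[of s] m by (simp add: s)
    thus ?thesis by (simp add: s)
  qed
qed

text \<open>\<open>K\<close> models the field of order \<open>q ^ n\<close> with primitive element
  \<open>x\<close>. It is a subset of a larger field because its order depends on the variable
  \<open>n\<close>; its subfield of order \<open>q\<close> is the fixed set of the Frobenius
  map.\<close>

locale singer_field =
  fixes K :: "'w::field set" and q n :: nat and x :: 'w
  assumes q_ge: "q \<ge> 2" and n_ge: "n \<ge> 2"
    and zero_mem [simp]: "0 \<in> K" and one_mem [simp]: "1 \<in> K"
    and add_mem: "\<And>a b. a \<in> K \<Longrightarrow> b \<in> K \<Longrightarrow> a + b \<in> K"
    and diff_mem: "\<And>a b. a \<in> K \<Longrightarrow> b \<in> K \<Longrightarrow> a - b \<in> K"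
    and mult_mem: "\<And>a b. a \<in> K \<Longrightarrow> b \<in> K \<Longrightarrow> a * b \<in> K"
    and inverse_mem: "\<And>a. a \<in> K \<Longrightarrow> inverse a \<in> K"
    and pow_q_add: "\<And>a b. a \<in> K \<Longrightarrow> b \<in> K \<Longrightarrow> (a + b) ^ q = a ^ q + b ^ q"
    and pow_qn: "\<And>a. a \<in> K \<Longrightarrow> a ^ (q ^ n) = a"
    and card_K: "card K = q ^ n"
    and x_mem [simp]: "x \<in> K" and x_nz [simp]: "x \<noteq> 0"
    and gen: "\<And>a. a \<in> K \<Longrightarrow> a \<noteq> 0 \<Longrightarrow> \<exists>k. a = x ^ k"
    and card_F: "card {a \<in> K. a ^ q = a} = q"
begin

definition F where "F = {a \<in> K. a ^ q = a}"
definition N where "N = q ^ n - 1"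

lemma q_pos [simp]: "q > 0" "q \<noteq> 0" using q_ge by auto
lemma n_pos [simp]: "n > 0" using n_ge by auto

lemma finite_K [simp]: "finite K" using card_K by (metis card.infinite power_not_zero q_pos(2))
lemma F_subset: "F \<subseteq> K" by (auto simp: F_def)
lemma finite_F [simp]: "finite F" using F_subset finite_K by (rule finite_subset)

lemma sum_mem: "(\<And>i. i \<in> I \<Longrightarrow> f i \<in> K) \<Longrightarrow> sum f I \<in> K"
  by (induction I rule: infinite_finite_induct) (auto intro: add_mem)

lemma pow_mem: "a \<in> K \<Longrightarrow> a ^ k \<in> K"
  by (induction k) (auto intro: mult_mem)

lemma frob_add: "a \<in> K \<Longrightarrow> b \<in> K \<Longrightarrow> (a + b) ^ (q ^ i) = a ^ (q ^ i) + b ^ (q ^ i)"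
proof (induction i)
  case (Suc i)
  have "(a + b) ^ (q ^ Suc i) = ((a + b) ^ (q ^ i)) ^ q"
    by (metis mult.commute power_Suc power_mult)
  also have "\<dots> = (a ^ (q ^ i)) ^ q + (b ^ (q ^ i)) ^ q"
    using Suc by (simp add: pow_q_add pow_mem)
  also have "\<dots> = a ^ (q ^ Suc i) + b ^ (q ^ Suc i)"
    by (metis mult.commute power_Suc power_mult)
  finally show ?case .
qed simp

lemma frob_diff: "a \<in> K \<Longrightarrow> b \<in> K \<Longrightarrow> (a - b) ^ (q ^ i) = a ^ (q ^ i) - b ^ (q ^ i)"
  using frob_add[of "a - b" b i] by (simp add: diff_mem)

lemma frob_sum:
  "finite I \<Longrightarrow> (\<And>j. j \<in> I \<Longrightarrow> f j \<in> K) \<Longrightarrow> (\<Sum>j\<in>I. f j) ^ (q ^ i) = (\<Sum>j\<in>I. f j ^ (q ^ i))"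
  by (induction I rule: finite_induct) (auto simp: frob_add sum_mem)

lemma frob_frob: "((a::'w) ^ (q ^ i)) ^ (q ^ j) = a ^ (q ^ (i + j))"
  by (simp add: power_add power_mult)

lemma frob_period: "a \<in> K \<Longrightarrow> a ^ (q ^ (i + n * j)) = a ^ (q ^ i)"
proof (induction j)
  case (Suc j)
  have "a ^ (q ^ (i + n * Suc j)) = (a ^ (q ^ (i + n * j))) ^ (q ^ n)"
    by (simp add: frob_frob algebra_simps)
  thus ?case using Suc by (simp add: pow_qn pow_mem)
qed simp

lemma F_pow: "c \<in> F \<Longrightarrow> c ^ (q ^ i) = c"
  by (induction i) (auto simp: F_def mult.commute power_mult)

lemma N_pos: "N > 0"
proof -
  have "q ^ n \<ge> 2 ^ n" using q_ge by (simp add: power_mono)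
  moreover have "(2::nat) ^ n \<ge> 2" using self_le_power[of 2 n] by simp
  ultimately show ?thesis unfolding N_def by linarith
qed

lemma x_pow_N: "x ^ N = 1"
proof -
  have "x * x ^ N = x ^ (q ^ n)" unfolding N_def by (subst power_Suc[symmetric]) simp
  thus ?thesis using pow_qn[of x] by simp
qed

lemma x_pow_mod: "x ^ (i mod N) = x ^ i"
  by (metis mod_mult_div_eq mult.right_neutral power_add power_mult power_one x_pow_N)

text \<open>The first \<open>N\<close> powers exhaust the \<open>N\<close> nonzero elements of
  \<open>K\<close>, so they are distinct and \<open>x\<close> has order exactly
  \<open>N\<close>.\<close>

lemma x_pow_eq_iff: "x ^ i = x ^ j \<longleftrightarrow> i mod N = j mod N"
proof -
  have "(\<lambda>k. x ^ k) ` {..<N} = K - {0}"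
  proof
    show "K - {0} \<subseteq> (\<lambda>k. x ^ k) ` {..<N}"
    proof
      fix a assume "a \<in> K - {0}"
      then obtain k where "a = x ^ k" using gen by auto
      hence "a = x ^ (k mod N)" by (simp add: x_pow_mod)
      thus "a \<in> (\<lambda>k. x ^ k) ` {..<N}" using N_pos by auto
    qed
  qed (auto simp: pow_mem)
  hence "card ((\<lambda>k. x ^ k) ` {..<N}) = card {..<N}"
    by (simp add: card_K N_def)
  hence "inj_on (\<lambda>k. x ^ k) {..<N}" by (simp add: eq_card_imp_inj_on)
  thus ?thesis using N_pos by (metis inj_onD lessThan_iff mod_less_divisor x_pow_mod)
qed

lemma q_pow_less_N: "i < n \<Longrightarrow> q ^ i < N"
proof -
  assume "i < n"
  hence "q ^ i \<le> q ^ (n - 1)" using q_ge by (intro power_increasing) auto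
  moreover have "q ^ n \<ge> 2 * q ^ (n - 1)" using q_ge by (subst power_eq_if) simp
  moreover have "q ^ (n - 1) \<ge> 2"
    using q_ge n_ge by (intro le_trans[OF _ self_le_power]) auto
  ultimately show ?thesis unfolding N_def by linarith
qed

lemma x_frob_inj: "i < n \<Longrightarrow> j < n \<Longrightarrow> x ^ (q ^ i) = x ^ (q ^ j) \<Longrightarrow> i = j"
  using q_pow_less_N q_ge by (simp add: x_pow_eq_iff power_inject_exp)

text \<open>Powers of the Frobenius map fix the coefficients, so a relation at \<open>x\<close>
  holds at each of its \<open>n\<close> distinct conjugates, too many for a polynomial of degree
  below \<open>n\<close>.\<close>

lemma basis_indep:
  assumes c: "\<And>j. j < n \<Longrightarrow> c j \<in> F" and z: "(\<Sum>j<n. c j * x ^ j) = 0" and "j < n"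
  shows "c j = 0"
proof (rule sparse_poly_zero[where I = "{..<n}" and e = "\<lambda>i. i" and A = "(\<lambda>i. x ^ (q ^ i)) ` {..<n}"])
  have "card ((\<lambda>i. x ^ (q ^ i)) ` {..<n}) = n"
    by (subst card_image) (auto simp: inj_on_def x_frob_inj)
  thus "i < card ((\<lambda>i. x ^ (q ^ i)) ` {..<n})" if "i \<in> {..<n}" for i using that by simp
next
  fix w assume "w \<in> (\<lambda>i. x ^ (q ^ i)) ` {..<n}"
  then obtain i where w: "w = x ^ (q ^ i)" by auto
  have "(\<Sum>j<n. c j * w ^ j) = (\<Sum>j<n. (c j * x ^ j) ^ (q ^ i))"
    by (rule sum.cong) (auto simp: power_mult_distrib F_pow c w mult.commute simp flip: power_mult)
  also have "\<dots> = (\<Sum>j<n. c j * x ^ j) ^ (q ^ i)"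
    using c F_subset by (subst frob_sum) (auto intro!: mult_mem pow_mem)
  finally show "(\<Sum>j<n. c j * w ^ j) = 0" using z by simp
qed (use \<open>j < n\<close> in auto)

lemma F_diff: "a \<in> F \<Longrightarrow> b \<in> F \<Longrightarrow> a - b \<in> F"
  using frob_diff[of a b 1] by (auto simp: F_def diff_mem)
lemma F_add: "a \<in> F \<Longrightarrow> b \<in> F \<Longrightarrow> a + b \<in> F"
  by (auto simp: F_def add_mem pow_q_add)
lemma F_mult: "a \<in> F \<Longrightarrow> b \<in> F \<Longrightarrow> a * b \<in> F"
  by (auto simp: F_def mult_mem power_mult_distrib)
lemma F_zero [simp]: "0 \<in> F" by (simp add: F_def)
lemma F_one [simp]: "1 \<in> F" by (simp add: F_def)
lemma F_K: "a \<in> F \<Longrightarrow> a \<in> K" by (simp add: F_def)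

section \<open>Coordinates in the basis of powers of \<open>x\<close>\<close>

definition comb :: "(nat \<Rightarrow> 'w) \<Rightarrow> 'w" where "comb c = (\<Sum>j<n. c j * x ^ j)"
definition coord :: "'w \<Rightarrow> nat \<Rightarrow> 'w" where "coord = inv_into ({..<n} \<rightarrow>\<^sub>E F) comb"

lemma comb_bij: "bij_betw comb ({..<n} \<rightarrow>\<^sub>E F) K"
proof -
  have inj: "inj_on comb ({..<n} \<rightarrow>\<^sub>E F)"
  proof (rule inj_onI)
    fix c c' assume cc: "c \<in> {..<n} \<rightarrow>\<^sub>E F" "c' \<in> {..<n} \<rightarrow>\<^sub>E F" "comb c = comb c'"
    have "c j - c' j = 0" if "j < n" for j
      by (rule basis_indep[where c = "\<lambda>j. c j - c' j"])
        (use cc that in \<open>auto simp: comb_def sum_subtractf left_diff_distrib intro!: F_diff\<close>)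
    thus "c = c'" using cc by (intro PiE_ext[OF cc(1,2)]) auto
  qed
  have sub: "comb ` ({..<n} \<rightarrow>\<^sub>E F) \<subseteq> K"
    using F_subset by (auto simp: comb_def intro!: sum_mem mult_mem pow_mem)
  have "card (comb ` ({..<n} \<rightarrow>\<^sub>E F)) = card K"
    using card_F by (simp add: card_image[OF inj] card_PiE card_K flip: F_def)
  hence "comb ` ({..<n} \<rightarrow>\<^sub>E F) = K" using sub by (simp add: card_subset_eq)
  thus ?thesis using inj by (simp add: bij_betw_def)
qed

lemma coord_mem: "z \<in> K \<Longrightarrow> coord z \<in> {..<n} \<rightarrow>\<^sub>E F"
  using comb_bij unfolding coord_def bij_betw_def by (metis inv_into_into)
lemma coord_F: "z \<in> K \<Longrightarrow> j < n \<Longrightarrow> coord z j \<in> F"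
  using coord_mem by auto
lemma comb_coord: "z \<in> K \<Longrightarrow> (\<Sum>j<n. coord z j * x ^ j) = z"
  using comb_bij unfolding coord_def bij_betw_def comb_def[symmetric] by (metis f_inv_into_f)
lemma coord_unique:
  assumes "\<And>j. j < n \<Longrightarrow> c j \<in> F" and z: "z = (\<Sum>j<n. c j * x ^ j)" and "j < n"
  shows "coord z j = c j"
proof -
  have "z \<in> K" using assms(1) F_K by (auto simp: z intro!: sum_mem mult_mem pow_mem)
  have "coord z j - c j = 0"
    by (rule basis_indep[where c = "\<lambda>j. coord z j - c j"])
       (use assms \<open>z \<in> K\<close> comb_coord[of z] in \<open>auto simp: sum_subtractf left_diff_distrib coord_F intro!: F_diff\<close>)
  thus ?thesis by simp
qed
lemma coord_add: "y \<in> K \<Longrightarrow> z \<in> K \<Longrightarrow> j < n \<Longrightarrow> coord (y + z) j = coord y j + coord z j"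
  by (rule coord_unique) (auto simp: F_add coord_F distrib_right sum.distrib comb_coord)
lemma coord_scale: "a \<in> F \<Longrightarrow> z \<in> K \<Longrightarrow> j < n \<Longrightarrow> coord (a * z) j = a * coord z j"
  by (rule coord_unique) (auto simp: F_mult coord_F mult.assoc comb_coord simp flip: sum_distrib_left)
lemma coord_basis: "i < n \<Longrightarrow> j < n \<Longrightarrow> coord (x ^ i) j = (if j = i then 1 else 0)"
  by (rule coord_unique) (auto simp: if_distrib[of "\<lambda>a. a * _"] cong: if_cong)

text \<open>The \<open>F\<close>-linear endomorphisms of \<open>K\<close>. The value
  \<open>0\<close> outside \<open>K\<close> makes agreement on \<open>K\<close> the same as equality
  of functions, so that they can be counted.\<close>

definition E :: "('w \<Rightarrow> 'w) set" where
  "E = {f. (\<forall>z. z \<notin> K \<longrightarrow> f z = 0) \<and> (\<forall>z\<in>K. f z \<in> K) \<and>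
     (\<forall>y\<in>K. \<forall>z\<in>K. f (y + z) = f y + f z) \<and> (\<forall>c\<in>F. \<forall>z\<in>K. f (c * z) = c * f z)}"

lemma E_outside: "f \<in> E \<Longrightarrow> z \<notin> K \<Longrightarrow> f z = 0" by (simp add: E_def)
lemma E_mem: "f \<in> E \<Longrightarrow> z \<in> K \<Longrightarrow> f z \<in> K" by (simp add: E_def)
lemma E_add: "f \<in> E \<Longrightarrow> y \<in> K \<Longrightarrow> z \<in> K \<Longrightarrow> f (y + z) = f y + f z" by (simp add: E_def)
lemma E_scale: "f \<in> E \<Longrightarrow> c \<in> F \<Longrightarrow> z \<in> K \<Longrightarrow> f (c * z) = c * f z" by (simp add: E_def)
lemma E_zero: "f \<in> E \<Longrightarrow> f 0 = 0" using E_scale[of f 0 0] by simp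
lemma E_sum: "f \<in> E \<Longrightarrow> finite I \<Longrightarrow> (\<And>i. i \<in> I \<Longrightarrow> g i \<in> K) \<Longrightarrow> f (sum g I) = (\<Sum>i\<in>I. f (g i))"
  by (rotate_tac 1, induction I rule: finite_induct) (auto simp: E_zero E_add sum_mem)
lemma E_comp: "f \<in> E \<Longrightarrow> g \<in> E \<Longrightarrow> f \<circ> g \<in> E"
  using E_zero[of f] by (simp add: E_def)
lemma E_diff: "f \<in> E \<Longrightarrow> y \<in> K \<Longrightarrow> z \<in> K \<Longrightarrow> f (y - z) = f y - f z"
  using E_add[of f "y - z" z] by (simp add: diff_mem)

lemma E_ext: "f \<in> E \<Longrightarrow> g \<in> E \<Longrightarrow> (\<And>z. z \<in> K \<Longrightarrow> f z = g z) \<Longrightarrow> f = g"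
  by (rule ext) (metis E_outside)

lemma E_basis_ext:
  assumes "f \<in> E" "g \<in> E" "\<And>j. j < n \<Longrightarrow> f (x ^ j) = g (x ^ j)"
  shows "f = g"
proof (rule E_ext[OF assms(1,2)])
  have *: "h z = (\<Sum>j<n. coord z j * h (x ^ j))" if "h \<in> E" "z \<in> K" for h z
  proof -
    have "h z = h (\<Sum>j<n. coord z j * x ^ j)" using comb_coord that by simp
    also have "\<dots> = (\<Sum>j<n. coord z j * h (x ^ j))"
      by (subst E_sum) (auto simp: that coord_F F_K E_scale pow_mem intro!: mult_mem)
    finally show ?thesis .
  qed
  fix z assume "z \<in> K"
  show "f z = g z" using *[OF assms(1) \<open>z \<in> K\<close>] *[OF assms(2) \<open>z \<in> K\<close>] assms(3) by simp
qed

definition lin :: "(nat \<Rightarrow> 'w) \<Rightarrow> 'w \<Rightarrow> 'w" where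
  "lin v = (\<lambda>z. if z \<in> K then \<Sum>j<n. coord z j * v j else 0)"

lemma lin_E: "(\<And>j. j < n \<Longrightarrow> v j \<in> K) \<Longrightarrow> lin v \<in> E"
  unfolding E_def lin_def
  by (auto simp: coord_F F_K add_mem coord_add coord_scale distrib_right
      sum.distrib sum_distrib_left mult.assoc mult_mem intro!: sum_mem)

lemma lin_basis: "j < n \<Longrightarrow> lin v (x ^ j) = v j"
  by (simp add: lin_def pow_mem coord_basis if_distrib[of "\<lambda>a. a * _"] cong: if_cong)

lemma lin_bij: "bij_betw lin ({..<n} \<rightarrow>\<^sub>E K) E"
  unfolding bij_betw_def
proof
  show "inj_on lin ({..<n} \<rightarrow>\<^sub>E K)"
  proof (rule inj_onI, rule PiE_ext)
    fix v w i assume "lin v = lin w" "i \<in> {..<n}"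
    thus "v i = w i" using lin_basis by (metis lessThan_iff)
  qed auto
  show "lin ` ({..<n} \<rightarrow>\<^sub>E K) = E"
  proof
    show "E \<subseteq> lin ` ({..<n} \<rightarrow>\<^sub>E K)"
    proof
      fix f assume f: "f \<in> E"
      let ?v = "\<lambda>j\<in>{..<n}. f (x ^ j)"
      have "f = lin ?v"
        by (rule E_basis_ext) (auto simp: f E_mem pow_mem lin_basis intro!: lin_E)
      thus "f \<in> lin ` ({..<n} \<rightarrow>\<^sub>E K)" using f by (auto simp: E_mem pow_mem intro!: image_eqI[of _ _ ?v])
    qed
  qed (auto intro!: lin_E)
qed

lemma card_E: "card E = (q ^ n) ^ n"
  using bij_betw_same_card[OF lin_bij] by (simp add: card_PiE card_K)
lemma finite_E [simp]: "finite E" using card_E by (metis card.infinite power_not_zero q_pos(2))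

section \<open>Linearized polynomials\<close>

definition lp :: "(nat \<Rightarrow> 'w) \<Rightarrow> 'w \<Rightarrow> 'w" where
  "lp c = (\<lambda>z. if z \<in> K then \<Sum>i<n. c i * z ^ (q ^ i) else 0)"

lemma lp_E: "(\<And>j. j < n \<Longrightarrow> c j \<in> K) \<Longrightarrow> lp c \<in> E"
  unfolding E_def lp_def
  by (auto simp: add_mem frob_add F_K F_pow power_mult_distrib distrib_left
      sum.distrib sum_distrib_left mult_mem mult.left_commute pow_mem intro!: sum_mem)

lemma lp_inj:
  assumes "\<And>z. z \<in> K \<Longrightarrow> (\<Sum>i<n. c i * z ^ (q ^ i)) = (\<Sum>i<n. c' i * z ^ (q ^ i))" and "i < n"
  shows "c i = c' i"
proof -
  have "c i - c' i = 0"
    by (rule sparse_poly_zero[where I = "{..<n}" and e = "\<lambda>i. q ^ i" and A = K and c = "\<lambda>i. c i - c' i"])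
      (use assms q_ge in \<open>auto simp: inj_on_def power_inject_exp card_K left_diff_distrib sum_subtractf
        intro: power_strict_increasing\<close>)
  thus ?thesis by simp
qed

text \<open>Surjectivity is a count: there are \<open>(q ^ n) ^ n\<close> coefficient vectors and as
  many linear maps, and distinct vectors give distinct maps.\<close>

lemma lp_bij: "bij_betw lp ({..<n} \<rightarrow>\<^sub>E K) E"
proof -
  have inj: "inj_on lp ({..<n} \<rightarrow>\<^sub>E K)"
  proof (rule inj_onI, rule PiE_ext)
    fix c c' i assume "lp c = lp c'" "i \<in> {..<n}"
    thus "c i = c' i" using lp_inj[of c c' i] by (metis (no_types, lifting) lessThan_iff lp_def)
  qed auto
  have "lp ` ({..<n} \<rightarrow>\<^sub>E K) \<subseteq> E" by (auto intro!: lp_E)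
  moreover have "card (lp ` ({..<n} \<rightarrow>\<^sub>E K)) = card E"
    by (simp add: card_image[OF inj] card_PiE card_K card_E)
  ultimately show ?thesis using inj by (simp add: bij_betw_def card_subset_eq)
qed

section \<open>Proper subrings of the endomorphism ring\<close>

definition mu :: "'w \<Rightarrow> 'w \<Rightarrow> 'w" where "mu c = (\<lambda>z. if z \<in> K then c * z else 0)"
definition fr :: "nat \<Rightarrow> 'w \<Rightarrow> 'w" where "fr i = (\<lambda>z. if z \<in> K then z ^ (q ^ i) else 0)"

definition closed :: "('w \<Rightarrow> 'w) set \<Rightarrow> bool" where
  "closed S \<longleftrightarrow> S \<subseteq> E \<and> (\<lambda>z. 0) \<in> S \<and>
     (\<forall>f\<in>S. \<forall>g\<in>S. (\<lambda>z. f z + g z) \<in> S \<and> (\<lambda>z. f z - g z) \<in> S \<and> f \<circ> g \<in> S)"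

lemma closed_E: "closed S \<Longrightarrow> f \<in> S \<Longrightarrow> f \<in> E" by (auto simp: closed_def)
lemma closed_comp: "closed S \<Longrightarrow> f \<in> S \<Longrightarrow> g \<in> S \<Longrightarrow> f \<circ> g \<in> S" by (auto simp: closed_def)
lemma closed_add: "closed S \<Longrightarrow> f \<in> S \<Longrightarrow> g \<in> S \<Longrightarrow> (\<lambda>z. f z + g z) \<in> S"
  by (auto simp: closed_def)
lemma closed_diff: "closed S \<Longrightarrow> f \<in> S \<Longrightarrow> g \<in> S \<Longrightarrow> (\<lambda>z. f z - g z) \<in> S"
  by (auto simp: closed_def)
lemma closed_zero: "closed S \<Longrightarrow> (\<lambda>z. 0) \<in> S" by (auto simp: closed_def)

lemma mu_E: "c \<in> K \<Longrightarrow> mu c \<in> E"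
  by (auto simp: E_def mu_def mult_mem add_mem F_K distrib_left mult.left_commute)
lemma mu_mu: "a \<in> K \<Longrightarrow> b \<in> K \<Longrightarrow> mu a \<circ> mu b = mu (a * b)"
  by (auto simp: mu_def mult_mem)
lemma mu_fr: "a \<in> K \<Longrightarrow> (mu a \<circ> fr i) = (\<lambda>z. if z \<in> K then a * z ^ (q ^ i) else 0)"
  by (auto simp: mu_def fr_def pow_mem)
lemma fr_fr: "fr i \<circ> fr j = fr (i + j)"
  by (auto simp: fr_def pow_mem frob_frob add.commute power_0_left)
lemma fr_period: "fr (i + n * j) = fr i"
  by (auto simp: fr_def frob_period)

lemma closed_mu:
  assumes "closed S" "mu x \<in> S" "c \<in> K"
  shows "mu c \<in> S"
proof -
  have pow: "mu (x ^ Suc k) \<in> S" for k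
  proof (induction k)
    case (Suc k)
    have "mu x \<circ> mu (x ^ Suc k) = mu (x ^ Suc (Suc k))" by (subst mu_mu) (auto simp: mult_mem pow_mem)
    thus ?case using closed_comp[OF assms(1,2) Suc] by simp
  qed (use assms in simp)
  show ?thesis
  proof (cases "c = 0")
    case True
    thus ?thesis using closed_zero[OF assms(1)] by (simp add: mu_def cong: if_cong)
  next
    case False
    then obtain k where "c = x ^ k" using gen assms by auto
    \<comment> \<open>\<open>S\<close> need not contain the identity, so the exponent is made
      positive by adding the order of \<open>x\<close>.\<close>
    hence "c = x ^ (k + N)" by (simp add: power_add x_pow_N)
    moreover have "k + N = Suc (k + N - 1)" using N_pos by simp
    ultimately show ?thesis using pow[of "k + N - 1"] by metis
  qed
qed

text \<open>The lines \<open>K fr i\<close> are pairwise non-isomorphic \<open>K\<close>-bimodules, so a sub-bimodule is a sum of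
  some of them: \<open>s \<circ> mu x - mu (x ^ q ^ i) \<circ> s\<close> removes the \<open>i\<close>-th coefficient of \<open>s\<close> and no other.\<close>
lemma closed_fr:
  assumes S: "closed S" and xS: "mu x \<in> S"
    and "\<And>i. i < n \<Longrightarrow> c i \<in> K" "lp c \<in> S" "j < n" "c j \<noteq> 0"
  shows "fr j \<in> S"
  using assms(3-6)
proof (induction "card {i. i < n \<and> c i \<noteq> 0}" arbitrary: c rule: less_induct)
  case (less c)
  note cK = less.prems(1)
  show ?case
  proof (cases "\<exists>i<n. i \<noteq> j \<and> c i \<noteq> 0")
    case False
    hence "(\<Sum>i<n. c i * z ^ q ^ i) = (\<Sum>i<n. if i = j then c j * z ^ q ^ j else 0)" for z
      by (intro sum.cong) auto
    hence lp: "lp c = (\<lambda>z. if z \<in> K then c j * z ^ q ^ j else 0)"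
      using \<open>j < n\<close> by (auto simp: lp_def)
    have "mu (inverse (c j)) \<circ> lp c = fr j"
      using \<open>c j \<noteq> 0\<close> cK[OF \<open>j < n\<close>] by (auto simp: lp mu_def fr_def mult_mem pow_mem)
    moreover have "mu (inverse (c j)) \<in> S" using S xS cK[OF \<open>j < n\<close>]
      by (auto intro!: closed_mu inverse_mem)
    ultimately show ?thesis using closed_comp[OF S _ less.prems(2)] by metis
  next
    case True
    then obtain i where i: "i < n" "i \<noteq> j" "c i \<noteq> 0" by auto
    define c' where "c' k = c k * (x ^ (q ^ k) - x ^ (q ^ i))" for k
    have c'K: "c' k \<in> K" if "k < n" for k
      using cK[OF that] by (auto simp: c'_def intro!: mult_mem diff_mem pow_mem)
    have "lp c' = (\<lambda>z. (lp c \<circ> mu x) z - (mu (x ^ q ^ i) \<circ> lp c) z)"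
    proof
      fix z
      show "lp c' z = (lp c \<circ> mu x) z - (mu (x ^ q ^ i) \<circ> lp c) z"
      proof (cases "z \<in> K")
        case True
        have "lp c z \<in> K" by (rule E_mem[OF lp_E[OF cK] True])
        hence "(lp c \<circ> mu x) z - (mu (x ^ q ^ i) \<circ> lp c) z = lp c (x * z) - x ^ q ^ i * lp c z"
          using True by (simp add: mu_def)
        also have "\<dots> = lp c' z"
          using True by (simp add: lp_def mult_mem c'_def algebra_simps sum_subtractf
              sum_distrib_left power_mult_distrib)
        finally show ?thesis by simp
      qed (simp add: lp_def mu_def power_0_left)
    qed
    moreover have "\<dots> \<in> S"
      by (intro closed_diff closed_comp S xS less.prems closed_mu pow_mem x_mem)
    ultimately have "lp c' \<in> S" by simp
    moreover have "c' j \<noteq> 0"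
      using i \<open>c j \<noteq> 0\<close> \<open>j < n\<close> x_frob_inj by (auto simp: c'_def)
    moreover have "card {i. i < n \<and> c' i \<noteq> 0} < card {i. i < n \<and> c i \<noteq> 0}"
      by (rule psubset_card_mono) (use i in \<open>auto simp: c'_def\<close>)
    ultimately show ?thesis using less.hyps[of c'] c'K \<open>j < n\<close> by blast
  qed
qed

lemma lp_obtain:
  assumes "f \<in> E"
  obtains c where "f = lp c" "\<And>i. i < n \<Longrightarrow> c i \<in> K" "c \<in> {..<n} \<rightarrow>\<^sub>E K"
proof -
  have "f \<in> lp ` ({..<n} \<rightarrow>\<^sub>E K)" using assms lp_bij by (simp add: bij_betw_def)
  then obtain c where "f = lp c" "c \<in> {..<n} \<rightarrow>\<^sub>E K" by auto
  thus thesis by (intro that) auto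
qed

lemma closed_all_fr:
  assumes S: "closed S" and xS: "mu x \<in> S" and fr: "\<And>i. fr i \<in> S"
  shows "S = E"
proof
  show "E \<subseteq> S"
  proof
    fix f assume "f \<in> E"
    then obtain c where c: "f = lp c" "\<And>i. i < n \<Longrightarrow> c i \<in> K" using lp_obtain by metis
    have "k \<le> n \<Longrightarrow> (\<lambda>z. if z \<in> K then \<Sum>i<k. c i * z ^ q ^ i else 0) \<in> S" for k
    proof (induction k)
      case 0
      show ?case using closed_zero[OF S] by (simp cong: if_cong)
    next
      case (Suc k)
      have "(\<lambda>z. (if z \<in> K then \<Sum>i<k. c i * z ^ q ^ i else 0) + (mu (c k) \<circ> fr k) z) \<in> S"
        using Suc c(2) by (intro closed_add[OF S _ closed_comp[OF S closed_mu[OF S xS] fr]]) auto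
      moreover have "(\<lambda>z. (if z \<in> K then \<Sum>i<k. c i * z ^ q ^ i else 0) + (mu (c k) \<circ> fr k) z)
        = (\<lambda>z. if z \<in> K then \<Sum>i<Suc k. c i * z ^ q ^ i else 0)"
        using Suc c by (auto simp: mu_fr)
      ultimately show ?case by simp
    qed
    from this[of n] show "f \<in> S" by (simp add: c lp_def)
  qed
qed (use S in \<open>auto simp: closed_def\<close>)

text \<open>Modulo \<open>n\<close>, the exponents \<open>i\<close> with \<open>fr i \<in> S\<close>
  form a subgroup generated by a divisor \<open>m\<close>, and \<open>m = 1\<close> would give all
  of \<open>E\<close>. The element \<open>e\<close> generates the subfield of order
  \<open>q ^ m\<close>, so multiplication by it commutes with \<open>fr i\<close> exactly when
  \<open>m\<close> divides \<open>i\<close>, and hence with all of \<open>S\<close>.\<close>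

lemma proper_commutes:
  assumes S: "closed S" and ne: "S \<noteq> E" and xS: "mu x \<in> S"
  obtains m e where "m dvd n" "m \<ge> 2" "e \<in> K" "\<And>t. e ^ (q ^ t) = e \<Longrightarrow> m dvd t"
    "\<And>s z. s \<in> S \<Longrightarrow> z \<in> K \<Longrightarrow> s (e * z) = e * s z"
proof -
  define I where "I = {i. fr i \<in> S}"
  have "fr 0 = mu 1" by (auto simp: fr_def mu_def)
  hence I0: "0 \<in> I" using closed_mu[OF S xS, of 1] by (simp add: I_def)
  have per: "i + n * j \<in> I \<longleftrightarrow> i \<in> I" for i j by (simp add: I_def fr_period)
  have In: "n \<in> I" using per[of 0 1] I0 by simp
  have add: "i + j \<in> I" if "i \<in> I" "j \<in> I" for i j
    using closed_comp[OF S, of "fr i" "fr j"] that by (simp add: I_def fr_fr)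
  have mult: "k * i \<in> I" if "i \<in> I" for i k
    by (induction k) (auto simp: I0 add that)
  have diff: "i - j \<in> I" if "i \<in> I" "j \<in> I" "j \<le> i" for i j
  proof -
    \<comment> \<open>Modulo \<open>n\<close>, subtracting \<open>j\<close> is the same as adding it
      \<open>n - 1\<close> times, so closure under composition suffices.\<close>
    have "i - j + n * j = i + (n - 1) * j"
      using \<open>j \<le> i\<close> n_pos by (cases n) auto
    thus ?thesis using per[of "i - j" j] add[OF that(1) mult[OF that(2), of "n - 1"]] by simp
  qed
  define m where "m = (LEAST i. i \<in> I \<and> i > 0)"
  have m: "m \<in> I" "m > 0" and m_le: "\<And>i. i \<in> I \<Longrightarrow> i > 0 \<Longrightarrow> m \<le> i"
    using LeastI[of "\<lambda>i. i \<in> I \<and> i > 0" n] Least_le[of "\<lambda>i. i \<in> I \<and> i > 0"] In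
    by (auto simp: m_def)
  have m_dvd: "m dvd i" if "i \<in> I" for i
  proof -
    have "i - i div m * m \<in> I" by (rule diff) (auto intro: mult m that)
    hence "i mod m \<in> I" by (simp add: minus_div_mult_eq_mod)
    hence "i mod m = 0" using m_le[of "i mod m"] m(2) by (meson mod_less_divisor not_gr0 not_less)
    thus ?thesis by auto
  qed
  have "m \<noteq> 1"
  proof
    assume "m = 1"
    hence "fr i \<in> S" for i using mult[OF m(1), of i] by (simp add: I_def)
    thus False using closed_all_fr[OF S xS] ne by blast
  qed
  hence m2: "m \<ge> 2" using m by simp
  obtain l where l: "n = m * l" using m_dvd[OF In] by auto
  define M where "M = q ^ m - 1"
  have "q ^ m \<ge> q ^ 1" using q_ge m2 by (intro power_increasing) auto
  hence M_pos: "M > 0" using q_ge by (simp add: M_def)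
  have "int (q ^ m) - 1 dvd int (q ^ m) ^ l - 1" by (simp add: power_diff_1_eq)
  moreover have "int M = int (q ^ m) - 1"
    using q_pos by (simp add: M_def of_nat_diff Suc_leI)
  moreover have "int N = int (q ^ m) ^ l - 1"
  proof -
    have "q ^ n = (q ^ m) ^ l" by (simp only: l power_mult)
    moreover have "int N = int (q ^ n) - 1" using q_pos by (simp add: N_def of_nat_diff Suc_leI)
    ultimately show ?thesis by simp
  qed
  ultimately have "M dvd N" by (metis int_dvd_int_iff)
  then obtain r where r: "N = M * r" by auto
  \<comment> \<open>Here \<open>r\<close> is \<open>N\<close> divided by \<open>q ^ m - 1\<close>,
    so \<open>e\<close> has order \<open>q ^ m - 1\<close>, and \<open>e ^ q ^ t = e\<close> means
    that \<open>q ^ m - 1\<close> divides \<open>q ^ t - 1\<close>.\<close>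
  define e where "e = x ^ r"
  have eK: "e \<in> K" by (simp add: e_def pow_mem)
  have e_m: "e ^ (q ^ m) = e"
  proof -
    have "q ^ m = M + 1" using q_pos by (simp add: M_def)
    hence "e ^ (q ^ m) = x ^ (N + r)" by (simp add: e_def r algebra_simps power_add flip: power_mult)
    thus ?thesis by (simp add: power_add x_pow_N e_def)
  qed
  have e_mk: "e ^ (q ^ (m * k)) = e" for k
  proof (induction k)
    case (Suc k)
    thus ?case using frob_frob[of e "m * k" m] e_m by (simp add: add.commute)
  qed simp
  have e_dvd: "m dvd t" if "e ^ (q ^ t) = e" for t
  proof -
    have "x ^ (r * q ^ t) = x ^ r" using that by (simp add: e_def power_mult)
    hence "(r * q ^ t) mod N = r mod N" by (simp add: x_pow_eq_iff)
    hence "N dvd r * q ^ t - r" by (rule mod_eq_dvd_iff_nat[THEN iffD1, rotated]) (simp add: Suc_leI)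
    moreover have "r * q ^ t - r = r * (q ^ t - 1)" by (simp add: diff_mult_distrib2)
    ultimately have "r * M dvd r * (q ^ t - 1)" by (simp add: r mult.commute)
    moreover have "r > 0" using N_pos by (auto simp: r)
    ultimately have "q ^ m - 1 dvd q ^ t - 1" by (simp add: M_def)
    thus ?thesis using power_minus_one_dvd_iff q_ge m(2) by simp
  qed
  have comm: "s (e * z) = e * s z" if "s \<in> S" "z \<in> K" for s z
  proof -
    obtain c where c: "s = lp c" "\<And>i. i < n \<Longrightarrow> c i \<in> K"
      using lp_obtain closed_E[OF S \<open>s \<in> S\<close>] by metis
    have "c i * (e * z) ^ q ^ i = e * (c i * z ^ q ^ i)" if "i < n" for i
    proof (cases "c i = 0")
      case False
      have "fr i \<in> S" by (rule closed_fr[OF S xS, where c = c]) (use \<open>s \<in> S\<close> c \<open>i < n\<close> False in auto)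
      hence "m dvd i" using m_dvd by (simp add: I_def)
      thus ?thesis using e_mk by (auto simp: power_mult_distrib)
    qed simp
    hence "(\<Sum>i<n. c i * (e * z) ^ q ^ i) = (\<Sum>i<n. e * (c i * z ^ q ^ i))" by (intro sum.cong) auto
    thus ?thesis using \<open>z \<in> K\<close> eK by (simp only: c(1) lp_def mult_mem sum_distrib_left if_True)
  qed
  show thesis by (rule that[OF m_dvd[OF In] m2 eK e_dvd comm])
qed

section \<open>Conjugates of a generator\<close>

definition GL :: "('w \<Rightarrow> 'w) set" where "GL = {h \<in> E. bij_betw h K K}"
definition gl_inv :: "('w \<Rightarrow> 'w) \<Rightarrow> 'w \<Rightarrow> 'w" where
  "gl_inv h = (\<lambda>z. if z \<in> K then inv_into K h z else 0)"
definition conj :: "('w \<Rightarrow> 'w) \<Rightarrow> ('w \<Rightarrow> 'w) \<Rightarrow> 'w \<Rightarrow> 'w" where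
  "conj h f = h \<circ> f \<circ> gl_inv h"

lemma GL_E: "h \<in> GL \<Longrightarrow> h \<in> E" by (simp add: GL_def)
lemma finite_GL [simp]: "finite GL" by (simp add: GL_def)
lemma gl_inv_mem: "h \<in> GL \<Longrightarrow> z \<in> K \<Longrightarrow> gl_inv h z \<in> K"
  by (auto simp: GL_def gl_inv_def bij_betw_def inv_into_into)
lemma gl_inv_right: "h \<in> GL \<Longrightarrow> z \<in> K \<Longrightarrow> h (gl_inv h z) = z"
  by (auto simp: GL_def gl_inv_def bij_betw_def f_inv_into_f)
lemma gl_inv_left: "h \<in> GL \<Longrightarrow> z \<in> K \<Longrightarrow> gl_inv h (h z) = z"
  by (auto simp: GL_def gl_inv_def bij_betw_def)
lemma GL_eqD: "h \<in> GL \<Longrightarrow> y \<in> K \<Longrightarrow> z \<in> K \<Longrightarrow> h y = h z \<Longrightarrow> y = z"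
  by (metis gl_inv_left)
lemma gl_inv_GL:
  assumes h: "h \<in> GL"
  shows "gl_inv h \<in> GL"
proof -
  have "gl_inv h (y + z) = gl_inv h y + gl_inv h z" if "y \<in> K" "z \<in> K" for y z
    by (rule GL_eqD[OF h]) (use that h in \<open>auto simp: gl_inv_mem gl_inv_right add_mem E_add[OF GL_E]\<close>)
  moreover have "gl_inv h (c * z) = c * gl_inv h z" if "c \<in> F" "z \<in> K" for c z
    by (rule GL_eqD[OF h]) (use that h in \<open>auto simp: gl_inv_mem gl_inv_right mult_mem F_K E_scale[OF GL_E]\<close>)
  ultimately have "gl_inv h \<in> E" using h by (auto simp: E_def gl_inv_mem) (simp add: gl_inv_def)
  moreover have "bij_betw (gl_inv h) K K"
    by (rule bij_betw_byWitness[where f' = h])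
      (use h in \<open>auto simp: gl_inv_left gl_inv_right gl_inv_mem E_mem GL_E\<close>)
  ultimately show ?thesis by (simp add: GL_def)
qed
lemma GL_comp: "g \<in> GL \<Longrightarrow> h \<in> GL \<Longrightarrow> g \<circ> h \<in> GL"
  by (auto simp: GL_def E_comp intro: bij_betw_trans)
lemma conj_E: "h \<in> GL \<Longrightarrow> f \<in> E \<Longrightarrow> conj h f \<in> E"
  by (simp add: conj_def E_comp GL_E gl_inv_GL)

lemma card_residue_class:
  assumes "m dvd n" "m > 0" "r < m"
  shows "card {i. i < n \<and> i mod m = r} = n div m"
proof -
  have "{i. i < n \<and> i mod m = r} = (\<lambda>k. r + m * k) ` {..<n div m}"
  proof (intro equalityI subsetI)
    fix i assume i: "i \<in> {i. i < n \<and> i mod m = r}"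
    hence "i = r + m * (i div m)" by auto
    moreover have "i div m < n div m" using i assms by (metis dvd_mult_div_cancel mem_Collect_eq div_less_iff_less_mult mult.commute)
    ultimately show "i \<in> (\<lambda>k. r + m * k) ` {..<n div m}" by blast
  next
    fix i assume "i \<in> (\<lambda>k. r + m * k) ` {..<n div m}"
    then obtain k where k: "i = r + m * k" "k < n div m" by auto
    have "r + m * k < m * Suc k" using assms by simp
    also have "\<dots> \<le> m * (n div m)" using k by (intro mult_le_mono2) simp
    also have "\<dots> = n" using assms by simp
    finally show "i \<in> {i. i < n \<and> i mod m = r}" using k assms by simp
  qed
  moreover have "inj_on (\<lambda>k. r + m * k) {..<n div m}" using assms by (auto simp: inj_on_def)
  ultimately show ?thesis by (simp add: card_image)
qed

text \<open>Multiplication by \<open>e\<close> commutes with \<open>conj h (mu x)\<close>. Pulled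
  back along \<open>h\<close> it commutes with \<open>x\<close>, hence with \<open>K\<close>, so it
  is multiplication by some \<open>e'\<close>. Comparing coefficients in
  \<open>h (e' * z) = e * h z\<close> gives \<open>e' ^ q ^ k = e\<close> for every \<open>k\<close>
  in the support of \<open>c\<close>. Two such \<open>k\<close> differ by the exponent of a
  Frobenius power fixing \<open>e\<close>, that is, by a multiple of \<open>m\<close>.\<close>

lemma conj_mu_support:
  assumes S: "closed S" and e: "e \<in> K" "\<And>t. e ^ (q ^ t) = e \<Longrightarrow> m dvd t"
    and comm: "\<And>s z. s \<in> S \<Longrightarrow> z \<in> K \<Longrightarrow> s (e * z) = e * s z"
    and h: "h \<in> GL" "conj h (mu x) \<in> S" "h = lp c" "\<And>i. i < n \<Longrightarrow> c i \<in> K"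
    and ij: "i < n" "j < n" "c i \<noteq> 0" "c j \<noteq> 0"
  shows "i mod m = j mod m"
proof -
  let ?g = "\<lambda>z. gl_inv h (e * h z)"
  have hE: "h z \<in> K" if "z \<in> K" for z using h(1) that by (auto intro: E_mem GL_E)
  have gx: "?g (x * z) = x * ?g z" if z: "z \<in> K" for z
  proof (rule GL_eqD[OF h(1)])
    have "conj h (mu x) (e * h z) = e * conj h (mu x) (h z)"
      using comm h(2) z hE by blast
    thus "h (?g (x * z)) = h (x * ?g z)"
      using z h(1) e hE by (simp add: conj_def mu_def gl_inv_left gl_inv_right gl_inv_mem mult_mem)
  qed (use z h(1) e(1) hE in \<open>simp_all add: mult_mem gl_inv_mem\<close>)
  \<comment> \<open>A map commuting with multiplication by \<open>x\<close> is determined by its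
    value at \<open>1\<close>, because the powers of \<open>x\<close> exhaust the nonzero
    elements.\<close>
  define e' where "e' = ?g 1"
  have e'K: "e' \<in> K" unfolding e'_def by (intro gl_inv_mem h mult_mem e hE) simp
  have pow: "?g (x ^ k) = e' * x ^ k" for k
  proof (induction k)
    case (Suc k)
    thus ?case using gx[of "x ^ k"] by (simp add: pow_mem mult.left_commute)
  qed (simp add: e'_def)
  have he: "h (e' * z) = e * h z" if z: "z \<in> K" for z
  proof (cases "z = 0")
    case False
    then obtain k where "z = x ^ k" using gen z by auto
    hence "h (e' * z) = h (?g z)" using pow by simp
    thus ?thesis using z h(1) e hE by (simp add: gl_inv_right mult_mem)
  qed (use E_zero[OF GL_E[OF h(1)]] in simp)
  have eq: "(\<Sum>k<n. (c k * e' ^ q ^ k) * z ^ q ^ k) = (\<Sum>k<n. (c k * e) * z ^ q ^ k)" if "z \<in> K" for z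
    using he[OF that] that e'K
    by (simp add: h(3) lp_def mult_mem sum_distrib_left power_mult_distrib mult_ac)
  have "e' ^ q ^ k = e" if "k < n" "c k \<noteq> 0" for k
    using lp_inj[OF eq \<open>k < n\<close>] that by simp
  hence e'k: "e' ^ q ^ i = e" "e' ^ q ^ j = e" using ij by auto
  have "a mod m = b mod m" if "a \<le> b" "e' ^ q ^ a = e" "e' ^ q ^ b = e" for a b
  proof -
    have "e ^ (q ^ (b - a)) = e" using frob_frob[of e' a "b - a"] that by simp
    hence "m dvd b - a" by (rule e(2))
    thus ?thesis using \<open>a \<le> b\<close> by (metis mod_eq_dvd_iff_nat)
  qed
  thus ?thesis using e'k by (metis nat_le_linear)
qed

text \<open>The sum of the coefficients is the value of the map at \<open>1\<close>, which is
  nonzero for an invertible map. Trading \<open>c r\<close> for this value leaves \<open>N\<close>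
  choices for it and \<open>q ^ n\<close> for each of the other \<open>n div m - 1\<close>
  coefficients. Having exactly \<open>N\<close> here is what later cancels the first factor of the
  order of \<open>GL\<close>.\<close>

lemma card_class_lp:
  assumes m: "m dvd n" "m > 0" "r < m"
  defines "B \<equiv> {c \<in> {..<n} \<rightarrow>\<^sub>E K. (\<forall>i<n. c i \<noteq> 0 \<longrightarrow> i mod m = r) \<and> (\<Sum>i<n. c i) \<noteq> 0}"
  shows "card B \<le> N * q ^ (n * (n div m - 1))"
proof -
  define I where "I = {i. i < n \<and> i mod m = r}"
  have "m \<le> n" using m by (simp add: dvd_imp_le)
  hence rI: "r \<in> I" using m by (simp add: I_def)
  have fI: "finite I" by (simp add: I_def)
  let ?f = "\<lambda>c. (\<Sum>i<n. c i, restrict c (I - {r}))"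
  have sumI: "(\<Sum>i<n. c i) = c r + (\<Sum>i\<in>I - {r}. c i)" if "c \<in> B" for c
  proof -
    have "(\<Sum>i<n. c i) = (\<Sum>i\<in>I. c i)"
      by (rule sum.mono_neutral_right) (use that in \<open>auto simp: B_def I_def\<close>)
    thus ?thesis using rI fI by (simp add: sum.remove)
  qed
  have "inj_on ?f B"
  proof (rule inj_onI)
    fix c c' assume cc: "c \<in> B" "c' \<in> B" "?f c = ?f c'"
    have eqI: "c i = c' i" if "i \<in> I - {r}" for i using cc(3) that by (metis prod.inject restrict_apply')
    hence "(\<Sum>i\<in>I - {r}. c i) = (\<Sum>i\<in>I - {r}. c' i)" by simp
    hence eqr: "c r = c' r" using cc(3) sumI[OF cc(1)] sumI[OF cc(2)] by simp
    show "c = c'"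
    proof (rule PiE_ext[of c "{..<n}" "\<lambda>_. K"])
      fix i assume i: "i \<in> {..<n}"
      show "c i = c' i"
      proof (cases "i \<in> I")
        case False
        hence "c i = 0" "c' i = 0" using cc i by (auto simp: B_def I_def)
        thus ?thesis by simp
      qed (use eqI eqr in \<open>cases "i = r"; auto\<close>)
    qed (use cc in \<open>auto simp: B_def\<close>)
  qed
  moreover have "?f ` B \<subseteq> (K - {0}) \<times> (I - {r} \<rightarrow>\<^sub>E K)"
  proof
    fix y assume "y \<in> ?f ` B"
    then obtain c where c: "y = ?f c" "c \<in> B" by auto
    hence "c i \<in> K" if "i < n" for i using that by (auto simp: B_def)
    thus "y \<in> (K - {0}) \<times> (I - {r} \<rightarrow>\<^sub>E K)"
      using c by (auto simp: B_def I_def restrict_PiE_iff intro!: sum_mem)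
  qed
  moreover have "finite ((K - {0}) \<times> (I - {r} \<rightarrow>\<^sub>E K))"
    using fI by (intro finite_cartesian_product finite_PiE) auto
  ultimately have "card B \<le> card ((K - {0}) \<times> (I - {r} \<rightarrow>\<^sub>E K))" by (rule card_inj_on_le)
  also have "\<dots> = N * (q ^ n) ^ (n div m - 1)"
    using fI rI card_residue_class[OF m]
    by (simp add: card_cartesian_product card_PiE card_K N_def I_def[symmetric])
  finally show ?thesis by (simp add: power_mult)
qed

text \<open>The factor \<open>m\<close> comes from the \<open>m\<close> possible residue classes of
  the support.\<close>

lemma card_conj_mu_aux:
  assumes S: "closed S" and ne: "S \<noteq> E" and xS: "mu x \<in> S"
  obtains m where "m dvd n" "m \<ge> 2" "card {h \<in> GL. conj h (mu x) \<in> S} \<le> N * (m * q ^ (n * (n div m - 1)))"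
proof -
  obtain m e where me: "m dvd n" "m \<ge> 2" "e \<in> K" "\<And>t. e ^ (q ^ t) = e \<Longrightarrow> m dvd t"
    "\<And>s z. s \<in> S \<Longrightarrow> z \<in> K \<Longrightarrow> s (e * z) = e * s z"
    using proper_commutes[OF assms] by blast
  define B where "B r = {c \<in> {..<n} \<rightarrow>\<^sub>E K. (\<forall>i<n. c i \<noteq> 0 \<longrightarrow> i mod m = r) \<and> (\<Sum>i<n. c i) \<noteq> 0}" for r
  have finB: "finite (B r)" for r unfolding B_def by (rule finite_subset[of _ "{..<n} \<rightarrow>\<^sub>E K"]) (auto intro!: finite_PiE)
  have "{h \<in> GL. conj h (mu x) \<in> S} \<subseteq> (\<Union>r<m. lp ` B r)"
  proof
    fix h assume "h \<in> {h \<in> GL. conj h (mu x) \<in> S}"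
    hence h: "h \<in> GL" "conj h (mu x) \<in> S" by auto
    obtain c where c: "h = lp c" "\<And>i. i < n \<Longrightarrow> c i \<in> K" "c \<in> {..<n} \<rightarrow>\<^sub>E K"
      using lp_obtain[OF GL_E[OF h(1)]] by blast
    have "h 1 \<noteq> h 0" using GL_eqD[OF h(1), of 1 0] by auto
    hence "h 1 \<noteq> 0" using E_zero[OF GL_E[OF h(1)]] by simp
    hence s: "(\<Sum>i<n. c i) \<noteq> 0" by (simp add: c(1) lp_def)
    then obtain j where j: "j < n" "c j \<noteq> 0" by (metis lessThan_iff sum.neutral)
    have "c \<in> B (j mod m)"
      using c(3) s conj_mu_support[OF S me(3,4,5) h c(1,2) _ j(1) _ j(2)] by (auto simp: B_def)
    moreover have "j mod m < m" using me(2) by simp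
    ultimately show "h \<in> (\<Union>r<m. lp ` B r)" using c(1) by blast
  qed
  hence "card {h \<in> GL. conj h (mu x) \<in> S} \<le> card (\<Union>r<m. lp ` B r)"
    by (rule card_mono[rotated]) (auto simp: finB)
  also have "\<dots> \<le> (\<Sum>r<m. card (lp ` B r))" by (rule card_UN_le) simp
  also have "\<dots> \<le> (\<Sum>r<m. N * q ^ (n * (n div m - 1)))"
  proof (rule sum_mono)
    fix r assume "r \<in> {..<m}"
    hence "card (B r) \<le> N * q ^ (n * (n div m - 1))"
      unfolding B_def using me by (intro card_class_lp) auto
    thus "card (lp ` B r) \<le> N * q ^ (n * (n div m - 1))"
      using card_image_le[OF finB, of lp r] by linarith
  qed
  finally show thesis by (intro that[OF me(1,2)]) (simp add: mult_ac)
qed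

section \<open>Conjugation as an automorphism of \<open>E\<close>\<close>

lemma gl_inv_comp: "g \<in> GL \<Longrightarrow> h \<in> GL \<Longrightarrow> gl_inv (g \<circ> h) = gl_inv h \<circ> gl_inv g"
proof (rule E_ext)
  assume gh: "g \<in> GL" "h \<in> GL"
  show "gl_inv (g \<circ> h) \<in> E" "gl_inv h \<circ> gl_inv g \<in> E"
    using gh by (auto intro!: GL_E gl_inv_GL GL_comp E_comp)
  fix z assume z: "z \<in> K"
  show "gl_inv (g \<circ> h) z = (gl_inv h \<circ> gl_inv g) z"
    by (rule GL_eqD[OF GL_comp[OF gh]], unfold gl_inv_right[OF GL_comp[OF gh] z])
      (use gh z in \<open>simp_all add: gl_inv_mem gl_inv_right GL_comp\<close>)
qed

lemma conj_conj: "g \<in> GL \<Longrightarrow> h \<in> GL \<Longrightarrow> conj g (conj h f) = conj (g \<circ> h) f"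
  by (simp add: conj_def gl_inv_comp comp_assoc)

lemma conj_gl_inv: "h \<in> GL \<Longrightarrow> f \<in> E \<Longrightarrow> conj h (conj (gl_inv h) f) = f"
proof (rule E_ext)
  assume h: "h \<in> GL" and f: "f \<in> E"
  show "conj h (conj (gl_inv h) f) \<in> E" by (intro conj_E gl_inv_GL h f)
  fix z assume z: "z \<in> K"
  have "gl_inv (gl_inv h) (gl_inv h z) = z"
    using gl_inv_left[OF gl_inv_GL[OF h] z] .
  thus "conj h (conj (gl_inv h) f) z = f z"
    using h f z by (simp add: conj_def gl_inv_right E_mem)
qed simp

lemma conj_apply: "conj h f z = h (f (gl_inv h z))"
  by (simp add: conj_def)

lemma conj_comp: "h \<in> GL \<Longrightarrow> f \<in> E \<Longrightarrow> g \<in> E \<Longrightarrow> conj h (f \<circ> g) = conj h f \<circ> conj h g"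
  by (rule E_ext) (simp_all add: conj_E E_comp conj_apply gl_inv_left gl_inv_mem E_mem)

lemma E_zero_fun: "(\<lambda>z. 0) \<in> E" by (simp add: E_def)
lemma E_plus: "f \<in> E \<Longrightarrow> g \<in> E \<Longrightarrow> (\<lambda>z. f z + g z) \<in> E"
  by (simp add: E_def add_mem distrib_left)
lemma E_minus: "f \<in> E \<Longrightarrow> g \<in> E \<Longrightarrow> (\<lambda>z. f z - g z) \<in> E"
  by (simp add: E_def diff_mem right_diff_distrib)

lemma conj_add:
  "h \<in> GL \<Longrightarrow> f \<in> E \<Longrightarrow> g \<in> E \<Longrightarrow> conj h (\<lambda>z. f z + g z) = (\<lambda>z. conj h f z + conj h g z)"
  by (rule E_ext; ((intro E_plus conj_E; assumption) |
      simp add: conj_apply gl_inv_mem E_mem E_add[OF GL_E]))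
lemma conj_diff:
  "h \<in> GL \<Longrightarrow> f \<in> E \<Longrightarrow> g \<in> E \<Longrightarrow> conj h (\<lambda>z. f z - g z) = (\<lambda>z. conj h f z - conj h g z)"
  by (rule E_ext; ((intro E_minus conj_E; assumption) |
      simp add: conj_apply gl_inv_mem E_mem E_diff[OF GL_E]))
lemma conj_zero: "h \<in> GL \<Longrightarrow> conj h (\<lambda>z. 0) = (\<lambda>z. 0)"
  using E_zero[OF GL_E] by (auto simp: conj_def)

lemma closed_conj_preimage:
  assumes S: "closed S" and h: "h \<in> GL"
  shows "closed {f \<in> E. conj h f \<in> S}"
  unfolding closed_def
  using S h by (auto simp: conj_zero closed_zero E_zero_fun E_plus E_minus E_comp conj_add conj_diff
      conj_comp closed_add closed_diff closed_comp)

lemma proper_conj_preimage: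
  assumes S: "closed S" and h: "h \<in> GL" and ne: "S \<noteq> E"
  shows "{f \<in> E. conj h f \<in> S} \<noteq> E"
proof
  assume eq: "{f \<in> E. conj h f \<in> S} = E"
  have "f \<in> S" if f: "f \<in> E" for f
  proof -
    have "conj (gl_inv h) f \<in> E" by (intro conj_E gl_inv_GL h f)
    hence "conj h (conj (gl_inv h) f) \<in> S" using eq by blast
    thus ?thesis by (simp add: conj_gl_inv h f)
  qed
  thus False using ne S by (auto simp: closed_def)
qed

text \<open>Conjugating \<open>S\<close> reduces to the case \<open>mu x \<in> S\<close>: given
  \<open>g\<close> with \<open>conj g (mu x) \<in> S\<close>, composing with \<open>gl_inv g\<close>
  injects the elements to be counted into those for the preimage of \<open>S\<close> under
  conjugation by \<open>g\<close>.\<close>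

lemma card_conj_mu:
  assumes S: "closed S" and ne: "S \<noteq> E"
  obtains m where "m dvd n" "m \<ge> 2" "card {h \<in> GL. conj h (mu x) \<in> S} \<le> N * (m * q ^ (n * (n div m - 1)))"
proof (cases "{h \<in> GL. conj h (mu x) \<in> S} = {}")
  case True
  \<comment> \<open>Nothing is counted here, so any divisor of \<open>n\<close> that is at least
    \<open>2\<close> will do.\<close>
  show thesis by (rule that[of n], simp, rule n_ge, simp only: True card.empty)
next
  case False
  then obtain g where g: "g \<in> GL" "conj g (mu x) \<in> S" by auto
  define T where "T = {f \<in> E. conj g f \<in> S}"
  have "closed T" "T \<noteq> E" "mu x \<in> T"
    using closed_conj_preimage[OF S g(1)] proper_conj_preimage[OF S g(1) ne] g by (auto simp: T_def mu_E)
  then obtain m where m: "m dvd n" "m \<ge> 2" "card {h \<in> GL. conj h (mu x) \<in> T} \<le> N * (m * q ^ (n * (n div m - 1)))"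
    by (rule card_conj_mu_aux)
  have "card {h \<in> GL. conj h (mu x) \<in> S} \<le> card {h \<in> GL. conj h (mu x) \<in> T}"
  proof (rule card_inj_on_le[where f = "\<lambda>h. gl_inv g \<circ> h"])
    have left: "g \<circ> (gl_inv g \<circ> h) = h" if "h \<in> GL" for h
    proof (rule E_ext)
      show "g \<circ> (gl_inv g \<circ> h) \<in> E" "h \<in> E"
        by (rule E_comp[OF GL_E[OF g(1)] E_comp[OF GL_E[OF gl_inv_GL[OF g(1)]] GL_E[OF that]]])
          (rule GL_E[OF that])
    qed (use that g in \<open>simp add: gl_inv_right E_mem GL_E\<close>)
    show "inj_on (\<lambda>h. gl_inv g \<circ> h) {h \<in> GL. conj h (mu x) \<in> S}"
      by (rule inj_onI) (metis left mem_Collect_eq)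
    show "(\<lambda>h. gl_inv g \<circ> h) ` {h \<in> GL. conj h (mu x) \<in> S} \<subseteq> {h \<in> GL. conj h (mu x) \<in> T}"
    proof clarify
      fix h assume h: "h \<in> GL" "conj h (mu x) \<in> S"
      have gh: "gl_inv g \<circ> h \<in> GL" by (intro GL_comp gl_inv_GL g h)
      have "conj g (conj (gl_inv g \<circ> h) (mu x)) \<in> S"
        using h by (simp only: conj_conj[OF g(1) gh] left)
      thus "gl_inv g \<circ> h \<in> GL \<and> conj (gl_inv g \<circ> h) (mu x) \<in> T"
        using gh by (simp add: T_def conj_E mu_E)
    qed
  qed simp
  thus thesis using m by (intro that[OF m(1,2)]) linarith
qed

section \<open>The order of the general linear group\<close>

lemma F_inverse: "a \<in> F \<Longrightarrow> inverse a \<in> F"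
  by (auto simp: F_def inverse_mem power_inverse)

text \<open>Linear independence over \<open>F\<close>, put as injectivity of the combination map;
  for \<open>k = n\<close> this is what makes \<open>lin v\<close> injective.\<close>

definition indep :: "nat \<Rightarrow> (nat \<Rightarrow> 'w) set" where
  "indep k = {v \<in> {..<k} \<rightarrow>\<^sub>E K. inj_on (\<lambda>c. \<Sum>j<k. c j * v j) ({..<k} \<rightarrow>\<^sub>E F)}"

lemma indep_extend:
  assumes v: "v \<in> indep k" and w: "w \<in> K" "w \<notin> (\<lambda>c. \<Sum>j<k. c j * v j) ` ({..<k} \<rightarrow>\<^sub>E F)"
  shows "v(k := w) \<in> indep (Suc k)"
proof -
  have "inj_on (\<lambda>c. \<Sum>j<Suc k. c j * (v(k := w)) j) ({..<Suc k} \<rightarrow>\<^sub>E F)"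
  proof (rule inj_onI)
    fix c c' assume c: "c \<in> {..<Suc k} \<rightarrow>\<^sub>E F" "c' \<in> {..<Suc k} \<rightarrow>\<^sub>E F"
      and "(\<Sum>j<Suc k. c j * (v(k := w)) j) = (\<Sum>j<Suc k. c' j * (v(k := w)) j)"
    hence eq: "(\<Sum>j<k. c j * v j) + c k * w = (\<Sum>j<k. c' j * v j) + c' k * w" by simp
    have cF: "c j \<in> F" "c' j \<in> F" if "j \<le> k" for j
      using PiE_mem[OF c(1), of j] PiE_mem[OF c(2), of j] that by simp_all
    have k: "c k = c' k"
    proof (rule ccontr)
      assume ne: "c k \<noteq> c' k"
      define a where "a = (\<lambda>j\<in>{..<k}. inverse (c k - c' k) * (c' j - c j))"
      have "(c k - c' k) * w = (\<Sum>j<k. (c' j - c j) * v j)"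
        using eq by (simp add: left_diff_distrib sum_subtractf algebra_simps)
      hence "w = inverse (c k - c' k) * (\<Sum>j<k. (c' j - c j) * v j)"
        using ne by (simp flip: mult.assoc \<open>(c k - c' k) * w = _\<close>)
      also have "\<dots> = (\<Sum>j<k. a j * v j)" by (simp add: a_def sum_distrib_left mult.assoc)
      finally have "w = (\<Sum>j<k. a j * v j)" .
      moreover have "a \<in> {..<k} \<rightarrow>\<^sub>E F"
        using cF by (auto simp: a_def intro!: F_mult F_inverse F_diff)
      ultimately show False using w(2) by blast
    qed
    have "restrict c {..<k} = restrict c' {..<k}"
    proof (rule inj_onD)
      show "inj_on (\<lambda>c. \<Sum>j<k. c j * v j) ({..<k} \<rightarrow>\<^sub>E F)" using v by (simp add: indep_def)
    qed (use eq k cF in auto)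
    hence lt: "c j = c' j" if "j < k" for j using that by (metis lessThan_iff restrict_apply')
    show "c = c'"
      by (rule PiE_ext[OF c]) (use k lt in \<open>auto simp: less_Suc_eq\<close>)
  qed
  thus ?thesis using v w(1) by (auto simp: indep_def PiE_iff extensional_def less_Suc_eq)
qed

text \<open>An independent \<open>k\<close>-tuple extends by any vector outside its span, and the
  span has at most \<open>q ^ k\<close> elements.\<close>

lemma card_indep: "(\<Prod>i<k. q ^ n - q ^ i) \<le> card (indep k)"
proof (induction k)
  case 0
  show ?case by (simp add: indep_def)
next
  case (Suc k)
  have fin: "finite (indep j)" for j
    unfolding indep_def by (rule finite_subset[of _ "{..<j} \<rightarrow>\<^sub>E K"]) (auto intro!: finite_PiE)
  define sp where "sp v = (\<lambda>c. \<Sum>j<k. c j * v j) ` ({..<k} \<rightarrow>\<^sub>E F)" for v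
  have "card F = q" using card_F by (simp add: F_def)
  have card_sp: "q ^ n - q ^ k \<le> card (K - sp v)" for v
  proof -
    have "card (sp v) \<le> card ({..<k} \<rightarrow>\<^sub>E F)" unfolding sp_def
      by (rule card_image_le) (auto intro!: finite_PiE)
    also have "\<dots> = q ^ k" by (simp add: card_PiE \<open>card F = q\<close>)
    finally have "card (sp v) \<le> q ^ k" .
    moreover have "card K - card (sp v) \<le> card (K - sp v)"
      by (rule diff_card_le_card_Diff) (auto simp: sp_def intro!: finite_PiE)
    ultimately show ?thesis by (simp add: card_K)
  qed
  have "(\<Prod>i<Suc k. q ^ n - q ^ i) = (\<Prod>i<k. q ^ n - q ^ i) * (q ^ n - q ^ k)" by simp
  also have "\<dots> \<le> card (indep k) * (q ^ n - q ^ k)" using Suc by simp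
  also have "\<dots> = (\<Sum>v\<in>indep k. q ^ n - q ^ k)" by simp
  also have "\<dots> \<le> (\<Sum>v\<in>indep k. card (K - sp v))" by (intro sum_mono card_sp)
  also have "\<dots> = card (SIGMA v:indep k. K - sp v)" using fin by simp
  also have "\<dots> \<le> card (indep (Suc k))"
  proof (rule card_inj_on_le[where f = "\<lambda>(v, w). v(k := w)"])
    show "inj_on (\<lambda>(v, w). v(k := w)) (SIGMA v:indep k. K - sp v)"
    proof (rule inj_onI, clarify)
      fix v w v' w' assume v: "v \<in> indep k" "v' \<in> indep k" and eq: "v(k := w) = v'(k := w')"
      have "v = v'"
      proof (rule PiE_ext[of v "{..<k}" "\<lambda>_. K"])
        fix i assume "i \<in> {..<k}"
        thus "v i = v' i" using fun_cong[OF eq, of i] by simp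
      qed (use v in \<open>auto simp: indep_def\<close>)
      thus "v = v' \<and> w = w'" using fun_cong[OF eq, of k] by simp
    qed
  qed (use fin in \<open>auto simp: sp_def intro!: indep_extend\<close>)
  finally show ?case .
qed

lemma card_GL: "(\<Prod>i<n. q ^ n - q ^ i) \<le> card GL"
proof -
  have "card (indep n) \<le> card GL"
  proof (rule card_inj_on_le[where f = lin])
    show "inj_on lin (indep n)"
      using lin_bij by (auto simp: bij_betw_def indep_def intro: inj_on_subset)
    show "lin ` indep n \<subseteq> GL"
    proof
      fix f assume "f \<in> lin ` indep n"
      then obtain v where v: "v \<in> indep n" "f = lin v" by auto
      have fE: "f \<in> E" using v lin_bij by (auto simp: bij_betw_def indep_def)
      have "inj_on f K"
      proof (rule inj_onI)
        fix y z assume yz: "y \<in> K" "z \<in> K" "f y = f z"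
        have "inj_on (\<lambda>c. \<Sum>j<n. c j * v j) ({..<n} \<rightarrow>\<^sub>E F)" using v by (simp add: indep_def)
        moreover have "(\<Sum>j<n. coord y j * v j) = (\<Sum>j<n. coord z j * v j)"
          using yz by (simp add: v lin_def)
        ultimately have "coord y = coord z" using yz coord_mem by (meson inj_onD)
        thus "y = z" using comb_coord[OF yz(1)] comb_coord[OF yz(2)] by metis
      qed
      moreover from this have "f ` K = K" using fE by (intro endo_inj_surj) (auto simp: E_mem)
      ultimately have "bij_betw f K K" by (simp add: bij_betw_def)
      thus "f \<in> GL" using fE by (simp add: GL_def)
    qed
  qed simp
  thus ?thesis using card_indep[of n] by linarith
qed

text \<open>Only the conjugates of \<open>mu x\<close> have to be covered. The bound then applies to
  those members of a cover that meet them and leaves the others for further elements when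
  \<open>n = 3\<close> and \<open>q = 2\<close>.\<close>

definition singer_family :: "('w \<Rightarrow> 'w) set set \<Rightarrow> bool" where
  "singer_family C \<longleftrightarrow> (\<forall>S\<in>C. closed S \<and> S \<noteq> E) \<and> (\<forall>h\<in>GL. \<exists>S\<in>C. conj h (mu x) \<in> S)"

text \<open>The divisor varies with the member of \<open>C\<close>; one that maximizes
  \<open>m * q ^ (n * (n div m - 1))\<close> serves for all. The factor \<open>N\<close> occurs in
  the order of \<open>GL\<close> and in the count for each member, and cancels.\<close>

lemma singer_family_bound:
  assumes "finite C" and C: "singer_family C"
  obtains m where "m dvd n" "m \<ge> 2" "(\<Prod>i\<in>{1..<n}. q ^ n - q ^ i) \<le> card C * (m * q ^ (n * (n div m - 1)))"
proof -
  define b where "b m = m * q ^ (n * (n div m - 1))" for m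
  define D where "D = {m. m dvd n \<and> m \<ge> 2}"
  have D: "finite D" "D \<noteq> {}" using n_ge dvd_refl[of n] unfolding D_def by (fastforce, blast)
  have "Max (b ` D) \<in> b ` D" using D by (intro Max_in) auto
  then obtain m where m: "m \<in> D" "Max (b ` D) = b m" by auto
  have max: "b l \<le> b m" if "l \<in> D" for l using that D m(2) by (metis Max_ge finite_imageI imageI)
  have each: "card {h \<in> GL. conj h (mu x) \<in> S} \<le> N * b m" if S: "S \<in> C" for S
  proof -
    have "closed S" "S \<noteq> E" using C S by (auto simp: singer_family_def)
    then obtain l where l: "l dvd n" "l \<ge> 2" "card {h \<in> GL. conj h (mu x) \<in> S} \<le> N * (l * q ^ (n * (n div l - 1)))"
      by (rule card_conj_mu)
    moreover have "N * b l \<le> N * b m" using max[of l] l by (simp add: D_def)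
    ultimately show ?thesis by (fold b_def) (rule le_trans)
  qed
  have "N * (\<Prod>i\<in>{1..<n}. q ^ n - q ^ i) = (\<Prod>i<n. q ^ n - q ^ i)"
  proof -
    have "{..<n} = insert 0 {1..<n}" using n_pos by auto
    thus ?thesis by (simp add: N_def)
  qed
  also have "\<dots> \<le> card GL" by (rule card_GL)
  also have "\<dots> \<le> card (\<Union>S\<in>C. {h \<in> GL. conj h (mu x) \<in> S})"
    by (rule card_mono) (use C \<open>finite C\<close> in \<open>auto simp: singer_family_def\<close>)
  also have "\<dots> \<le> (\<Sum>S\<in>C. card {h \<in> GL. conj h (mu x) \<in> S})" by (rule card_UN_le[OF \<open>finite C\<close>])
  also have "\<dots> \<le> card C * (N * b m)" using sum_bounded_above[OF each, of C] by simp
  finally have "N * (\<Prod>i\<in>{1..<n}. q ^ n - q ^ i) \<le> N * (card C * b m)" by (simp add: mult_ac)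
  hence "(\<Prod>i\<in>{1..<n}. q ^ n - q ^ i) \<le> card C * b m" using N_pos by simp
  thus thesis using that m by (auto simp: D_def b_def)
qed

text \<open>The elements \<open>mu c \<circ> fr 1\<close> have order 3, unlike the nontrivial elements of a field of order 8,
  and the quotient of two of them generates \<open>K\<close>.\<close>
lemma cover_bound_3_2:
  assumes n: "n = 3" and q: "q = 2" and fin: "finite C" and C: "\<And>S. S \<in> C \<Longrightarrow> closed S \<and> S \<noteq> E"
    and cov: "E \<subseteq> \<Union>C"
  shows "15 \<le> card C"
proof -
  \<comment> \<open>\<open>C1\<close> and \<open>C2\<close> turn out to be disjoint, with at least 8
    and 7 members.\<close>
  define C1 where "C1 = {S \<in> C. \<exists>h\<in>GL. conj h (mu x) \<in> S}"
  define y where "y c = mu c \<circ> fr 1" for c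
  define C2 where "C2 = {S \<in> C. \<exists>c\<in>K - {0}. y c \<in> S}"
  have N7: "N = 7" unfolding N_def by (simp add: n q)
  have pow7: "c ^ 7 = 1" if "c \<in> K" "c \<noteq> 0" for c
  proof -
    have "c * c ^ 7 = c" using pow_qn[OF that(1)] by (simp add: n q flip: power_Suc)
    thus ?thesis using that by simp
  qed
  have yz: "y c z = c * z ^ 2" if "c \<in> K" "z \<in> K" for c z
    using that pow_mem[OF that(2), of 2] unfolding y_def mu_def fr_def by (simp add: q)
  have fr1: "fr 1 \<in> E"
    by (auto simp: E_def fr_def pow_mem pow_q_add power_mult_distrib mult_mem F_K add_mem) (auto simp: F_def)
  have yE: "y c \<in> E" if "c \<in> K" for c unfolding y_def by (intro E_comp mu_E fr1 that)
  have y3: "y c \<circ> (y c \<circ> y c) = mu 1" if "c \<in> K" "c \<noteq> 0" for c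
  proof (rule E_ext)
    fix z assume z: "z \<in> K"
    have "(y c \<circ> (y c \<circ> y c)) z = c * (c * (c * z ^ 2) ^ 2) ^ 2"
      using that z by (simp add: yz mult_mem pow_mem)
    also have "\<dots> = c ^ 7 * z ^ 8" by (simp add: power_mult_distrib eval_nat_numeral)
    also have "\<dots> = mu 1 z" using pow7[OF that] pow_qn[OF z] z by (simp add: mu_def n q)
    finally show "(y c \<circ> (y c \<circ> y c)) z = mu 1 z" .
  qed (use that in \<open>auto intro!: E_comp yE mu_E\<close>)
  have "finite C1" "finite C2" using fin by (auto simp: C1_def C2_def)
  have "singer_family C1"
    unfolding singer_family_def
  proof (intro conjI ballI)
    fix h assume h: "h \<in> GL"
    hence "conj h (mu x) \<in> E" by (intro conj_E mu_E) auto
    then obtain S where "S \<in> C" "conj h (mu x) \<in> S" using cov by auto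
    thus "\<exists>S\<in>C1. conj h (mu x) \<in> S" using h by (auto simp: C1_def)
  qed (use C in \<open>auto simp: C1_def\<close>)
  then obtain m where m: "m dvd n" "m \<ge> 2"
    "(\<Prod>i\<in>{1..<n}. q ^ n - q ^ i) \<le> card C1 * (m * q ^ (n * (n div m - 1)))"
    using singer_family_bound[OF \<open>finite C1\<close>] by blast
  have "m \<le> 3" using m(1) n by (simp add: dvd_imp_le)
  hence "m = 2 \<or> m = 3" using m(2) by linarith
  hence "m = 3" using m(1) n by auto
  moreover have "{1..<n} = {1, 2}" using n by auto
  \<comment> \<open>For \<open>m = 3\<close> the bound reads
    \<open>(8 - 2) * (8 - 4) \<le> card C1 * 3\<close>.\<close>
  ultimately have card1: "8 \<le> card C1" using m(3) by (simp add: n q)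
  \<comment> \<open>Two different maps \<open>y c\<close> and \<open>y c'\<close> in
    \<open>S\<close> would force \<open>mu x \<in> S\<close>, and then \<open>S\<close> commutes
    with multiplication by some \<open>e\<close> outside \<open>F\<close>. But \<open>y c\<close>
    squares its argument up to the factor \<open>c\<close>, so it commutes with \<open>e\<close>
    only if \<open>e ^ 2 = e\<close>.\<close>
  have two: "c = c'" if S: "S \<in> C" and c: "c \<in> K - {0}" "c' \<in> K - {0}" "y c \<in> S" "y c' \<in> S" for S c c'
  proof (rule ccontr)
    assume "c \<noteq> c'"
    have cl: "closed S" "S \<noteq> E" using C[OF S] by auto
    define a where "a = c' * inverse c"
    have aK: "a \<in> K" using c by (auto simp: a_def intro!: mult_mem inverse_mem)
    have "y c' \<circ> (y c \<circ> y c) = mu a"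
    proof (rule E_ext)
      fix z assume z: "z \<in> K"
      have "(y c' \<circ> (y c \<circ> y c)) z = c' * (c * (c * z ^ 2) ^ 2) ^ 2"
        using c z by (simp add: yz mult_mem pow_mem)
      also have "\<dots> = c' * c ^ 6 * z ^ 8" by (simp add: power_mult_distrib eval_nat_numeral)
      also have "c ^ 6 = inverse c" using pow7[of c] c
        by (metis Diff_iff inverse_unique power_Suc eval_nat_numeral(3) semiring_norm(26,27,28) numeral_eq_Suc pred_numeral_simps(3) insert_iff)
      finally show "(y c' \<circ> (y c \<circ> y c)) z = mu a z" using pow_qn[OF z] z by (simp add: mu_def n q a_def)
    qed (use c aK in \<open>auto intro!: E_comp yE mu_E\<close>)
    hence aS: "mu a \<in> S" using cl c by (metis closed_comp)
    have a1: "a \<noteq> 1" "a \<noteq> 0" using \<open>c \<noteq> c'\<close> c by (auto simp: a_def field_simps)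
    obtain k where k: "a = x ^ k" using gen aK a1 by auto
    have "k mod 7 \<noteq> 0"
    proof
      assume "k mod 7 = 0"
      hence "x ^ k = x ^ 0" unfolding x_pow_eq_iff N7 by simp
      thus False using a1 k by simp
    qed
    moreover have "k mod 7 < 7" by simp
    ultimately have "k mod 7 \<in> {1, 2, 3, 4, 5, 6}" by (auto; presburger)
    \<comment> \<open>As \<open>7\<close> is prime, \<open>a\<close> is again a generator: the list
      holds the inverses of 1, 2, 3, 4, 5, 6 modulo \<open>7\<close>, in this order.\<close>
    hence "\<exists>j\<in>{1, 4, 5, 2, 3, 6}. (k mod 7) * j mod 7 = 1" by auto
    then obtain j where j: "(k mod 7) * j mod 7 = 1" by blast
    hence "x ^ (k * j) = x ^ 1" unfolding x_pow_eq_iff N7 by (simp add: mod_mult_left_eq)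
    hence xa: "x = a ^ j" by (simp add: k power_mult)
    have "mu (a ^ i) \<in> S" for i
    proof (induction i)
      case 0
      have "mu 1 \<in> S" using y3[of c] c cl by (metis Diff_iff closed_comp insert_iff)
      thus ?case by simp
    next
      case (Suc i)
      thus ?case using closed_comp[OF cl(1) aS Suc] aK by (simp add: mu_mu pow_mem)
    qed
    hence xS: "mu x \<in> S" using xa by metis
    obtain m e where me: "m dvd n" "m \<ge> 2" "e \<in> K" "\<And>t. e ^ (q ^ t) = e \<Longrightarrow> m dvd t"
      "\<And>s z. s \<in> S \<Longrightarrow> z \<in> K \<Longrightarrow> s (e * z) = e * s z"
      using proper_commutes[OF cl xS] by blast
    have "c * e ^ 2 = e * c" using me(5)[OF c(3), of 1] c me(3) by (simp add: yz)
    hence "e ^ (q ^ 1) = e" using c by (simp add: q)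
    hence "m dvd 1" by (rule me(4))
    thus False using me(2) by simp
  qed
  have card2: "7 \<le> card C2"
  proof -
    have "\<exists>S\<in>C. y c \<in> S" if "c \<in> K - {0}" for c using yE[of c] cov that by auto
    then obtain g where g: "\<And>c. c \<in> K - {0} \<Longrightarrow> g c \<in> C \<and> y c \<in> g c" by metis
    have "card (K - {0}) \<le> card C2"
    proof (rule card_inj_on_le)
      show "inj_on g (K - {0})" by (rule inj_onI) (metis g two)
      show "g ` (K - {0}) \<subseteq> C2" using g by (auto simp: C2_def)
    qed fact
    thus ?thesis by (simp add: card_K n q)
  qed
  \<comment> \<open>After conjugation, a common member contains \<open>mu x\<close> and a conjugate
    \<open>u\<close> of \<open>y c\<close>. Since \<open>3\<close> is prime, \<open>m = 3\<close>
    and only the exponent \<open>0\<close> occurs in \<open>u\<close>, which is therefore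
    multiplication by \<open>b 0\<close>. Then \<open>b 0 ^ 3 = 1\<close> and
    \<open>b 0 ^ 7 = 1\<close> make \<open>u\<close>, and hence \<open>y c\<close>, the identity on
    \<open>K\<close>, which it is not.\<close>
  have "C1 \<inter> C2 = {}"
  proof (rule ccontr)
    assume "C1 \<inter> C2 \<noteq> {}"
    then obtain S h c where S: "S \<in> C" and h: "h \<in> GL" "conj h (mu x) \<in> S" and c: "c \<in> K" "c \<noteq> 0" "y c \<in> S"
      by (auto simp: C1_def C2_def)
    have cl: "closed S" "S \<noteq> E" using C[OF S] by auto
    define T where "T = {f \<in> E. conj h f \<in> S}"
    define u where "u = conj (gl_inv h) (y c)"
    have T: "closed T" "T \<noteq> E" "mu x \<in> T"
      using closed_conj_preimage[OF cl(1) h(1)] proper_conj_preimage[OF cl(1) h(1) cl(2)] h by (auto simp: T_def mu_E)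
    have uE: "u \<in> E" using h c by (auto simp: u_def intro!: conj_E yE gl_inv_GL)
    hence uT: "u \<in> T" using c h by (simp add: T_def u_def conj_gl_inv yE)
    obtain m e where me: "m dvd n" "m \<ge> 2" "e \<in> K" "\<And>t. e ^ (q ^ t) = e \<Longrightarrow> m dvd t"
      "\<And>s z. s \<in> T \<Longrightarrow> z \<in> K \<Longrightarrow> s (e * z) = e * s z"
      using proper_commutes[OF T] by blast
    obtain b where b: "u = lp b" "\<And>i. i < n \<Longrightarrow> b i \<in> K" using lp_obtain[OF uE] by blast
    have "b i = 0" if "i < n" "i > 0" for i
    proof (rule ccontr)
      assume "b i \<noteq> 0"
      have "fr i \<in> T" by (rule closed_fr[OF T(1,3), where c = b]) (use uT b \<open>i < n\<close> \<open>b i \<noteq> 0\<close> in auto)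
      hence "e ^ (q ^ i) = e" using me(5)[of "fr i" 1] me(3) by (simp add: fr_def)
      hence "m dvd i" by (rule me(4))
      moreover have "i = 1 \<or> i = 2" using that n by linarith
      ultimately have "m dvd 1 \<or> m dvd 2" by auto
      hence "m dvd 2" by auto
      moreover have "m dvd 3" using me(1) n by simp
      ultimately have "m dvd 3 - 2" by (metis dvd_diff_nat)
      thus False using me(2) by simp
    qed
    hence ub: "u z = b 0 * z" if "z \<in> K" for z
      using that unfolding b(1) lp_def by (simp add: n numeral_3_eq_3 lessThan_Suc)
    have b0: "b 0 \<in> K" using b(2) by simp
    have "conj (gl_inv h) (y c \<circ> (y c \<circ> y c)) = u \<circ> (u \<circ> u)"
      using h c by (simp add: conj_comp gl_inv_GL E_comp yE u_def)
    hence "u \<circ> (u \<circ> u) = conj (gl_inv h) (mu 1)" using y3 c by simp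
    moreover have "conj (gl_inv h) (mu 1) 1 = 1"
      using h gl_inv_right[OF gl_inv_GL[OF h(1)], of 1] gl_inv_mem[OF gl_inv_GL[OF h(1)], of 1]
      by (simp add: conj_def mu_def)
    ultimately have "u (u (u 1)) = 1" by (metis comp_apply)
    hence b3: "b 0 ^ 3 = 1" using b0 by (simp add: ub mult_mem power3_eq_cube mult.assoc)
    hence "b 0 \<noteq> 0" by auto
    hence "b 0 ^ 7 = 1" using pow7 b0 by simp
    moreover have "b 0 ^ 7 = b 0 ^ 3 * b 0 ^ 3 * b 0" by (simp add: eval_nat_numeral)
    ultimately have "b 0 = 1" using b3 by simp
    hence "u = mu 1" by (intro E_ext uE mu_E) (simp_all add: ub mu_def)
    have "y c = conj h u" using h c by (simp add: u_def conj_gl_inv yE)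
    also have "\<dots> = mu 1"
      unfolding \<open>u = mu 1\<close>
    proof (rule E_ext)
      show "conj h (mu 1) \<in> E" "mu 1 \<in> E" using h by (auto intro!: conj_E mu_E)
    qed (use h in \<open>simp add: conj_apply mu_def gl_inv_mem gl_inv_right\<close>)
    finally have "y c z = z" if "z \<in> K" for z using that by (simp add: mu_def)
    hence cz: "c * z ^ 2 = z" if "z \<in> K" for z using yz[OF c(1) that] that by simp
    hence "x ^ 2 = x ^ 1" using cz[OF one_mem] cz[OF x_mem] by simp
    thus False unfolding x_pow_eq_iff N7 by simp
  qed
  hence "card C1 + card C2 = card (C1 \<union> C2)"
    using \<open>finite C1\<close> \<open>finite C2\<close> by (simp add: card_Un_disjoint)
  also have "\<dots> \<le> card C" using fin by (intro card_mono) (auto simp: C1_def C2_def)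
  finally show ?thesis using card1 card2 by simp
qed

end

section \<open>Covers by stabilizers of projective points\<close>

lemma sigma_le: "is_cover R C \<Longrightarrow> finite C \<Longrightarrow> sigma R \<le> enat (card C)"
  unfolding sigma_def by (rule INF_lower2[of C]) auto

lemma sigma_ge:
  assumes "\<And>C. is_cover R C \<Longrightarrow> finite C \<Longrightarrow> k \<le> card C"
  shows "enat k \<le> sigma R"
  unfolding sigma_def by (rule INF_greatest) (use assms in auto)

lemma is_subfieldD:
  assumes "is_subfield K"
  shows "0 \<in> K" "1 \<in> K" "a \<in> K \<Longrightarrow> b \<in> K \<Longrightarrow> a + b \<in> K" "a \<in> K \<Longrightarrow> b \<in> K \<Longrightarrow> a - b \<in> K"
    "a \<in> K \<Longrightarrow> b \<in> K \<Longrightarrow> a * b \<in> K" "a \<in> K \<Longrightarrow> - a \<in> K" "a \<in> K \<Longrightarrow> inverse a \<in> K"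
proof -
  show "- a \<in> K" if "a \<in> K"
    using assms that unfolding is_subfield_def by (metis diff_0)
  show "inverse a \<in> K" if "a \<in> K"
    using assms that unfolding is_subfield_def by (cases "a = 0") auto
qed (use assms in \<open>auto simp: is_subfield_def\<close>)

lemma is_subfield_sum: "is_subfield K \<Longrightarrow> (\<And>i. i \<in> I \<Longrightarrow> f i \<in> K) \<Longrightarrow> sum f I \<in> K"
  by (induction I rule: infinite_finite_induct) (auto intro: is_subfieldD)

lemma mult_mat_entry:
  "A \<in> carrier_mat m m \<Longrightarrow> B \<in> carrier_mat m m \<Longrightarrow> i < m \<Longrightarrow> j < m \<Longrightarrow>
    (A * B) $$ (i, j) = (\<Sum>k<m. A $$ (i, k) * B $$ (k, j))"
  by (simp add: scalar_prod_def lessThan_atLeast0)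

section \<open>Subrings of matrix rings as closed sets of matrices\<close>

definition mat_closed :: "nat \<Rightarrow> 'k::field mat set \<Rightarrow> bool" where
  "mat_closed m S \<longleftrightarrow> S \<subseteq> carrier_mat m m \<and> 0\<^sub>m m m \<in> S \<and> (\<forall>A\<in>S. - A \<in> S) \<and>
     (\<forall>A\<in>S. \<forall>B\<in>S. A + B \<in> S \<and> A * B \<in> S)"

abbreviation mat_ring :: "nat \<Rightarrow> 'k::field mat set \<Rightarrow> 'k mat ring" where
  "mat_ring m H \<equiv> (ring_mat TYPE('k) m ())\<lparr>carrier := H\<rparr>"

text \<open>The negative in a ring record is chosen within its carrier, so it must be identified
  with the matrix negative before \<open>subrng\<close> can be read as
  \<open>mat_closed\<close>.\<close>

lemma ring_mat_subset:
  assumes "mat_closed m H" "1\<^sub>m m \<in> H"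
  shows "ring (mat_ring m H)" and "A \<in> H \<Longrightarrow> \<ominus>\<^bsub>mat_ring m H\<^esub> A = - A"
proof -
  have H: "H \<subseteq> carrier_mat m m" using assms(1) by (simp add: mat_closed_def)
  interpret ring "ring_mat TYPE('a) m ()" by (rule ring_mat)
  have inv: "\<ominus>\<^bsub>ring_mat TYPE('a) m ()\<^esub> A = - A" if "A \<in> carrier_mat m m" for A
    using that by (intro minus_equality) (auto simp: ring_mat_def)
  have "subring H (ring_mat TYPE('a) m ())"
    by (rule subringI) (use assms H inv in \<open>auto simp: mat_closed_def ring_mat_def subset_iff\<close>)
  thus R: "ring (mat_ring m H)" by (rule subring_is_ring)
  show "\<ominus>\<^bsub>mat_ring m H\<^esub> A = - A" if "A \<in> H"
  proof -
    interpret S: ring "mat_ring m H" by (rule R)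
    show ?thesis by (rule S.minus_equality)
      (use that assms(1) H in \<open>auto simp: ring_mat_def mat_closed_def subset_iff\<close>)
  qed
qed

lemma subrng_mat_ring_iff:
  assumes "mat_closed m H" "1\<^sub>m m \<in> H"
  shows "subrng (mat_ring m H) S \<longleftrightarrow> S \<subseteq> H \<and> mat_closed m S"
proof (cases "S \<subseteq> H")
  case True
  hence "\<And>A. A \<in> S \<Longrightarrow> \<ominus>\<^bsub>mat_ring m H\<^esub> A = - A" using ring_mat_subset(2)[OF assms] by auto
  thus ?thesis using True assms by (auto simp: subrng_def mat_closed_def ring_mat_def)
qed (simp add: subrng_def)

definition MH :: "nat \<Rightarrow> 'k::field set \<Rightarrow> 'k mat set" where
  "MH n K = {M \<in> carrier_mat n n. \<forall>i<n. \<forall>j<n. M $$ (i, j) \<in> K}"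

definition AH :: "nat \<Rightarrow> 'k::field set \<Rightarrow> 'k set \<Rightarrow> 'k mat set" where
  "AH n K1 K2 = {M \<in> carrier_mat (n + 1) (n + 1).
        (\<forall>i<n. \<forall>j<n. M $$ (i, j) \<in> K1) \<and> (\<forall>j<n. M $$ (n, j) = 0) \<and> M $$ (n, n) \<in> K2}"

lemma matring_eq: "matring n K = mat_ring n (MH n K)" by (simp add: matring_def MH_def)
lemma Aring_eq: "Aring n K1 K2 = mat_ring (n + 1) (AH n K1 K2)" by (simp add: Aring_def AH_def)

lemma MH_closed:
  assumes "is_subfield K"
  shows "mat_closed n (MH n K)" "1\<^sub>m n \<in> MH n K"
  using is_subfieldD[OF assms]
  by (auto simp: mat_closed_def MH_def scalar_prod_def intro!: is_subfield_sum[OF assms])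

lemma AH_mult_entry:
  assumes A: "A \<in> AH n K1 K2" and B: "B \<in> AH n K1 K2"
  shows "i < n \<Longrightarrow> j < n \<Longrightarrow> (A * B) $$ (i, j) = (\<Sum>k<n. A $$ (i, k) * B $$ (k, j))"
    and "i < n \<Longrightarrow> (A * B) $$ (i, n) = (\<Sum>k<n. A $$ (i, k) * B $$ (k, n)) + A $$ (i, n) * B $$ (n, n)"
    and "j < n \<Longrightarrow> (A * B) $$ (n, j) = 0"
    and "(A * B) $$ (n, n) = A $$ (n, n) * B $$ (n, n)"
  using A B by (simp_all add: AH_def mult_mat_entry[of A "n + 1" B] del: index_mult_mat)

lemma AH_closed:
  assumes "is_subfield K1" "is_subfield K2"
  shows "mat_closed (n + 1) (AH n K1 K2)" "1\<^sub>m (n + 1) \<in> AH n K1 K2"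
proof -
  have "A * B \<in> AH n K1 K2" if AB: "A \<in> AH n K1 K2" "B \<in> AH n K1 K2" for A B
  proof -
    have "A * B \<in> carrier_mat (n + 1) (n + 1)"
      by (rule mult_carrier_mat[of _ _ "n + 1"]) (use AB in \<open>simp_all add: AH_def\<close>)
    thus ?thesis using AB unfolding AH_def mem_Collect_eq
      by (auto simp: AH_mult_entry[OF AB] is_subfieldD[OF assms(2)] is_subfieldD[OF assms(1)]
          simp del: index_mult_mat intro!: is_subfield_sum[OF assms(1)])
  qed
  thus "mat_closed (n + 1) (AH n K1 K2)"
    using is_subfieldD[OF assms(1)] is_subfieldD[OF assms(2)]
    by (auto simp: mat_closed_def) (auto simp: AH_def)
  show "1\<^sub>m (n + 1) \<in> AH n K1 K2"
    using is_subfieldD[OF assms(1)] is_subfieldD[OF assms(2)] by (auto simp: AH_def)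
qed

text \<open>For nonzero \<open>u\<close>, the stabilizer in \<open>H\<close> of the line spanned by
  \<open>u\<close>. The eigenvalue ranges over the whole ambient field and may be zero.\<close>

definition eig :: "'k::field mat set \<Rightarrow> 'k vec \<Rightarrow> 'k mat set" where
  "eig H u = {M \<in> H. \<exists>c. M *\<^sub>v u = c \<cdot>\<^sub>v u}"

lemma eig_closed:
  assumes "mat_closed m H" "u \<in> carrier_vec m"
  shows "mat_closed m (eig H u)"
proof -
  have H: "A \<in> carrier_mat m m" if "A \<in> H" for A using assms(1) that by (auto simp: mat_closed_def)
  have z: "\<exists>c. 0\<^sub>m m m *\<^sub>v u = c \<cdot>\<^sub>v u" using assms(2) by (intro exI[of _ 0]) auto
  have neg: "\<exists>c. (- A) *\<^sub>v u = c \<cdot>\<^sub>v u" if "A \<in> H" "A *\<^sub>v u = c \<cdot>\<^sub>v u" for A c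
  proof -
    have "(- A) *\<^sub>v u = - (A *\<^sub>v u)" using H[OF that(1)] assms(2) by (intro eq_vecI) auto
    thus ?thesis using that(2) by (intro exI[of _ "- c"]) auto
  qed
  have add: "\<exists>c. (A + B) *\<^sub>v u = c \<cdot>\<^sub>v u"
    if "A \<in> H" "B \<in> H" "A *\<^sub>v u = a \<cdot>\<^sub>v u" "B *\<^sub>v u = b \<cdot>\<^sub>v u" for A B a b
    using add_mult_distrib_mat_vec[OF H[OF that(1)] H[OF that(2)] assms(2)] that(3,4)
    by (intro exI[of _ "a + b"]) (simp add: add_smult_distrib_vec)
  have mult: "\<exists>c. (A * B) *\<^sub>v u = c \<cdot>\<^sub>v u"
    if "A \<in> H" "B \<in> H" "A *\<^sub>v u = a \<cdot>\<^sub>v u" "B *\<^sub>v u = b \<cdot>\<^sub>v u" for A B a b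
    using assoc_mult_mat_vec[OF H[OF that(1)] H[OF that(2)] assms(2)] that(3,4)
      mult_mat_vec[OF H[OF that(1)] assms(2), of b]
    by (intro exI[of _ "b * a"]) (simp add: smult_smult_assoc)
  show ?thesis
    unfolding mat_closed_def
  proof (intro conjI ballI)
    show "eig H u \<subseteq> carrier_mat m m" using H by (auto simp: eig_def)
    show "0\<^sub>m m m \<in> eig H u" using z assms(1) by (simp add: eig_def mat_closed_def)
    show "- A \<in> eig H u" if "A \<in> eig H u" for A
      using neg that assms(1) by (auto simp: eig_def mat_closed_def)
    show "A + B \<in> eig H u" "A * B \<in> eig H u" if "A \<in> eig H u" "B \<in> eig H u" for A B
      using add mult that assms(1) by (auto simp: eig_def mat_closed_def)
  qed
qed

lemma eig_smult:
  assumes "H \<subseteq> carrier_mat m m" "u \<in> carrier_vec m" "c \<noteq> 0"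
  shows "eig H (c \<cdot>\<^sub>v u) = eig H u"
proof -
  have "M *\<^sub>v (c \<cdot>\<^sub>v u) = a \<cdot>\<^sub>v (c \<cdot>\<^sub>v u) \<longleftrightarrow> M *\<^sub>v u = a \<cdot>\<^sub>v u" if "M \<in> H" for M a
  proof -
    have M: "M \<in> carrier_mat m m" using assms(1) that by auto
    have "M *\<^sub>v (c \<cdot>\<^sub>v u) = c \<cdot>\<^sub>v (M *\<^sub>v u)" by (rule mult_mat_vec[OF M assms(2)])
    moreover have "a \<cdot>\<^sub>v (c \<cdot>\<^sub>v u) = c \<cdot>\<^sub>v (a \<cdot>\<^sub>v u)" by (simp add: smult_smult_assoc mult.commute)
    moreover have "c \<cdot>\<^sub>v v = c \<cdot>\<^sub>v w \<longleftrightarrow> v = w" for v w :: "'a vec"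
      using assms(3) by (metis smult_smult_assoc left_inverse one_smult_vec)
    ultimately show ?thesis by simp
  qed
  thus ?thesis by (auto simp: eig_def)
qed

text \<open>If \<open>u $ j\<close> is nonzero, a single entry \<open>1\<close> at
  \<open>(i, j)\<close> with \<open>i \<noteq> j\<close> sends \<open>u\<close> to a nonzero
  multiple of the \<open>i\<close>-th basis vector, which is not a multiple of \<open>u\<close>.
  Such a matrix lies in the ring when \<open>i < n\<close>, and \<open>n \<ge> 2\<close> leaves room
  for \<open>i\<close>.\<close>

lemma eig_proper:
  assumes n: "n \<ge> 2" and K: "is_subfield K1" "is_subfield K2"
    and u: "u \<in> carrier_vec (n + 1)" "u \<noteq> 0\<^sub>v (n + 1)"
  shows "eig (AH n K1 K2) u \<noteq> AH n K1 K2"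
proof -
  obtain j where j: "j \<le> n" "u $ j \<noteq> 0"
  proof -
    have "\<exists>j<n+1. u $ j \<noteq> 0" using u by (metis eq_vecI carrier_vecD index_zero_vec)
    thus thesis using that by (auto simp: less_Suc_eq_le)
  qed
  define i :: nat where "i = (if j = 0 then 1 else 0)"
  have i: "i < n" "i \<noteq> j" using n by (auto simp: i_def)
  define M where "M = mat (n + 1) (n + 1) (\<lambda>(k, l). if k = i \<and> l = j then 1 else 0 :: 'a)"
  have "M \<in> AH n K1 K2"
    using i j is_subfieldD[OF K(1)] is_subfieldD[OF K(2)] by (auto simp: M_def AH_def)
  moreover have "M \<notin> eig (AH n K1 K2) u"
  proof
    assume "M \<in> eig (AH n K1 K2) u"
    then obtain c where c: "M *\<^sub>v u = c \<cdot>\<^sub>v u" by (auto simp: eig_def)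
    have ent: "(M *\<^sub>v u) $ k = (if k = i then u $ j else 0)" if "k < n + 1" for k
    proof -
      have "(M *\<^sub>v u) $ k = (\<Sum>l\<in>{0..<n+1}. (if k = i \<and> l = j then 1 else 0) * u $ l)"
        using that u(1) by (simp add: M_def scalar_prod_def)
      also have "\<dots> = (\<Sum>l\<in>{0..<n+1}. if l = j then (if k = i then u $ l else 0) else 0)"
        by (rule sum.cong) auto
      finally show ?thesis using j by simp
    qed
    have "(M *\<^sub>v u) $ j = c * u $ j" using c u(1) j by simp
    hence "c = 0" using ent[of j] i j by simp
    moreover have "(M *\<^sub>v u) $ i = c * u $ i" using c u(1) i by simp
    ultimately show False using ent[of i] i j by simp
  qed
  ultimately show ?thesis by auto
qed

lemma card_carrier_vec: "card (carrier_vec m :: 'k::finite vec set) = card (UNIV :: 'k set) ^ m"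
proof -
  have "bij_betw (vec m) ({..<m} \<rightarrow>\<^sub>E (UNIV :: 'k set)) (carrier_vec m)"
  proof (rule bij_betwI[where g = "\<lambda>v. \<lambda>i\<in>{..<m}. v $ i"])
    fix f assume "f \<in> {..<m} \<rightarrow>\<^sub>E (UNIV :: 'k set)"
    thus "(\<lambda>i\<in>{..<m}. vec m f $ i) = f" by (auto simp: fun_eq_iff PiE_def extensional_def)
  qed auto
  thus ?thesis by (simp add: bij_betw_same_card[symmetric] card_PiE)
qed

text \<open>Every element of the ring has its last diagonal entry as an eigenvalue, hence an eigenvector, so
  the stabilizers of the points of the projective space of dimension \<open>n\<close> form a cover.\<close>
lemma Aring_cover:
  fixes K1 K2 :: "'k::{field, finite} set"
  assumes n: "n \<ge> 2" and K: "is_subfield K1" "is_subfield K2"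
  obtains C where "is_cover (Aring n K1 K2) C" "finite C"
    "card C * (card (UNIV :: 'k set) - 1) \<le> card (UNIV :: 'k set) ^ (n + 1) - 1"
proof -
  define U where "U = carrier_vec (n + 1) - {0\<^sub>v (n + 1) :: 'k vec}"
  define f where "f = eig (AH n K1 K2)"
  note cl = AH_closed[OF K, of n]
  have H: "AH n K1 K2 \<subseteq> carrier_mat (n + 1) (n + 1)" by (auto simp: AH_def)
  have cardU: "card U = card (UNIV :: 'k set) ^ (n + 1) - 1"
    unfolding U_def by (subst card_Diff_singleton) (simp_all only: card_carrier_vec zero_carrier_vec)
  have finU: "finite U"
    unfolding U_def by (rule finite_Diff, rule card_ge_0_finite) (simp add: card_carrier_vec card_gt_0_iff)
  have "is_cover (Aring n K1 K2) (f ` U)"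
    unfolding is_cover_def
  proof (intro conjI ballI)
    fix S assume "S \<in> f ` U"
    then obtain u where u: "u \<in> U" "S = f u" by auto
    have "S \<subseteq> AH n K1 K2" by (auto simp: u f_def eig_def)
    moreover have "mat_closed (n + 1) S"
      unfolding u f_def by (rule eig_closed[OF cl(1)]) (use u in \<open>auto simp: U_def\<close>)
    ultimately show "subrng (Aring n K1 K2) S"
      unfolding Aring_eq subrng_mat_ring_iff[OF cl] by simp
    show "S \<noteq> carrier (Aring n K1 K2)"
      using eig_proper[OF n K, of u] u by (simp add: Aring_eq U_def f_def)
  next
    show "\<Union> (f ` U) = carrier (Aring n K1 K2)"
    proof
      show "carrier (Aring n K1 K2) \<subseteq> \<Union> (f ` U)"
      proof
        fix M assume "M \<in> carrier (Aring n K1 K2)"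
        hence M: "M \<in> AH n K1 K2" by (simp add: Aring_eq)
        hence Mc: "M \<in> carrier_mat (n + 1) (n + 1)" by (simp add: AH_def)
        let ?P = "char_matrix M (M $$ (n, n))"
        have P: "?P \<in> carrier_mat (n + 1) (n + 1)" using Mc by simp
        \<comment> \<open>The last row of \<open>?P\<close> vanishes: to the left of the corner by
          the shape of \<open>M\<close>, and at the corner because \<open>M $$ (n, n)\<close> is
          subtracted from itself.\<close>
        have "det ?P = (\<Sum>j<n+1. ?P $$ (n, j) * cofactor ?P n j)"
          by (rule laplace_expansion_row[OF P]) simp
        also have "\<dots> = 0"
          by (rule sum.neutral) (use M Mc in \<open>auto simp: char_matrix_def AH_def less_Suc_eq\<close>)
        finally have "eigenvalue M (M $$ (n, n))" by (simp only: eigenvalue_det[OF Mc])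
        then obtain u where u: "u \<in> carrier_vec (n + 1)" "u \<noteq> 0\<^sub>v (n + 1)" "M *\<^sub>v u = M $$ (n, n) \<cdot>\<^sub>v u"
          using Mc by (auto simp: eigenvalue_def eigenvector_def)
        hence "M \<in> f u" using M by (auto simp: f_def eig_def)
        thus "M \<in> \<Union> (f ` U)" using u by (auto simp: U_def)
      qed
    qed (auto simp: f_def eig_def Aring_eq)
  qed
  \<comment> \<open>Each stabilizer has at least \<open>card UNIV - 1\<close> preimages under
    \<open>f\<close>, the nonzero multiples of one vector. This counts projective points without
    introducing them.\<close>
  moreover have "card (f ` U) * (card (UNIV :: 'k set) - 1) \<le> card U"
  proof -
    have "card (UNIV :: 'k set) - 1 \<le> card {v \<in> U. f v = S}" if S: "S \<in> f ` U" for S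
    proof -
      obtain u where u: "u \<in> U" "S = f u" using S by auto
      obtain j where j: "j < n + 1" "u $ j \<noteq> 0"
        using u(1) unfolding U_def by (metis DiffD1 DiffD2 carrier_vecD eq_vecI index_zero_vec singletonI)
      have uc: "u \<in> carrier_vec (n + 1)" using u by (simp add: U_def)
      have "card (UNIV - {0 :: 'k}) \<le> card {v \<in> U. f v = S}"
      proof (rule card_inj_on_le[where f = "\<lambda>c. c \<cdot>\<^sub>v u"])
        show "inj_on (\<lambda>c. c \<cdot>\<^sub>v u) (UNIV - {0})"
        proof (rule inj_onI)
          fix c c' assume "c \<cdot>\<^sub>v u = c' \<cdot>\<^sub>v u"
          hence "(c \<cdot>\<^sub>v u) $ j = (c' \<cdot>\<^sub>v u) $ j" by simp
          thus "c = c'" using j uc by simp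
        qed
        show "(\<lambda>c. c \<cdot>\<^sub>v u) ` (UNIV - {0}) \<subseteq> {v \<in> U. f v = S}"
        proof
          fix v assume "v \<in> (\<lambda>c. c \<cdot>\<^sub>v u) ` (UNIV - {0})"
          then obtain c where c: "v = c \<cdot>\<^sub>v u" "c \<noteq> 0" by auto
          have "v $ j \<noteq> 0" using c j uc by simp
          hence "v \<noteq> 0\<^sub>v (n + 1)" using j by auto
          moreover have "f v = S" using eig_smult[OF H uc c(2)] by (simp add: c u f_def)
          ultimately show "v \<in> {v \<in> U. f v = S}" using c uc by (simp add: U_def)
        qed
      qed (use finU in simp)
      thus ?thesis by simp
    qed
    hence "card (f ` U) * (card (UNIV :: 'k set) - 1) \<le> (\<Sum>S\<in>f ` U. card {v \<in> U. f v = S})"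
      using sum_bounded_below[of "f ` U" "card (UNIV :: 'k set) - 1" "\<lambda>S. card {v \<in> U. f v = S}"] by simp
    also have "\<dots> = card U" using sum.image_gen[OF finU, of "\<lambda>_. 1 :: nat" f] by simp
    finally show ?thesis .
  qed
  ultimately show thesis using that finU cardU by auto
qed

section \<open>Existence of the extension field and the matrix model\<close>

text \<open>Multiplication by a nonzero \<open>a\<close> permutes the nonzero elements of
  \<open>K\<close>, so comparing their products gives \<open>a ^ (card K - 1) = 1\<close>.\<close>

lemma subfield_pow_card:
  assumes K: "is_subfield K" and fin: "finite K" and a: "a \<in> K"
  shows "a ^ card K = a"
proof (cases "a = 0")
  case False
  have "(\<Prod>y\<in>K - {0}. a * y) = (\<Prod>y\<in>K - {0}. y)"
  proof (rule prod.reindex_bij_betw[where g = "\<lambda>y. y"])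
    show "bij_betw (\<lambda>y. a * y) (K - {0}) (K - {0})"
      by (rule bij_betwI[where g = "\<lambda>y. inverse a * y"])
        (use False is_subfieldD[OF K] a in \<open>auto simp: Pi_def\<close>)
  qed
  hence "a ^ card (K - {0}) * (\<Prod>y\<in>K - {0}. y) = (\<Prod>y\<in>K - {0}. y)"
    by (simp add: prod.distrib)
  moreover have "(\<Prod>y\<in>K - {0}. y) \<noteq> 0" using fin by auto
  ultimately have "a ^ card (K - {0}) = 1" by simp
  moreover have "card K = Suc (card (K - {0}))"
    using fin is_subfieldD(1)[OF K] by (metis card.remove)
  ultimately show ?thesis by simp
next
  case True
  have "card K > 0" using fin is_subfieldD(1)[OF K] by (auto simp: card_gt_0_iff)
  thus ?thesis using True by simp
qed

text \<open>The exponent is positive because a subring without identity contains only the positive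
  powers of its elements. Applying cyclicity to \<open>a / x\<close> instead of \<open>a\<close>
  achieves this.\<close>

lemma subfield_generator:
  assumes K: "is_subfield (K :: 'w::field set)" and fin: "finite K"
  obtains x where "x \<in> K" "x \<noteq> 0" "\<And>a. a \<in> K \<Longrightarrow> a \<noteq> 0 \<Longrightarrow> \<exists>k. a = x ^ Suc k"
proof -
  define R :: "'w ring" where "R = \<lparr>carrier = K, monoid.mult = (*), one = 1, ring.zero = 0, add = (+)\<rparr>"
  note sf = is_subfieldD[OF K]
  interpret R: field R
  proof (rule cring.cring_fieldI2)
    show "cring R"
    proof (rule cringI)
      show "abelian_group R"
        by (rule abelian_groupI) (auto simp: R_def sf add_ac intro!: bexI[of _ "- _"])
      show "Group.comm_monoid R"
        by (rule comm_monoidI) (auto simp: R_def sf mult_ac)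
    qed (auto simp: R_def algebra_simps)
    show "\<zero>\<^bsub>R\<^esub> \<noteq> \<one>\<^bsub>R\<^esub>" by (simp add: R_def)
    show "\<exists>b\<in>carrier R. a \<otimes>\<^bsub>R\<^esub> b = \<one>\<^bsub>R\<^esub>" if "a \<in> carrier R" "a \<noteq> \<zero>\<^bsub>R\<^esub>" for a
      using that sf by (auto simp: R_def intro!: bexI[of _ "inverse a"])
  qed
  have "finite (carrier R)" using fin by (simp add: R_def)
  then obtain x where x: "x \<in> carrier (mult_of R)" "carrier (mult_of R) = {x [^]\<^bsub>R\<^esub> i | i :: nat. i \<in> UNIV}"
    using R.finite_field_mult_group_has_gen by blast
  have pow: "x [^]\<^bsub>R\<^esub> (i::nat) = x ^ i" for i
    by (induction i) (auto simp: R.nat_pow_0 R.nat_pow_Suc, auto simp: R_def mult.commute)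
  have xK: "x \<in> K" "x \<noteq> 0" using x(1) by (auto simp: R_def)
  have "\<exists>k. a = x ^ Suc k" if "a \<in> K" "a \<noteq> 0" for a
  proof -
    have "a / x \<in> carrier (mult_of R)"
      using that xK sf by (auto simp: R_def field_class.field_divide_inverse)
    then obtain i where "a / x = x ^ i" using x(2) pow by auto
    hence "a = x ^ Suc i" using xK by (simp add: field_simps)
    thus ?thesis by blast
  qed
  thus thesis using that xK by blast
qed

text \<open>A repeated linear factor would make the derivative vanish at its root, so the linear
  factors of \<open>P\<close> are distinct.\<close>

lemma card_roots_separable:
  fixes P :: "'w::alg_closed_field poly"
  assumes "P \<noteq> 0" and sep: "\<And>a. poly P a = 0 \<Longrightarrow> poly (pderiv P) a \<noteq> 0"
  shows "card {a. poly P a = 0} = degree P"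
proof -
  obtain A where A: "size A = degree P" "P = smult (lead_coeff P) (\<Prod>x\<in>#A. [:-x, 1:])"
    using alg_closed_imp_factorization[OF assms(1)] by blast
  have root: "poly P a = 0" if "a \<in># A" for a
  proof -
    obtain B where "A = add_mset a B" using multi_member_split \<open>a \<in># A\<close> by metis
    thus ?thesis by (subst A(2)) simp
  qed
  have count: "count A a = 1" if a: "a \<in># A" for a
  proof (rule ccontr)
    assume "count A a \<noteq> 1"
    moreover obtain B where B: "A = add_mset a B" using multi_member_split a by metis
    ultimately have "a \<in># B" by (auto simp: not_in_iff)
    then obtain D where "B = add_mset a D" using multi_member_split by metis
    hence "P = [:-a, 1:] * ([:-a, 1:] * smult (lead_coeff P) (\<Prod>x\<in>#D. [:-x, 1:]))"
      by (subst A(2)) (simp add: B)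
    then obtain T where T: "P = [:-a, 1:] * ([:-a, 1:] * T)" by blast
    have "poly (pderiv P) a = 0" unfolding T pderiv_mult by simp
    thus False using sep root[OF a] by blast
  qed
  have "degree P = (\<Sum>a\<in>set_mset A. count A a)" using A(1) by (simp add: size_multiset_overloaded_eq)
  also have "\<dots> = card (set_mset A)" using count by simp
  also have "\<dots> \<le> card {a. poly P a = 0}"
    by (rule card_mono[OF poly_roots_finite[OF assms(1)]]) (auto simp: root)
  finally show ?thesis using card_poly_roots_bound[OF assms(1)] by simp
qed

lemma frobenius_poly:
  fixes P :: "'w::field poly" and Q :: nat
  defines "P \<equiv> monom 1 Q - monom 1 1"
  assumes Q: "Q > 1"
  shows "P \<noteq> 0" "degree P = Q" "poly P a = a ^ Q - a"
proof -
  have c: "coeff P Q = 1" using Q by (simp add: P_def)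
  thus "P \<noteq> 0" by auto
  have "degree P \<le> Q" unfolding P_def using Q by (intro degree_diff_le) (auto simp: degree_monom_eq)
  thus "degree P = Q" using c by (metis le_antisym le_degree zero_neq_one)
  show "poly P a = a ^ Q - a" by (simp add: P_def poly_monom)
qed

lemma is_subfield_frobenius_fixed:
  fixes Q :: nat
  assumes "prime CHAR('w::field)" "Q = CHAR('w) ^ e"
  shows "is_subfield {a :: 'w. a ^ Q = a}"
proof -
  have Q0: "Q > 0" using assms prime_gt_0_nat by simp
  have add: "(a + b) ^ Q = a ^ Q + b ^ Q" for a b :: 'w by (rule freshmans_dream'[OF assms])
  have "(a - b) ^ Q = a ^ Q - b ^ Q" for a b :: 'w using add[of "a - b" b] by simp
  thus ?thesis using add Q0 by (auto simp: is_subfield_def power_mult_distrib power_inverse)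
qed

text \<open>The characteristic divides \<open>Q\<close>, so the polynomial with values
  \<open>a ^ Q - a\<close> has derivative \<open>-1\<close> and only simple roots.\<close>

lemma card_frobenius_fixed:
  assumes "prime CHAR('w::alg_closed_field)" "Q = CHAR('w) ^ e" "e > 0"
  shows "card {a :: 'w. a ^ Q = a} = Q"
proof -
  have Q1: "Q > 1" unfolding assms(2) by (intro one_less_power prime_gt_1_nat assms)
  define P :: "'w poly" where "P = monom 1 Q - monom 1 1"
  note P = frobenius_poly[OF Q1, where ?'w = 'w, folded P_def]
  have "CHAR('w) dvd Q" using assms by simp
  hence "(of_nat Q :: 'w) = 0" by (simp add: of_nat_eq_0_iff_char_dvd)
  hence "poly (pderiv P) a = -1" for a
    by (simp add: P_def pderiv_diff pderiv_monom)
  hence "card {a. poly P a = 0} = degree P" by (intro card_roots_separable P) simp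
  thus ?thesis by (simp add: P)
qed

lemma card_frobenius_fixed_le:
  assumes "Q > 1" shows "card {a :: 'w::field. a ^ Q = a} \<le> Q" "finite {a :: 'w. a ^ Q = a}"
  using card_poly_roots_bound[OF frobenius_poly(1)[OF assms, where ?'w = 'w]]
    poly_roots_finite[OF frobenius_poly(1)[OF assms, where ?'w = 'w]]
  by (simp_all only: frobenius_poly[OF assms] right_minus_eq)

lemma CHAR_eq_of_card:
  assumes "card (UNIV :: 'k::{field, finite} set) = p ^ L" "prime p"
  shows "CHAR('k) = p"
proof -
  have "prime CHAR('k)" by (rule prime_CHAR_semidom) (rule finite_imp_CHAR_pos, simp)
  moreover have "CHAR('k) dvd p ^ L"
  proof -
    \<comment> \<open>Translation by \<open>1\<close> permutes the field, so the order of the field,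
      as a sum of ones, is zero in it.\<close>
    have "(\<Sum>y\<in>(UNIV :: 'k set). y + 1) = (\<Sum>y\<in>UNIV. y)"
      by (rule sum.reindex_bij_betw[where g = "\<lambda>y. y"], rule bij_betwI[where g = "\<lambda>y. y - 1"]) auto
    hence "(of_nat (p ^ L) :: 'k) = 0" by (simp add: sum.distrib flip: assms(1))
    thus ?thesis by (simp only: of_nat_eq_0_iff_char_dvd)
  qed
  ultimately show ?thesis using assms(2) prime_dvd_power primes_dvd_imp_eq by blast
qed

text \<open>The extension of degree \<open>n\<close> need not lie in the ambient finite field, so it
  is taken in the algebraic closure as the fixed points of a Frobenius power. The image of
  \<open>K1\<close> consists of roots of \<open>a ^ q = a\<close> and has as many elements as the
  degree allows, so it is the whole fixed set.\<close>

lemma singer_field_exists: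
  fixes K1 :: "'k::{field, finite} set"
  assumes K1: "is_subfield K1" "card K1 = p ^ e" "e > 0" and p: "prime p" "card (UNIV :: 'k set) = p ^ L"
    and n: "n \<ge> 2"
  obtains K x where "singer_field K (card K1) n x" "{a \<in> K. a ^ card K1 = a} = to_ac ` K1"
proof -
  have ch: "CHAR('k alg_closure) = p" using CHAR_eq_of_card[OF p(2,1)] by simp
  hence pch: "prime CHAR('k alg_closure)" using p by simp
  define q where "q = card K1"
  have q: "q = p ^ e" by (simp add: q_def K1)
  have q1: "q > 1" unfolding q by (intro one_less_power prime_gt_1_nat K1 p)
  have qn: "q ^ n = CHAR('k alg_closure) ^ (e * n)" "e * n > 0"
    using K1(3) n unfolding q ch by (simp_all add: power_mult)
  define K where "K = {a :: 'k alg_closure. a ^ (q ^ n) = a}"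
  have K: "is_subfield K" unfolding K_def by (rule is_subfield_frobenius_fixed[OF pch qn(1)])
  have cK: "card K = q ^ n" unfolding K_def by (rule card_frobenius_fixed[OF pch qn])
  have fin: "finite K" using cK q1 by (metis card.infinite not_one_less_zero power_eq_0_iff)
  obtain x where x: "x \<in> K" "x \<noteq> 0" "\<And>a. a \<in> K \<Longrightarrow> a \<noteq> 0 \<Longrightarrow> \<exists>k. a = x ^ Suc k"
    using subfield_generator[OF K fin] by blast
  have F: "{a \<in> K. a ^ q = a} = to_ac ` K1"
  proof -
    have "a ^ (q ^ i) = a" if "a ^ q = a" for a :: "'k alg_closure" and i
      by (induction i) (auto simp: that power_mult)
    hence eq: "{a \<in> K. a ^ q = a} = {a :: 'k alg_closure. a ^ q = a}" by (auto simp: K_def)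
    have "to_ac ` K1 \<subseteq> {a. a ^ q = a}"
      using subfield_pow_card[OF K1(1)] by (auto simp: q_def simp flip: to_ac_power)
    moreover have "card (to_ac ` K1) = q" by (simp add: card_image inj_on_def q_def)
    ultimately have "to_ac ` K1 = {a :: 'k alg_closure. a ^ q = a}"
      using card_frobenius_fixed_le[OF q1, where ?'w = "'k alg_closure"] by (intro card_seteq) auto
    thus ?thesis using eq by simp
  qed
  have "singer_field K q n x"
  proof
    show "card {a \<in> K. a ^ q = a} = q" unfolding F by (simp add: card_image inj_on_def q_def)
    show "(a + b) ^ q = a ^ q + b ^ q" for a b :: "'k alg_closure"
      by (rule freshmans_dream'[OF pch, of q e]) (simp only: ch q)
    show "\<exists>k. a = x ^ k" if "a \<in> K" "a \<noteq> 0" for a using x(3)[OF that] by blast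
    show "a ^ (q ^ n) = a" if "a \<in> K" for a using that by (simp add: K_def)
  qed (use K cK q1 n x in \<open>auto simp: is_subfieldD\<close>)
  thus thesis using that F by (simp add: q_def)
qed

text \<open>\<open>\<iota>\<close> carries matrix entries into the copy of the base field inside
  \<open>K\<close>; it will be the embedding into the algebraic closure.\<close>

locale singer_matrix = singer_field K q n x for K :: "'w::field set" and q n x +
  fixes K1 :: "'k::field set" and \<iota> :: "'k \<Rightarrow> 'w"
  assumes K1: "is_subfield K1"
    and \<iota>_add: "\<iota> (a + b) = \<iota> a + \<iota> b" and \<iota>_mult: "\<iota> (a * b) = \<iota> a * \<iota> b"
    and \<iota>_inj: "inj \<iota>" and \<iota>_image: "\<iota> ` K1 = F"
begin

lemma \<iota>_F: "a \<in> K1 \<Longrightarrow> \<iota> a \<in> F" using \<iota>_image by auto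
lemma \<iota>_zero: "\<iota> 0 = 0" using \<iota>_add[of 0 0] by (metis add_cancel_right_right add_0)
lemma \<iota>_sum: "finite I \<Longrightarrow> \<iota> (sum f I) = (\<Sum>i\<in>I. \<iota> (f i))"
  by (induction I rule: finite_induct) (auto simp: \<iota>_zero \<iota>_add)

text \<open>Column \<open>j\<close> holds the coordinates of the image of \<open>x ^ j\<close>, so
  the matrix product becomes composition in the same order.\<close>

definition \<Phi> :: "'k mat \<Rightarrow> 'w \<Rightarrow> 'w" where
  "\<Phi> A = lin (\<lambda>j. \<Sum>i<n. \<iota> (A $$ (i, j)) * x ^ i)"

lemma MH_entry: "A \<in> MH n K1 \<Longrightarrow> i < n \<Longrightarrow> j < n \<Longrightarrow> A $$ (i, j) \<in> K1" by (simp add: MH_def)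

lemma \<Phi>_E: "A \<in> MH n K1 \<Longrightarrow> \<Phi> A \<in> E"
  unfolding \<Phi>_def by (auto intro!: lin_E sum_mem mult_mem pow_mem F_K[OF \<iota>_F] simp: MH_entry)

lemma \<Phi>_basis: "j < n \<Longrightarrow> \<Phi> A (x ^ j) = (\<Sum>i<n. \<iota> (A $$ (i, j)) * x ^ i)"
  by (simp add: \<Phi>_def lin_basis)

lemma \<Phi>_bij: "bij_betw \<Phi> (MH n K1) E"
  unfolding bij_betw_def
proof
  show "inj_on \<Phi> (MH n K1)"
  proof (rule inj_onI)
    fix A B assume AB: "A \<in> MH n K1" "B \<in> MH n K1" "\<Phi> A = \<Phi> B"
    show "A = B"
    proof (rule eq_matI)
      fix i j assume "i < dim_row B" "j < dim_col B"
      hence ij: "i < n" "j < n" using AB by (auto simp: MH_def)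
      have "coord (\<Phi> M (x ^ j)) i = \<iota> (M $$ (i, j))" if "M \<in> MH n K1" for M
        by (rule coord_unique) (use ij that \<iota>_F MH_entry in \<open>auto simp: \<Phi>_basis\<close>)
      hence "\<iota> (A $$ (i, j)) = \<iota> (B $$ (i, j))" using AB by metis
      thus "A $$ (i, j) = B $$ (i, j)" using \<iota>_inj by (simp add: inj_eq)
    qed (use AB in \<open>auto simp: MH_def\<close>)
  qed
  show "\<Phi> ` MH n K1 = E"
  proof
    show "E \<subseteq> \<Phi> ` MH n K1"
    proof
      fix f assume f: "f \<in> E"
      define A where "A = mat n n (\<lambda>(i, j). inv_into K1 \<iota> (coord (f (x ^ j)) i))"
      have cF: "coord (f (x ^ j)) i \<in> \<iota> ` K1" if "i < n" "j < n" for i j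
        unfolding \<iota>_image using that by (intro coord_F[OF E_mem[OF f pow_mem[OF x_mem]]])
      hence "A \<in> MH n K1" by (auto simp: A_def MH_def inv_into_into)
      moreover have "\<Phi> A = f"
      proof (rule E_basis_ext[OF \<Phi>_E[OF \<open>A \<in> MH n K1\<close>] f])
        fix j assume j: "j < n"
        have "(\<Sum>i<n. \<iota> (A $$ (i, j)) * x ^ i) = (\<Sum>i<n. coord (f (x ^ j)) i * x ^ i)"
          by (rule sum.cong) (use j cF in \<open>auto simp: A_def f_inv_into_f\<close>)
        thus "\<Phi> A (x ^ j) = f (x ^ j)"
          using j f by (simp add: \<Phi>_basis comb_coord E_mem pow_mem)
      qed
      ultimately show "f \<in> \<Phi> ` MH n K1" by blast
    qed
  qed (auto simp: \<Phi>_E)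
qed

lemma \<Phi>_zero: "\<Phi> (0\<^sub>m n n) = (\<lambda>z. 0)"
proof (rule E_basis_ext)
  show "\<Phi> (0\<^sub>m n n) \<in> E" by (rule \<Phi>_E) (simp add: MH_def is_subfieldD[OF K1])
qed (auto simp: \<Phi>_basis \<iota>_zero E_zero_fun)

lemma MH_ops:
  "A \<in> MH n K1 \<Longrightarrow> B \<in> MH n K1 \<Longrightarrow> A + B \<in> MH n K1"
  "A \<in> MH n K1 \<Longrightarrow> B \<in> MH n K1 \<Longrightarrow> A * B \<in> MH n K1"
  "A \<in> MH n K1 \<Longrightarrow> - A \<in> MH n K1"
  using MH_closed(1)[OF K1, of n] by (auto simp: mat_closed_def)

lemma \<Phi>_add: "A \<in> MH n K1 \<Longrightarrow> B \<in> MH n K1 \<Longrightarrow> \<Phi> (A + B) = (\<lambda>z. \<Phi> A z + \<Phi> B z)"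
proof (rule E_basis_ext)
  assume AB: "A \<in> MH n K1" "B \<in> MH n K1"
  show "\<Phi> (A + B) \<in> E" "(\<lambda>z. \<Phi> A z + \<Phi> B z) \<in> E" by (intro \<Phi>_E MH_ops E_plus AB)+
  fix j assume "j < n"
  thus "\<Phi> (A + B) (x ^ j) = \<Phi> A (x ^ j) + \<Phi> B (x ^ j)"
    using AB by (auto simp: \<Phi>_basis MH_def \<iota>_add distrib_right sum.distrib)
qed

lemma \<Phi>_mult: "A \<in> MH n K1 \<Longrightarrow> B \<in> MH n K1 \<Longrightarrow> \<Phi> (A * B) = \<Phi> A \<circ> \<Phi> B"
proof (rule E_basis_ext)
  assume AB: "A \<in> MH n K1" "B \<in> MH n K1"
  show "\<Phi> (A * B) \<in> E" "\<Phi> A \<circ> \<Phi> B \<in> E" by (intro \<Phi>_E MH_ops E_comp AB)+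
  fix j assume j: "j < n"
  have "(\<Phi> A \<circ> \<Phi> B) (x ^ j) = \<Phi> A (\<Sum>k<n. \<iota> (B $$ (k, j)) * x ^ k)"
    using j by (simp add: \<Phi>_basis)
  also have "\<dots> = (\<Sum>k<n. \<iota> (B $$ (k, j)) * \<Phi> A (x ^ k))"
    using AB j by (subst E_sum[OF \<Phi>_E])
      (auto simp: E_scale[OF \<Phi>_E] \<iota>_F MH_entry pow_mem F_K intro!: mult_mem)
  also have "\<dots> = (\<Sum>k<n. \<Sum>i<n. \<iota> (A $$ (i, k)) * \<iota> (B $$ (k, j)) * x ^ i)"
    by (simp add: \<Phi>_basis sum_distrib_left mult_ac)
  also have "\<dots> = (\<Sum>i<n. \<Sum>k<n. \<iota> (A $$ (i, k)) * \<iota> (B $$ (k, j)) * x ^ i)"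
    by (rule sum.swap)
  also have "\<dots> = (\<Sum>i<n. \<iota> ((A * B) $$ (i, j)) * x ^ i)"
  proof (rule sum.cong)
    fix i assume "i \<in> {..<n}"
    hence "(A * B) $$ (i, j) = (\<Sum>k<n. A $$ (i, k) * B $$ (k, j))"
      using AB j by (intro mult_mat_entry) (auto simp: MH_def)
    thus "(\<Sum>k<n. \<iota> (A $$ (i, k)) * \<iota> (B $$ (k, j)) * x ^ i) = \<iota> ((A * B) $$ (i, j)) * x ^ i"
      by (simp add: \<iota>_sum \<iota>_mult sum_distrib_right)
  qed simp
  finally show "\<Phi> (A * B) (x ^ j) = (\<Phi> A \<circ> \<Phi> B) (x ^ j)" using j by (simp add: \<Phi>_basis)
qed

lemma \<Phi>_uminus:
  assumes A: "A \<in> MH n K1"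
  shows "\<Phi> (- A) = (\<lambda>z. - \<Phi> A z)"
proof
  fix z
  have "\<Phi> (A + (- A)) z = \<Phi> A z + \<Phi> (- A) z" using \<Phi>_add[OF A MH_ops(3)[OF A]] by simp
  moreover have "A + (- A) = 0\<^sub>m n n" using A by (intro eq_matI) (auto simp: MH_def)
  ultimately have "\<Phi> A z + \<Phi> (- A) z = 0" by (simp add: \<Phi>_zero)
  thus "\<Phi> (- A) z = - \<Phi> A z" by (simp add: add_eq_0_iff)
qed

lemma closed_\<Phi>_image:
  assumes "mat_closed n S" "S \<subseteq> MH n K1"
  shows "closed (\<Phi> ` S)"
  unfolding closed_def
proof (intro conjI ballI)
  have S: "0\<^sub>m n n \<in> S" "\<And>A B. A \<in> S \<Longrightarrow> B \<in> S \<Longrightarrow> A + B \<in> S" "\<And>A B. A \<in> S \<Longrightarrow> B \<in> S \<Longrightarrow> A * B \<in> S"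
    "\<And>A. A \<in> S \<Longrightarrow> - A \<in> S"
    using assms(1) by (auto simp: mat_closed_def)
  show "\<Phi> ` S \<subseteq> E" using assms(2) \<Phi>_E by auto
  show "(\<lambda>z. 0) \<in> \<Phi> ` S" using S(1) \<Phi>_zero by (metis imageI)
  fix f g assume "f \<in> \<Phi> ` S" "g \<in> \<Phi> ` S"
  then obtain A B where AB: "A \<in> S" "B \<in> S" and f: "f = \<Phi> A" "g = \<Phi> B" by auto
  hence AB': "A \<in> MH n K1" "B \<in> MH n K1" using assms(2) by auto
  show "(\<lambda>z. f z + g z) \<in> \<Phi> ` S" using \<Phi>_add[OF AB'] S(2)[OF AB] f by (metis imageI)
  show "f \<circ> g \<in> \<Phi> ` S" using \<Phi>_mult[OF AB'] S(3)[OF AB] f by (metis imageI)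
  have "\<Phi> (A + (- B)) = (\<lambda>z. f z - g z)"
    using AB' f by (simp add: \<Phi>_add MH_ops \<Phi>_uminus)
  thus "(\<lambda>z. f z - g z) \<in> \<Phi> ` S" using S(2)[OF AB(1) S(4)[OF AB(2)]] by (metis imageI)
qed

lemma proper_\<Phi>_image:
  assumes "S \<subset> MH n K1"
  shows "\<Phi> ` S \<noteq> E"
  using assms \<Phi>_bij unfolding bij_betw_def by (metis inj_on_image_eq_iff order_refl psubset_imp_subset psubset_eq)

end

text \<open>Keeps the extension field inside the proof: \<open>T\<close> will be the set of matrices
  of the conjugates of \<open>mu x\<close>, but the conclusions speak of matrices only.\<close>

lemma matrix_family_bound:
  fixes K1 :: "'k::{field, finite} set"
  assumes K1: "is_subfield K1" "card K1 = p ^ e" "e > 0" and p: "prime p" "card (UNIV :: 'k set) = p ^ L"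
    and n: "n \<ge> 2"
  defines "q \<equiv> card K1"
  obtains T where "T \<subseteq> MH n K1"
    "\<And>C. finite C \<Longrightarrow> (\<And>S. S \<in> C \<Longrightarrow> mat_closed n S \<and> S \<subset> MH n K1) \<Longrightarrow> T \<subseteq> \<Union>C \<Longrightarrow>
      \<exists>m. m dvd n \<and> m \<ge> 2 \<and> (\<Prod>i\<in>{1..<n}. q ^ n - q ^ i) \<le> card C * (m * q ^ (n * (n div m - 1)))"
    "\<And>C. n = 3 \<Longrightarrow> q = 2 \<Longrightarrow> finite C \<Longrightarrow> (\<And>S. S \<in> C \<Longrightarrow> mat_closed n S \<and> S \<subset> MH n K1) \<Longrightarrow>
      MH n K1 \<subseteq> \<Union>C \<Longrightarrow> 15 \<le> card C"
proof -
  obtain K x where sf: "singer_field K q n x" and F: "{a \<in> K. a ^ q = a} = to_ac ` K1"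
    unfolding q_def using singer_field_exists[OF K1 p n] by blast
  interpret singer_field K q n x by (rule sf)
  interpret singer_matrix K q n x K1 to_ac
    by unfold_locales (auto simp: K1 inj_to_ac F_def F)
  have im: "closed (\<Phi> ` S) \<and> \<Phi> ` S \<noteq> E" if "mat_closed n S \<and> S \<subset> MH n K1" for S
    using that closed_\<Phi>_image proper_\<Phi>_image by auto
  define T where "T = {A \<in> MH n K1. \<Phi> A \<in> (\<lambda>h. conj h (mu x)) ` GL}"
  have "\<exists>m. m dvd n \<and> m \<ge> 2 \<and> (\<Prod>i\<in>{1..<n}. q ^ n - q ^ i) \<le> card C * (m * q ^ (n * (n div m - 1)))"
    if C: "finite C" "\<And>S. S \<in> C \<Longrightarrow> mat_closed n S \<and> S \<subset> MH n K1" "T \<subseteq> \<Union>C" for C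
  proof -
    have "singer_family ((`) \<Phi> ` C)"
      unfolding singer_family_def
    proof (intro conjI ballI)
      fix h assume h: "h \<in> GL"
      hence "conj h (mu x) \<in> \<Phi> ` MH n K1"
        using \<Phi>_bij conj_E[OF h mu_E[OF x_mem]] by (simp add: bij_betw_def)
      then obtain A where A: "A \<in> MH n K1" "conj h (mu x) = \<Phi> A" by auto
      hence "A \<in> T" unfolding T_def using h by (auto intro!: image_eqI[of _ _ h])
      then obtain S where "S \<in> C" "A \<in> S" using C(3) by auto
      thus "\<exists>S\<in>(`) \<Phi> ` C. conj h (mu x) \<in> S" using A(2) by auto
    qed (use im[OF C(2)] in auto)
    then obtain m where m: "m dvd n" "m \<ge> 2"
      "(\<Prod>i\<in>{1..<n}. q ^ n - q ^ i) \<le> card ((`) \<Phi> ` C) * (m * q ^ (n * (n div m - 1)))"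
      using singer_family_bound[of "(`) \<Phi> ` C"] C(1) by blast
    have "card ((`) \<Phi> ` C) \<le> card C" by (rule card_image_le[OF C(1)])
    hence "card ((`) \<Phi> ` C) * (m * q ^ (n * (n div m - 1))) \<le> card C * (m * q ^ (n * (n div m - 1)))"
      by (rule mult_le_mono1)
    thus ?thesis using m by (intro exI[of _ m]) linarith
  qed
  moreover have "15 \<le> card C" if C: "n = 3" "q = 2" "finite C"
    "\<And>S. S \<in> C \<Longrightarrow> mat_closed n S \<and> S \<subset> MH n K1" "MH n K1 \<subseteq> \<Union>C" for C
  proof -
    have "15 \<le> card ((`) \<Phi> ` C)"
    proof (rule cover_bound_3_2[OF C(1,2)])
      show "E \<subseteq> \<Union> ((`) \<Phi> ` C)"
      proof
        fix f assume "f \<in> E"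
        then obtain A where "A \<in> MH n K1" "f = \<Phi> A" using \<Phi>_bij by (auto simp: bij_betw_def)
        thus "f \<in> \<Union> ((`) \<Phi> ` C)" using C(5) by auto
      qed
    qed (use im[OF C(4)] C(3) in auto)
    also have "\<dots> \<le> card C" by (rule card_image_le[OF C(3)])
    finally show ?thesis .
  qed
  ultimately show thesis using that[of T] by (auto simp: T_def)
qed

section \<open>Ideals and covers relative to the last column\<close>

definition unit_mat :: "nat \<Rightarrow> nat \<Rightarrow> nat \<Rightarrow> 'a::zero \<Rightarrow> 'a mat" where
  "unit_mat m i j z = mat m m (\<lambda>(k, l). if k = i \<and> l = j then z else 0)"

lemma unit_mat_carrier [simp]: "unit_mat m i j z \<in> carrier_mat m m"
  by (simp add: unit_mat_def)

lemma unit_mat_entry: "k < m \<Longrightarrow> l < m \<Longrightarrow> unit_mat m i j z $$ (k, l) = (if k = i \<and> l = j then z else 0)"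
  by (simp add: unit_mat_def)

lemma unit_mat_mult_entry:
  fixes M :: "'k::field mat"
  assumes M: "M \<in> carrier_mat m m" and k: "k < m" "l < m"
  shows "b < m \<Longrightarrow> (unit_mat m a b s * M) $$ (k, l) = (if k = a then s * M $$ (b, l) else 0)"
    and "c < m \<Longrightarrow> (M * unit_mat m c e t) $$ (k, l) = (if l = e then M $$ (k, c) * t else 0)"
proof -
  have "(unit_mat m a b s * M) $$ (k, l) = (\<Sum>i<m. if i = b then (if k = a then s * M $$ (b, l) else 0) else 0)"
    unfolding mult_mat_entry[OF unit_mat_carrier M k]
    by (rule sum.cong) (use k in \<open>auto simp: unit_mat_entry\<close>)
  thus "b < m \<Longrightarrow> (unit_mat m a b s * M) $$ (k, l) = (if k = a then s * M $$ (b, l) else 0)" by simp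
  have "(M * unit_mat m c e t) $$ (k, l) = (\<Sum>i<m. if i = c then (if l = e then M $$ (k, c) * t else 0) else 0)"
    unfolding mult_mat_entry[OF M unit_mat_carrier k]
    by (rule sum.cong) (use k in \<open>auto simp: unit_mat_entry\<close>)
  thus "c < m \<Longrightarrow> (M * unit_mat m c e t) $$ (k, l) = (if l = e then M $$ (k, c) * t else 0)" by simp
qed

lemma unit_mat_sandwich:
  fixes M :: "'k::field mat"
  assumes M: "M \<in> carrier_mat m m" and "b < m" "c < m"
  shows "unit_mat m a b s * M * unit_mat m c e t = unit_mat m a e (s * M $$ (b, c) * t)"
proof (rule eq_matI)
  have aM: "unit_mat m a b s * M \<in> carrier_mat m m" by (rule mult_carrier_mat[OF unit_mat_carrier M])
  fix k l assume "k < dim_row (unit_mat m a e (s * M $$ (b, c) * t))" "l < dim_col (unit_mat m a e (s * M $$ (b, c) * t))"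
  hence k: "k < m" "l < m" by (simp_all add: unit_mat_def)
  show "(unit_mat m a b s * M * unit_mat m c e t) $$ (k, l) = unit_mat m a e (s * M $$ (b, c) * t) $$ (k, l)"
    by (simp only: unit_mat_mult_entry(2)[OF aM k assms(3)] unit_mat_mult_entry(1)[OF M k(1) assms(3,2)]
        unit_mat_entry[OF k]) simp
qed (use M in \<open>auto simp: unit_mat_def\<close>)

lemma unit_mat_mult:
  fixes s t :: "'k::field"
  assumes "b < m" "c < m"
  shows "unit_mat m a b s * unit_mat m c e t = unit_mat m a e (if b = c then s * t else 0)"
proof (rule eq_matI)
  fix k l assume "k < dim_row (unit_mat m a e (if b = c then s * t else 0))"
    "l < dim_col (unit_mat m a e (if b = c then s * t else 0))"
  hence k: "k < m" "l < m" by (simp_all add: unit_mat_def)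
  show "(unit_mat m a b s * unit_mat m c e t) $$ (k, l) = unit_mat m a e (if b = c then s * t else 0) $$ (k, l)"
    by (subst unit_mat_mult_entry(1)[OF unit_mat_carrier k]) (use assms k in \<open>auto simp: unit_mat_entry\<close>)
qed (auto simp: unit_mat_def)

lemma unit_mat_add:
  "unit_mat m i j (s + t :: 'k::field) = unit_mat m i j s + unit_mat m i j t"
  by (rule eq_matI) (auto simp: unit_mat_def)

lemma unit_mat_zero: "unit_mat m i j (0 :: 'k::field) = 0\<^sub>m m m"
  by (rule eq_matI) (auto simp: unit_mat_def)

lemma mat_closedD:
  assumes "mat_closed m S"
  shows "A \<in> S \<Longrightarrow> A \<in> carrier_mat m m" "0\<^sub>m m m \<in> S" "A \<in> S \<Longrightarrow> - A \<in> S"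
    "A \<in> S \<Longrightarrow> B \<in> S \<Longrightarrow> A + B \<in> S" "A \<in> S \<Longrightarrow> B \<in> S \<Longrightarrow> A * B \<in> S"
  using assms by (auto simp: mat_closed_def)

lemma mat_closed_of_units:
  assumes S: "mat_closed m S" and M: "M \<in> carrier_mat m m"
    and u: "\<And>i j. i < m \<Longrightarrow> j < m \<Longrightarrow> unit_mat m i j (M $$ (i, j)) \<in> S"
  shows "M \<in> S"
proof -
  define msk where "msk P = mat m m (\<lambda>ij. if ij \<in> P then M $$ ij else 0)" for P
  have "msk P \<in> S" if "P \<subseteq> {..<m} \<times> {..<m}" "finite P" for P
    using that(2,1)
  proof (induction P rule: finite_induct)
    case empty
    have "msk {} = 0\<^sub>m m m" by (rule eq_matI) (auto simp: msk_def)
    thus ?case using mat_closedD(2)[OF S] by simp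
  next
    case (insert ij P)
    obtain i j where ij: "ij = (i, j)" by (cases ij)
    have "msk (insert ij P) = msk P + unit_mat m i j (M $$ (i, j))"
      by (rule eq_matI) (use insert.hyps in \<open>auto simp: msk_def unit_mat_def ij\<close>)
    thus ?case using insert ij u mat_closedD(4)[OF S] by simp
  qed
  from this[of "{..<m} \<times> {..<m}"] have "msk ({..<m} \<times> {..<m}) \<in> S" by simp
  moreover have "msk ({..<m} \<times> {..<m}) = M" by (rule eq_matI) (use M in \<open>auto simp: msk_def\<close>)
  ultimately show ?thesis by simp
qed

text \<open>From a subspace \<open>G\<close> of known order, one vector at a time is adjoined until
  \<open>H\<close> is reached; each step multiplies the order by \<open>card K\<close>.\<close>

lemma subspace_card_step:
  fixes H :: "'k::{field, finite} set"
  assumes K: "is_subfield K"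
    and H: "\<And>a b. a \<in> H \<Longrightarrow> b \<in> H \<Longrightarrow> a + b \<in> H" "\<And>c a. c \<in> K \<Longrightarrow> a \<in> H \<Longrightarrow> c * a \<in> H"
    and G: "G \<subseteq> H" "0 \<in> G" "\<And>a b. a \<in> G \<Longrightarrow> b \<in> G \<Longrightarrow> a + b \<in> G" "\<And>c a. c \<in> K \<Longrightarrow> a \<in> G \<Longrightarrow> c * a \<in> G"
    and cG: "card G = card K ^ k"
  shows "\<exists>a. card H = card K ^ a"
  using G cG
proof (induction "card H - card G" arbitrary: G k rule: less_induct)
  case less
  note sf = is_subfieldD[OF K]
  show ?case
  proof (cases "G = H")
    case False
    then obtain z where z: "z \<in> H" "z \<notin> G" using less.prems(1) by auto
    define G' where "G' = (\<lambda>(g, c). g + c * z) ` (G \<times> K)"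
    have neg: "- a \<in> G" if "a \<in> G" for a using less.prems(4)[of "-1" a] sf(2,6) that by simp
    have "inj_on (\<lambda>(g, c). g + c * z) (G \<times> K)"
    proof (rule inj_onI, clarify)
      fix g c g' c' assume gc: "g \<in> G" "c \<in> K" "g' \<in> G" "c' \<in> K" and eq: "g + c * z = g' + c' * z"
      have "c = c'"
      proof (rule ccontr)
        assume ne: "c \<noteq> c'"
        have "(c - c') * z = g' + (- g)" using eq by (simp add: algebra_simps)
        hence "z = inverse (c - c') * (g' + (- g))" using ne by (simp add: field_simps)
        moreover have "inverse (c - c') * (g' + (- g)) \<in> G"
          by (intro less.prems(3,4) neg gc sf(7) sf(4))
        ultimately show False using z by simp
      qed
      thus "g = g' \<and> c = c'" using eq by simp
    qed
    hence card: "card G' = card K ^ Suc k" by (simp add: G'_def card_image less.prems(5) mult.commute)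
    have sub: "G' \<subseteq> H" using less.prems(1) z H by (auto simp: G'_def)
    have zG': "z \<in> G'" unfolding G'_def
      by (rule image_eqI[of _ _ "(0, 1)"]) (use less.prems sf in auto)
    have GG': "G \<subseteq> G'"
    proof
      fix g assume "g \<in> G"
      thus "g \<in> G'" unfolding G'_def by (intro image_eqI[of _ _ "(g, 0)"]) (use sf in auto)
    qed
    have "card G < card G'" using GG' zG' z by (intro psubset_card_mono) auto
    moreover have "card G' \<le> card H" using sub by (intro card_mono) auto
    ultimately have "card H - card G' < card H - card G" by simp
    moreover have "0 \<in> G'" using GG' less.prems(2) by auto
    moreover have "a + b \<in> G'" if "a \<in> G'" "b \<in> G'" for a b
    proof -
      obtain g c where gc: "g \<in> G" "c \<in> K" "a = g + c * z"
        using \<open>a \<in> G'\<close> by (auto simp: G'_def)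
      moreover obtain g' c' where "g' \<in> G" "c' \<in> K" "b = g' + c' * z"
        using \<open>b \<in> G'\<close> by (auto simp: G'_def)
      ultimately show ?thesis unfolding G'_def
        by (intro image_eqI[of _ _ "(g + g', c + c')"]) (use less.prems(3) sf in \<open>auto simp: algebra_simps\<close>)
    qed
    moreover have "c * a \<in> G'" if "c \<in> K" "a \<in> G'" for c a
    proof -
      obtain g c' where gc: "g \<in> G" "c' \<in> K" "a = g + c' * z"
        using \<open>a \<in> G'\<close> by (auto simp: G'_def)
      thus ?thesis unfolding G'_def
        by (intro image_eqI[of _ _ "(c * g, c * c')"]) (use less.prems(4) sf that in \<open>auto simp: algebra_simps\<close>)
    qed
    ultimately show ?thesis using less.hyps[of G' "Suc k"] sub card by blast
  qed (use less.prems in auto)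
qed

text \<open>The order of \<open>H\<close> is a power of \<open>card K1\<close> and of
  \<open>card K2\<close>, so it is \<open>p\<close> to a common multiple of \<open>d1\<close> and
  \<open>d2\<close>. This multiple is nonzero, hence at least \<open>lcm d1 d2\<close>. Counting
  takes the place of an argument about the compositum.\<close>

lemma subspace_eq_UNIV:
  fixes H :: "'k::{field, finite} set"
  assumes K1: "is_subfield K1" "card K1 = p ^ d1" and K2: "is_subfield K2" "card K2 = p ^ d2"
    and p: "prime p" "card (UNIV :: 'k set) = p ^ lcm d1 d2"
    and H: "\<And>a b. a \<in> H \<Longrightarrow> b \<in> H \<Longrightarrow> a + b \<in> H" "\<And>c a. c \<in> K1 \<Longrightarrow> a \<in> H \<Longrightarrow> c * a \<in> H"
      "\<And>c a. c \<in> K2 \<Longrightarrow> a \<in> H \<Longrightarrow> c * a \<in> H" and z: "z \<in> H" "z \<noteq> 0"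
  shows "H = UNIV"
proof -
  have H0: "0 \<in> H" using H(2)[OF is_subfieldD(1)[OF K1(1)] z(1)] by simp
  obtain a where a: "card H = card K1 ^ a"
    using subspace_card_step[OF K1(1) H(1,2), of "{0}" 0] H0 by auto
  obtain b where b: "card H = card K2 ^ b"
    using subspace_card_step[OF K2(1) H(1,3), of "{0}" 0] H0 by auto
  have p1: "p > 1" by (rule prime_gt_1_nat[OF p(1)])
  have "p ^ (d1 * a) = p ^ (d2 * b)" using a b K1 K2 by (simp add: power_mult)
  hence eq: "d1 * a = d2 * b" using p1 by simp
  hence "lcm d1 d2 dvd d1 * a" by (metis lcm_least dvd_triv_left)
  moreover have "d1 * a \<noteq> 0"
  proof
    assume "d1 * a = 0"
    hence "card H = 1" using a K1(2) by (metis power_0 power_mult)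
    moreover have "card {0, z} \<le> card H" using H0 z by (intro card_mono) auto
    ultimately show False using z(2) by simp
  qed
  ultimately have "lcm d1 d2 \<le> d1 * a" by (intro dvd_imp_le) auto
  hence "p ^ lcm d1 d2 \<le> p ^ (d1 * a)" using p1 by (intro power_increasing) auto
  hence "card (UNIV :: 'k set) \<le> card H" using a K1(2) p(2) by (simp add: power_mult)
  thus ?thesis by (intro card_seteq) auto
qed

lemma unit_mat_AH:
  assumes "is_subfield K1" "is_subfield K2"
  shows "i < n \<Longrightarrow> j < n \<Longrightarrow> z \<in> K1 \<Longrightarrow> unit_mat (n + 1) i j z \<in> AH n K1 K2"
    and "i < n \<Longrightarrow> unit_mat (n + 1) i n z \<in> AH n K1 K2"
    and "z \<in> K2 \<Longrightarrow> unit_mat (n + 1) n n z \<in> AH n K1 K2"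
  using is_subfieldD(1)[OF assms(1)] is_subfieldD(1)[OF assms(2)]
  by (auto simp: AH_def unit_mat_def)

text \<open>The last column is a simple bimodule because the two subfields generate the field; it is therefore
  the least nonzero ideal.\<close>
lemma ideal_contains_column:
  fixes K1 K2 :: "'k::{field, finite} set"
  assumes K1: "is_subfield K1" "card K1 = p ^ d1" and K2: "is_subfield K2" "card K2 = p ^ d2"
    and p: "prime p" "card (UNIV :: 'k set) = p ^ lcm d1 d2" and n: "n \<ge> 1"
    and I: "mat_closed (n + 1) I" "\<And>A M. A \<in> AH n K1 K2 \<Longrightarrow> M \<in> I \<Longrightarrow> A * M \<in> I \<and> M * A \<in> I"
    and ne: "I \<noteq> {0\<^sub>m (n + 1) (n + 1)}" and i: "i < n"
  shows "unit_mat (n + 1) i n z \<in> I"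
proof -
  let ?U = "unit_mat (n + 1)"
  note uA = unit_mat_AH[OF K1(1) K2(1)]
  note one = is_subfieldD(2)[OF K1(1)] is_subfieldD(2)[OF K2(1)]
  \<comment> \<open>Matrix units on both sides carry any entry of an element of \<open>I\<close> to
    any position they reach within the ring.\<close>
  have sw: "?U a e (s * M $$ (b, c) * t) \<in> I"
    if "M \<in> I" "b < n + 1" "c < n + 1" "?U a b s \<in> AH n K1 K2" "?U c e t \<in> AH n K1 K2" for M a b c e s t
    using conjunct2[OF I(2)[OF that(5) conjunct1[OF I(2)[OF that(4,1)]]]]
    by (simp only: unit_mat_sandwich[OF mat_closedD(1)[OF I(1) that(1)] that(2,3)])
  obtain M where M: "M \<in> I" "M \<noteq> 0\<^sub>m (n + 1) (n + 1)" using ne mat_closedD(2)[OF I(1)] by auto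
  have Mc: "M \<in> carrier_mat (n + 1) (n + 1)" by (rule mat_closedD(1)[OF I(1) M(1)])
  have "\<exists>k<n+1. \<exists>l<n+1. M $$ (k, l) \<noteq> 0"
  proof (rule ccontr)
    assume "\<not> ?thesis"
    hence "M = 0\<^sub>m (n + 1) (n + 1)" using Mc by (intro eq_matI) auto
    thus False using M by simp
  qed
  then obtain k l where kl: "k < n + 1" "l < n + 1" "M $$ (k, l) \<noteq> 0" by auto
  \<comment> \<open>Left multiplication by \<open>c\<close> at \<open>(i, i)\<close> makes
    \<open>H\<close> a space over \<open>K1\<close>, and right multiplication by \<open>c\<close> at
    \<open>(n, n)\<close> a space over \<open>K2\<close>.\<close>
  define H where "H = {z. ?U i n z \<in> I}"
  have "?U i k 1 \<in> AH n K1 K2" using kl i uA one by (cases "k = n") auto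
  moreover have "?U l n 1 \<in> AH n K1 K2" using kl i uA one by (cases "l = n") auto
  ultimately have mem: "M $$ (k, l) \<in> H" using sw[OF M(1) kl(1,2), of i 1 n 1] by (simp add: H_def)
  have "H = UNIV"
  proof (rule subspace_eq_UNIV[OF K1 K2 p])
    show "a + b \<in> H" if "a \<in> H" "b \<in> H" for a b
      using that mat_closedD(4)[OF I(1)] by (simp add: H_def unit_mat_add)
    show "c * a \<in> H" if "c \<in> K1" "a \<in> H" for c a
      using sw[of "?U i n a" i n i c n 1] that uA one i by (simp add: H_def unit_mat_entry)
    show "c * a \<in> H" if "c \<in> K2" "a \<in> H" for c a
      using sw[of "?U i n a" i n i 1 n c] that uA one i by (simp add: H_def unit_mat_entry mult.commute)
    show "M $$ (k, l) \<in> H" "M $$ (k, l) \<noteq> 0" by fact+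
  qed
  thus ?thesis by (auto simp: H_def)
qed

section \<open>Upper left blocks of subrings\<close>

definition tl_block :: "nat \<Rightarrow> 'k mat \<Rightarrow> 'k mat" where "tl_block n M = mat n n (\<lambda>ij. M $$ ij)"

text \<open>The zeros to the left of the corner make the passage to the upper left block
  multiplicative.\<close>

lemma tl_block_closed:
  assumes S: "mat_closed (n + 1) S" "S \<subseteq> AH n K1 K2"
  shows "mat_closed n (tl_block n ` S)" "tl_block n ` S \<subseteq> MH n K1"
proof -
  have c: "A \<in> carrier_mat (n + 1) (n + 1)" if "A \<in> S" for A using mat_closedD(1)[OF S(1) that] .
  have "tl_block n (0\<^sub>m (n + 1) (n + 1)) = 0\<^sub>m n n" by (rule eq_matI) (auto simp: tl_block_def)
  hence "0\<^sub>m n n \<in> tl_block n ` S" using mat_closedD(2)[OF S(1)] by (metis imageI)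
  moreover have "- tl_block n A \<in> tl_block n ` S" if "A \<in> S" for A
  proof -
    have "tl_block n (- A) = - tl_block n A"
      using c[OF that] by (intro eq_matI) (auto simp: tl_block_def)
    thus ?thesis using mat_closedD(3)[OF S(1) that] by (metis imageI)
  qed
  moreover have "tl_block n A + tl_block n B \<in> tl_block n ` S" if "A \<in> S" "B \<in> S" for A B
  proof -
    have "tl_block n (A + B) = tl_block n A + tl_block n B"
      using c[OF that(1)] c[OF that(2)] by (intro eq_matI) (auto simp: tl_block_def)
    thus ?thesis using mat_closedD(4)[OF S(1) that] by (metis imageI)
  qed
  moreover have "tl_block n A * tl_block n B \<in> tl_block n ` S" if "A \<in> S" "B \<in> S" for A B
  proof -
    have AB: "A \<in> AH n K1 K2" "B \<in> AH n K1 K2" using that S(2) by auto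
    have "tl_block n (A * B) = tl_block n A * tl_block n B"
    proof (rule eq_matI)
      fix i j assume "i < dim_row (tl_block n A * tl_block n B)" "j < dim_col (tl_block n A * tl_block n B)"
      hence ij: "i < n" "j < n" by (auto simp: tl_block_def)
      have "(tl_block n A * tl_block n B) $$ (i, j) = (\<Sum>k<n. tl_block n A $$ (i, k) * tl_block n B $$ (k, j))"
        by (rule mult_mat_entry) (use ij in \<open>auto simp: tl_block_def\<close>)
      also have "\<dots> = (A * B) $$ (i, j)"
        unfolding AH_mult_entry(1)[OF AB ij] by (rule sum.cong) (use ij in \<open>auto simp: tl_block_def\<close>)
      also have "\<dots> = tl_block n (A * B) $$ (i, j)" using ij by (simp add: tl_block_def)
      finally show "tl_block n (A * B) $$ (i, j) = (tl_block n A * tl_block n B) $$ (i, j)" by simp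
    qed (auto simp: tl_block_def)
    thus ?thesis using mat_closedD(5)[OF S(1) that] by (metis imageI)
  qed
  ultimately show "mat_closed n (tl_block n ` S)" by (auto simp: mat_closed_def) (auto simp: tl_block_def)
  show "tl_block n ` S \<subseteq> MH n K1" using S(2) by (auto simp: tl_block_def MH_def AH_def)
qed

text \<open>If the upper left blocks exhaust the matrix ring, then commutators of elements of \<open>S\<close> produce
  off-diagonal matrix units whose last diagonal entry vanishes.\<close>
lemma tl_block_proper:
  fixes K1 K2 :: "'k::{field, finite} set"
  assumes K: "is_subfield K1" "is_subfield K2" and n: "n \<ge> 2"
    and S: "mat_closed (n + 1) S" "S \<subset> AH n K1 K2"
    and col: "\<And>i z. i < n \<Longrightarrow> unit_mat (n + 1) i n z \<in> S"
    and Y: "Y \<in> S" "\<And>c. c \<in> K2 \<Longrightarrow> c \<noteq> 0 \<Longrightarrow> \<exists>k. c = (Y $$ (n, n)) ^ Suc k"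
  shows "tl_block n ` S \<subset> MH n K1"
proof (rule ccontr)
  assume "\<not> tl_block n ` S \<subset> MH n K1"
  hence full: "tl_block n ` S = MH n K1" using tl_block_closed(2)[OF S(1)] S(2) by blast
  let ?U = "unit_mat (n + 1)"
  note sc = mat_closedD[OF S(1)]
  note sf = is_subfieldD[OF K(1)] is_subfieldD[OF K(2)]
  have zS: "0\<^sub>m (Suc n) (Suc n) \<in> S" using sc(2) by simp
  have SA: "A \<in> AH n K1 K2" if "A \<in> S" for A using that S(2) by auto
  have minus: "A - B \<in> S" if "A \<in> S" "B \<in> S" for A B
    using sc(4)[OF that(1) sc(3)[OF that(2)]] minus_add_uminus_mat[OF sc(1)[OF that(1)] sc(1)[OF that(2)]] by simp
  have diag: "?U i j z + ?U n n (M $$ (n, n)) \<in> S"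
    if "i < n" "j < n" "M \<in> S" "tl_block n M = unit_mat n i j z" for i j z M
  proof -
    have Mc: "M \<in> carrier_mat (n + 1) (n + 1)" by (rule sc(1)[OF that(3)])
    \<comment> \<open>\<open>L\<close> is the part of the last column above the corner; it lies in
      \<open>S\<close> by \<open>col\<close> and can be subtracted.\<close>
    define L where "L = mat (n + 1) (n + 1) (\<lambda>(k, l). if k < n \<and> l = n then M $$ (k, l) else 0)"
    have "L \<in> S"
      by (rule mat_closed_of_units[OF S(1)]) (use col in \<open>auto simp: L_def unit_mat_zero zS\<close>)
    moreover have "?U i j z + ?U n n (M $$ (n, n)) = M - L"
    proof (rule eq_matI)
      fix k l assume "k < dim_row (M - L)" "l < dim_col (M - L)"
      hence kl: "k < n + 1" "l < n + 1" using Mc by (auto simp: L_def)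
      have "M $$ (k, l) = (if k = i \<and> l = j then z else 0)" if "k < n" "l < n"
        using arg_cong[OF \<open>tl_block n M = unit_mat n i j z\<close>, of "\<lambda>A. A $$ (k, l)"] that
        by (simp add: tl_block_def unit_mat_entry)
      moreover have "M $$ (n, l) = 0" if "l < n" using SA[OF \<open>M \<in> S\<close>] that by (simp add: AH_def)
      ultimately show "(?U i j z + ?U n n (M $$ (n, n))) $$ (k, l) = (M - L) $$ (k, l)"
        using kl that(1,2) Mc by (auto simp: unit_mat_def L_def less_Suc_eq)
    qed (use Mc in \<open>auto simp: unit_mat_def L_def\<close>)
    ultimately show ?thesis using minus[OF that(3)] by simp
  qed
  have lift: "\<exists>b. ?U i j z + ?U n n b \<in> S" if ij: "i < n" "j < n" and "z \<in> K1" for i j z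
  proof -
    have "unit_mat n i j z \<in> tl_block n ` S" unfolding full using that sf by (auto simp: MH_def unit_mat_def)
    then obtain M where "M \<in> S" "tl_block n M = unit_mat n i j z" by auto
    thus ?thesis using diag[OF ij] by blast
  qed
  have prod: "(?U a b s + ?U n n \<beta>) * (?U c e t + ?U n n \<gamma>) =
      ?U a e (if b = c then s * t else 0) + ?U n n (\<beta> * \<gamma>)"
    if "a < n" "b < n" "c < n" "e < n" for a b c e and s t \<beta> \<gamma> :: 'k
  proof -
    have 1: "?U x y w \<in> carrier_mat (n + 1) (n + 1)" for x y w by (rule unit_mat_carrier)
    have 2: "?U c e t + ?U n n \<gamma> \<in> carrier_mat (n + 1) (n + 1)" by (intro add_carrier_mat 1)
    have e: "?U a b s * ?U c e t = ?U a e (if b = c then s * t else 0)"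
      "?U n n \<beta> * ?U n n \<gamma> = ?U n n (\<beta> * \<gamma>)"
      "?U a b s * ?U n n \<gamma> = 0\<^sub>m (n + 1) (n + 1)" "?U n n \<beta> * ?U c e t = 0\<^sub>m (n + 1) (n + 1)"
      using that unit_mat_mult[of b "n + 1" c a s e t] unit_mat_mult[of n "n + 1" n n \<beta> n \<gamma>]
        unit_mat_mult[of b "n + 1" n a s n \<gamma>] unit_mat_mult[of n "n + 1" c n \<beta> e t]
      by (simp_all add: unit_mat_zero)
    show ?thesis
      unfolding add_mult_distrib_mat[OF 1 1 2] mult_add_distrib_mat[OF 1 1 1] e
        right_add_zero_mat[OF 1] left_add_zero_mat[OF 1] ..
  qed
  have off: "?U i j z \<in> S" if ij: "i < n" "j < n" "i \<noteq> j" and z: "z \<in> K1" for i j z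
  proof -
    obtain \<beta> where \<beta>: "?U i i 1 + ?U n n \<beta> \<in> S" using lift[OF ij(1,1) sf(2)] by auto
    obtain \<gamma> where \<gamma>: "?U i j z + ?U n n \<gamma> \<in> S" using lift[OF ij(1,2) z] by auto
    \<comment> \<open>The corner entries commute and cancel in the commutator. The unit at
      \<open>(i, i)\<close> fixes the one at \<open>(i, j)\<close> from the left and kills it from
      the right.\<close>
    have "(?U i i 1 + ?U n n \<beta>) * (?U i j z + ?U n n \<gamma>) - (?U i j z + ?U n n \<gamma>) * (?U i i 1 + ?U n n \<beta>) \<in> S"
      by (intro minus sc(5) \<beta> \<gamma>)
    also have "(?U i i 1 + ?U n n \<beta>) * (?U i j z + ?U n n \<gamma>) - (?U i j z + ?U n n \<gamma>) * (?U i i 1 + ?U n n \<beta>)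
      = ?U i j z"
      using ij by (simp only: prod) (intro eq_matI; auto simp: unit_mat_def)
    finally show ?thesis .
  qed
  have block: "?U i j z \<in> S" if ij: "i < n" "j < n" and z: "z \<in> K1" for i j z
  proof (cases "i = j")
    case True
    \<comment> \<open>A diagonal unit is a product of two off-diagonal ones through a second index
      \<open>k\<close>, which exists because \<open>n \<ge> 2\<close>.\<close>
    define k :: nat where "k = (if i = 0 then 1 else 0)"
    have k: "k < n" "k \<noteq> i" using n by (auto simp: k_def)
    have "?U i k z * ?U k i 1 \<in> S" by (intro sc(5) off) (use k ij z sf in auto)
    thus ?thesis using k True by (simp add: unit_mat_mult)
  qed (use off ij z in blast)
  have corner: "?U n n z \<in> S" if z: "z \<in> K2" for z
  proof (cases "z = 0")
    case False
    have Yc: "Y \<in> carrier_mat (n + 1) (n + 1)" by (rule sc(1)[OF Y(1)])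
    \<comment> \<open>\<open>L\<close> is \<open>Y\<close> without its corner. Subtracting it
      isolates the generator of the nonzero elements of \<open>K2\<close>, whose positive powers
      give all of them.\<close>
    define L where "L = mat (n + 1) (n + 1) (\<lambda>(k, l). if k = n then 0 else Y $$ (k, l))"
    have "L \<in> S"
    proof (rule mat_closed_of_units[OF S(1)])
      fix i j assume ij: "i < n + 1" "j < n + 1"
      show "?U i j (L $$ (i, j)) \<in> S"
      proof (cases "i = n")
        case True
        thus ?thesis using ij by (simp add: L_def unit_mat_zero zS)
      next
        case False
        thus ?thesis using ij block[of i j] col[of i] SA[OF Y(1)]
          by (cases "j = n") (auto simp: L_def AH_def)
      qed
    qed (simp add: L_def)
    moreover have "?U n n (Y $$ (n, n)) = Y - L"
    proof (rule eq_matI)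
      fix k l assume "k < dim_row (Y - L)" "l < dim_col (Y - L)"
      thus "?U n n (Y $$ (n, n)) $$ (k, l) = (Y - L) $$ (k, l)"
        using SA[OF Y(1)] Yc by (auto simp: unit_mat_def L_def AH_def less_Suc_eq)
    qed (use Yc in \<open>auto simp: unit_mat_def L_def\<close>)
    ultimately have b: "?U n n (Y $$ (n, n)) \<in> S" using minus[OF Y(1)] by simp
    have pow: "?U n n ((Y $$ (n, n)) ^ Suc k) \<in> S" for k
    proof (induction k)
      case (Suc k)
      thus ?case using sc(5)[OF b Suc] by (simp add: unit_mat_mult)
    qed (use b in simp)
    obtain k where "z = (Y $$ (n, n)) ^ Suc k" using Y(2)[OF z False] by auto
    thus ?thesis using pow by simp
  qed (simp add: unit_mat_zero zS)
  have "AH n K1 K2 \<subseteq> S"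
  proof
    fix M assume M: "M \<in> AH n K1 K2"
    show "M \<in> S"
    proof (rule mat_closed_of_units[OF S(1)])
      fix i j assume ij: "i < n + 1" "j < n + 1"
      consider "i < n" "j < n" | "i < n" "j = n" | "i = n" "j < n" | "i = n" "j = n" using ij by linarith
      thus "?U i j (M $$ (i, j)) \<in> S"
        by cases (use M block col corner in \<open>auto simp: AH_def unit_mat_zero zS\<close>)
    qed (use M in \<open>simp add: AH_def\<close>)
  qed
  thus False using S(2) by blast
qed

text \<open>Keep only the members with an element whose corner is the generator \<open>b\<close>.
  Every block occurs with the corner \<open>b\<close>, so the upper left blocks of these members
  still cover; each of these block rings is proper because its member contains the last column and
  an element with corner \<open>b\<close>.\<close>

lemma Aring_cover_bound:
  fixes K1 K2 :: "'k::{field, finite} set"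
  assumes K1: "is_subfield K1" "card K1 = p ^ d1" "d1 > 0" and K2: "is_subfield K2"
    and p: "prime p" "card (UNIV :: 'k set) = p ^ L" and n: "n \<ge> 2"
    and C: "is_cover (Aring n K1 K2) C" "finite C" "\<And>S i z. S \<in> C \<Longrightarrow> i < n \<Longrightarrow> unit_mat (n + 1) i n z \<in> S"
  shows "\<exists>m. m dvd n \<and> m \<ge> 2 \<and>
    (\<Prod>i\<in>{1..<n}. card K1 ^ n - card K1 ^ i) \<le> card C * (m * card K1 ^ (n * (n div m - 1)))"
proof -
  obtain T where T: "T \<subseteq> MH n K1"
    "\<And>C. finite C \<Longrightarrow> (\<And>S. S \<in> C \<Longrightarrow> mat_closed n S \<and> S \<subset> MH n K1) \<Longrightarrow> T \<subseteq> \<Union>C \<Longrightarrow>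
      \<exists>m. m dvd n \<and> m \<ge> 2 \<and> (\<Prod>i\<in>{1..<n}. card K1 ^ n - card K1 ^ i) \<le> card C * (m * card K1 ^ (n * (n div m - 1)))"
    using matrix_family_bound[OF K1 p n] by metis
  obtain b where b: "b \<in> K2" "\<And>c. c \<in> K2 \<Longrightarrow> c \<noteq> 0 \<Longrightarrow> \<exists>k. c = b ^ Suc k"
    using subfield_generator[OF K2] by (metis finite)
  define C' where "C' = {S \<in> C. \<exists>Y\<in>S. Y $$ (n, n) = b}"
  have cl: "mat_closed (n + 1) S" "S \<subset> AH n K1 K2" if "S \<in> C" for S
    using C(1) that subrng_mat_ring_iff[OF AH_closed[OF K1(1) K2, of n], of S]
    unfolding is_cover_def Aring_eq by auto
  have "\<exists>m. m dvd n \<and> m \<ge> 2 \<and> (\<Prod>i\<in>{1..<n}. card K1 ^ n - card K1 ^ i)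
      \<le> card ((\<lambda>S. tl_block n ` S) ` C') * (m * card K1 ^ (n * (n div m - 1)))"
  proof (rule T(2))
    show "finite ((\<lambda>S. tl_block n ` S) ` C')" using C(2) by (simp add: C'_def)
    fix S assume "S \<in> (\<lambda>S. tl_block n ` S) ` C'"
    then obtain S' Y where S': "S' \<in> C" "S = tl_block n ` S'" and Y: "Y \<in> S'" "Y $$ (n, n) = b"
      by (auto simp: C'_def)
    have "tl_block n ` S' \<subset> MH n K1"
      by (rule tl_block_proper[OF K1(1) K2 n cl[OF S'(1)] C(3)[OF S'(1)] Y(1)]) (use b Y in auto)
    moreover have "mat_closed n (tl_block n ` S')"
      using tl_block_closed(1)[OF cl(1)[OF S'(1)]] cl(2)[OF S'(1)] by blast
    ultimately show "mat_closed n S \<and> S \<subset> MH n K1" using S'(2) by simp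
  next
    show "T \<subseteq> \<Union> ((\<lambda>S. tl_block n ` S) ` C')"
    proof
      fix A assume "A \<in> T"
      hence A: "A \<in> MH n K1" using T(1) by auto
      define Y where "Y = mat (n + 1) (n + 1) (\<lambda>(i, j). if i < n \<and> j < n then A $$ (i, j) else if i = n \<and> j = n then b else 0)"
      have "Y \<in> AH n K1 K2" using A b(1) by (auto simp: Y_def AH_def MH_def)
      then obtain S where S: "S \<in> C" "Y \<in> S" using C(1) by (auto simp: is_cover_def Aring_eq)
      hence "S \<in> C'" by (auto simp: C'_def Y_def intro!: bexI[of _ Y])
      moreover have "tl_block n Y = A" using A by (intro eq_matI) (auto simp: Y_def tl_block_def MH_def)
      ultimately show "A \<in> \<Union> ((\<lambda>S. tl_block n ` S) ` C')" using S(2) by blast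
    qed
  qed
  moreover have "card ((\<lambda>S. tl_block n ` S) ` C') \<le> card C"
    using card_image_le[of C' "\<lambda>S. tl_block n ` S"] card_mono[of C C'] C(2) by (fastforce simp: C'_def)
  ultimately show ?thesis by (meson mult_le_mono1 le_trans)
qed

section \<open>Comparison of the bounds\<close>

text \<open>The extra summand carries the induction:
  \<open>(1 / 4 + t) * (1 - t) \<ge> 1 / 4 + t / 2\<close> holds for
  \<open>0 \<le> t \<le> 1 / 4\<close>, and \<open>t\<close> is halved at each step.\<close>

lemma prod_one_minus_inverse_power_ge:
  fixes q :: real
  assumes q: "q \<ge> 2"
  shows "1 / 4 + 1 / 2 ^ (k + 2) \<le> (\<Prod>j\<in>{1..k+1}. 1 - 1 / q ^ j)"
proof (induction k)
  case 0
  show ?case using q by (simp add: field_simps)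
next
  case (Suc k)
  let ?t = "1 / 2 ^ (k + 2) :: real"
  have "1 / q ^ (k + 2) \<le> ?t" using q by (intro divide_left_mono power_mono) auto
  hence f: "1 - ?t \<le> 1 - 1 / q ^ (k + 2)" by simp
  have t: "0 < ?t" "?t \<le> 1 / 4"
    using power_increasing[of 2 "k + 2" "2 :: real"] by (auto simp: divide_simps)
  have "1 / 4 + 1 / 2 ^ (Suc k + 2) \<le> (1 / 4 + ?t) * (1 - ?t)"
  proof -
    have "?t * ?t \<le> ?t * (1 / 4)" using t by (intro mult_left_mono) auto
    hence "1 / 4 + ?t / 2 \<le> (1 / 4 + ?t) * (1 - ?t)" by (simp add: algebra_simps)
    thus ?thesis by simp
  qed
  also have "\<dots> \<le> (\<Prod>j\<in>{1..k+1}. 1 - 1 / q ^ j) * (1 - 1 / q ^ (k + 2))"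
  proof (rule mult_mono[OF Suc f])
    show "0 \<le> (\<Prod>j\<in>{1..k+1}. 1 - 1 / q ^ j)" using Suc t(1) by linarith
    show "0 \<le> 1 - ?t" using t(2) by linarith
  qed
  also have "\<dots> = (\<Prod>j\<in>{1..Suc k+1}. 1 - 1 / q ^ j)"
    by (simp add: mult.commute)
  finally show ?case .
qed

text \<open>Taking \<open>q ^ n\<close> out of each of the \<open>n - 1\<close> factors leaves the
  product of the \<open>1 - 1 / q ^ j\<close> with \<open>j = n - i\<close>, which is at least
  \<open>1 / 4\<close>.\<close>

lemma prod_power_diff_ge:
  fixes q n :: nat
  assumes q: "q \<ge> 2" and n: "n \<ge> 2"
  shows "q ^ (n * (n - 1)) \<le> 4 * (\<Prod>i\<in>{1..<n}. q ^ n - q ^ i)"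
proof -
  have "real (\<Prod>i\<in>{1..<n}. q ^ n - q ^ i) = (\<Prod>i\<in>{1..<n}. real q ^ n - real q ^ i)"
    unfolding of_nat_prod
    by (rule prod.cong) (use q in \<open>auto simp: of_nat_diff intro!: power_increasing\<close>)
  also have "\<dots> = (\<Prod>j\<in>{1..<n}. real q ^ n * (1 - 1 / real q ^ j))"
  proof (rule prod.reindex_bij_witness[of _ "\<lambda>j. n - j" "\<lambda>i. n - i"])
    fix i assume "i \<in> {1..<n}"
    hence "real q ^ n = real q ^ (n - i) * real q ^ i" by (simp flip: power_add)
    thus "real q ^ n * (1 - 1 / real q ^ (n - i)) = real q ^ n - real q ^ i"
      using q by (simp add: field_simps)
  qed auto
  also have "\<dots> = real q ^ (n * (n - 1)) * (\<Prod>j\<in>{1..<n}. 1 - 1 / real q ^ j)"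
    by (simp add: prod.distrib power_mult)
  finally have eq: "real (\<Prod>i\<in>{1..<n}. q ^ n - q ^ i) = real q ^ (n * (n - 1)) * (\<Prod>j\<in>{1..<n}. 1 - 1 / real q ^ j)" .
  have "{1..<n} = {1..n-2+1}" using n by auto
  hence "1 / 4 + 1 / 2 ^ (n - 2 + 2) \<le> (\<Prod>j\<in>{1..<n}. 1 - 1 / real q ^ j)"
    using prod_one_minus_inverse_power_ge[of "real q" "n - 2"] q by simp
  hence "1 / 4 \<le> (\<Prod>j\<in>{1..<n}. 1 - 1 / real q ^ j)" by (rule order_trans[rotated]) simp
  hence "real q ^ (n * (n - 1)) * (1 / 4) \<le> real (\<Prod>i\<in>{1..<n}. q ^ n - q ^ i)"
    unfolding eq by (intro mult_left_mono) auto
  hence "real (q ^ (n * (n - 1))) \<le> real (4 * (\<Prod>i\<in>{1..<n}. q ^ n - q ^ i))" by simp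
  thus ?thesis by (simp only: of_nat_le_iff)
qed

text \<open>The crude bound for the product suffices unless \<open>q ^ n < 8 * m\<close>, which leaves
  \<open>q = 2\<close> and \<open>n \<le> 5\<close>.\<close>
lemma upper_less_lower:
  fixes n a d q m u c :: nat
  assumes n: "n \<ge> 3" and a: "prime a" "a dvd n" "\<forall>r. prime r \<and> r dvd n \<longrightarrow> a \<le> r"
    and d: "d > 0" "d < n - n div a" and q: "q \<ge> 2" and m: "m dvd n" "m \<ge> 2"
    and c: "(\<Prod>i\<in>{1..<n}. q ^ n - q ^ i) \<le> c * (m * q ^ (n * (n div m - 1)))"
    and u: "u * (q ^ d - 1) \<le> (q ^ d) ^ (n + 1) - 1" and ex: "(n, q) \<noteq> (3, 2)"
  shows "u < c"
proof -
  define Q where "Q = q ^ d"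
  have Q2: "Q \<ge> 2"
  proof -
    have "q ^ 1 \<le> q ^ d" using q d by (intro power_increasing) auto
    thus ?thesis using q by (simp add: Q_def)
  qed
  \<comment> \<open>The geometric sum is less than twice its top term because
    \<open>Q \<le> 2 * (Q - 1)\<close>.\<close>
  have u2: "u < 2 * Q ^ n"
  proof (rule ccontr)
    assume "\<not> u < 2 * Q ^ n"
    hence "2 * Q ^ n * (Q - 1) \<le> u * (Q - 1)" by simp
    also have "\<dots> \<le> Q ^ (n + 1) - 1" using u by (simp add: Q_def)
    also have "\<dots> < Q ^ (n + 1)" using Q2 by simp
    also have "\<dots> = Q ^ n * Q" by simp
    also have "\<dots> \<le> Q ^ n * (2 * (Q - 1))" using Q2 by (intro mult_left_mono) auto
    finally show False by simp
  qed
  \<comment> \<open>A prime factor of \<open>m\<close> divides \<open>n\<close>, so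
    \<open>a \<le> m\<close>. Hence \<open>n div m \<le> n div a\<close>, and the hypothesis on
    \<open>d\<close> passes from \<open>a\<close> to \<open>m\<close>.\<close>
  obtain r where r: "prime r" "r dvd m" using prime_factor_nat[of m] m(2) by auto
  have am: "a \<le> m"
  proof -
    have "a \<le> r" using a(3) r m(1) dvd_trans by blast
    also have "r \<le> m" using r(2) m(2) by (intro dvd_imp_le) auto
    finally show ?thesis .
  qed
  have a0: "a > 0" using a(1) prime_gt_0_nat by blast
  have nm: "n div m \<le> n div a" using am a0 by (rule div_le_mono2[rotated])
  have nm1: "n div m \<ge> 1" using m n by (metis One_nat_def Suc_leI dvd_div_eq_0_iff neq0_conv not_numeral_le_zero)
  have dm: "d + 1 \<le> n - n div m" using d nm by linarith
  consider (big) "q ^ n \<ge> 8 * m" | (four) "n = 4" "q = 2" "m = 4" | (five) "n = 5" "q = 2" "m = 5"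
  proof (cases "q ^ n \<ge> 8 * m")
    case False
    hence lt: "q ^ n < 8 * n" using m n by (meson dvd_imp_le leD le_trans mult_le_mono2 not_less zero_less_numeral less_le_trans)
    have "q = 2"
    proof (rule ccontr)
      assume "q \<noteq> 2"
      hence "3 ^ n \<le> q ^ n" using q by (intro power_mono) auto
      moreover have "8 * k \<le> 3 ^ k" if "k \<ge> 3" for k :: nat
        using that by (induction k rule: dec_induct) auto
      ultimately show False using lt n by (metis leD le_trans)
    qed
    have "n < 6"
    proof (rule ccontr)
      assume "\<not> n < 6"
      moreover have "8 * k \<le> 2 ^ k" if "k \<ge> 6" for k :: nat
        using that by (induction k rule: dec_induct) auto
      ultimately show False using lt \<open>q = 2\<close> by (metis leD not_less)
    qed
    hence "n = 4 \<or> n = 5" using n ex \<open>q = 2\<close> by auto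
    thus thesis
    proof
      assume n4: "n = 4"
      have "m \<le> 4" using m(1) n4 by (simp add: dvd_imp_le)
      moreover have "m > 2" using False n4 \<open>q = 2\<close> by simp
      ultimately have "m = 3 \<or> m = 4" by linarith
      hence "m = 4" using m(1) n4 by auto
      thus thesis using four n4 \<open>q = 2\<close> by simp
    next
      assume n5: "n = 5"
      have "m \<le> 5" using m(1) n5 by (simp add: dvd_imp_le)
      moreover have "m > 4" using False n5 \<open>q = 2\<close> by simp
      ultimately show thesis using five n5 \<open>q = 2\<close> by simp
    qed
  qed
  thus ?thesis
  proof cases
    case big
    \<comment> \<open>Cancelling \<open>q ^ (n * (n div m))\<close> gives
      \<open>q ^ (n * (n - n div m)) \<le> 4 * c * m\<close>. The left side is at least
      \<open>Q ^ n * q ^ n\<close>, and the spare \<open>q ^ n \<ge> 8 * m\<close> yields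
      \<open>2 * Q ^ n \<le> c\<close>.\<close>
    have "q ^ n * q ^ (n * (n - 1)) \<le> q ^ n * (4 * (\<Prod>i\<in>{1..<n}. q ^ n - q ^ i))"
      using prod_power_diff_ge[OF q, of n] n by (intro mult_left_mono) auto
    also have "\<dots> \<le> q ^ n * (4 * (c * (m * q ^ (n * (n div m - 1)))))"
      using c by (intro mult_left_mono) auto
    also have "\<dots> = 4 * c * m * q ^ (n + n * (n div m - 1))" by (simp add: power_add)
    also have "n + n * (n div m - 1) = n * (n div m)" using nm1 by (cases "n div m") auto
    finally have le: "q ^ (n + n * (n - 1)) \<le> 4 * c * m * q ^ (n * (n div m))" by (simp add: power_add)
    have "n + n * (n - 1) = n * (n - n div m) + n * (n div m)"
    proof -
      have "n * (n - n div m) + n * (n div m) = n * n" by (simp flip: distrib_left)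
      moreover have "n + n * (n - 1) = n * n" using n by (cases n) auto
      ultimately show ?thesis by simp
    qed
    hence "q ^ (n * (n - n div m)) * q ^ (n * (n div m)) \<le> 4 * c * m * q ^ (n * (n div m))"
      using le by (simp only: power_add)
    hence "q ^ (n * (n - n div m)) \<le> 4 * c * m" using q by simp
    moreover have "q ^ (n * (d + 1)) \<le> q ^ (n * (n - n div m))"
      using dm q by (intro power_increasing mult_le_mono2) auto
    moreover have "q ^ (n * (d + 1)) = Q ^ n * q ^ n"
      by (simp add: Q_def power_add mult.commute flip: power_mult)
    moreover have "Q ^ n * (8 * m) \<le> Q ^ n * q ^ n" using big by simp
    ultimately have "Q ^ n * (8 * m) \<le> 4 * c * m" by linarith
    hence "(2 * Q ^ n) * (4 * m) \<le> c * (4 * m)" by (simp add: mult_ac)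
    hence "2 * Q ^ n \<le> c" using m(2) by simp
    thus ?thesis using u2 by simp
  next
    \<comment> \<open>Here \<open>d = 1\<close>, so \<open>u \<le> 31\<close>, while
      \<open>14 * 12 * 8 \<le> 4 * c\<close> gives \<open>c \<ge> 336\<close>.\<close>
    case four
    have "a \<le> 2" using a(3) four by simp
    hence "a = 2" using prime_ge_2_nat[OF a(1)] by simp
    hence "d = 1" using d four by simp
    moreover have "{1..<n} = {1, 2, 3}" using four by auto
    ultimately show ?thesis using u c four by simp
  next
    \<comment> \<open>The largest case \<open>d = 3\<close> has \<open>u \<le> 37449\<close>, while
      \<open>30 * 28 * 24 * 16 \<le> 5 * c\<close> gives \<open>c \<ge> 64512\<close>.\<close>
    case five
    have "prime (5 :: nat)" by simp
    hence "a = 5" using a(1,2) five primes_dvd_imp_eq by blast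
    hence "d = 1 \<or> d = 2 \<or> d = 3" using d five by auto
    moreover have "{1..<n} = {1, 2, 3, 4}" using five by auto
    ultimately show ?thesis using u c five by auto
  qed
qed

section \<open>Ideals and covers of quotients\<close>

lemma ideal_of_ideal_rng:
  assumes "ring R" "ideal_rng R I"
  shows "ideal I R"
proof -
  interpret ring R by fact
  have I: "I \<subseteq> carrier R" "\<zero>\<^bsub>R\<^esub> \<in> I" "\<And>x. x \<in> I \<Longrightarrow> \<ominus>\<^bsub>R\<^esub> x \<in> I"
    "\<And>x y. x \<in> I \<Longrightarrow> y \<in> I \<Longrightarrow> x \<oplus>\<^bsub>R\<^esub> y \<in> I"
    using assms(2) by (auto simp: ideal_rng_def subrng_def)
  have "subgroup I (add_monoid R)"
    by (rule add.subgroupI) (use I in \<open>auto simp: a_inv_def\<close>)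
  thus ?thesis using assms by (intro idealI) (auto simp: ideal_rng_def)
qed

text \<open>Preimages under the quotient map turn a cover of the quotient into a cover of
  \<open>R\<close> by subrings containing \<open>I\<close>, without increasing its size.\<close>

lemma sigma_Quot_ge:
  assumes R: "ring R" and I: "ideal I R"
    and C: "\<And>C. is_cover R C \<Longrightarrow> finite C \<Longrightarrow> (\<And>S. S \<in> C \<Longrightarrow> I \<subseteq> S) \<Longrightarrow> k \<le> card C"
  shows "enat k \<le> sigma (R Quot I)"
proof (rule sigma_ge)
  fix D assume D: "is_cover (R Quot I) D" "finite D"
  interpret R: ring R by fact
  interpret I: ideal I R by fact
  define f where "f x = I +>\<^bsub>R\<^esub> x" for x
  interpret f: ring_hom_ring R "R Quot I" f
    unfolding f_def by (rule I.rcos_ring_hom_ring)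
  define pre where "pre S = {x \<in> carrier R. f x \<in> S}" for S
  have surj: "carrier (R Quot I) = f ` carrier R"
    by (auto simp: FactRing_def A_RCOSETS_def' f_def)
  have fI: "f x = \<zero>\<^bsub>R Quot I\<^esub>" if "x \<in> I" for x
    using R.a_rcos_zero[OF I that] by (simp add: f_def FactRing_def)
  have S: "subrng (R Quot I) S" "S \<noteq> carrier (R Quot I)" if "S \<in> D" for S
    using D(1) that by (auto simp: is_cover_def)
  have "subrng R (pre S)" if "S \<in> D" for S
    using S(1)[OF that] by (auto simp: subrng_def pre_def)
  moreover have "pre S \<noteq> carrier R" if "S \<in> D" for S
  proof
    assume "pre S = carrier R"
    hence "carrier (R Quot I) \<subseteq> S" unfolding surj by (auto simp: pre_def)
    thus False using S[OF that] by (auto simp: subrng_def)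
  qed
  moreover have "\<Union> (pre ` D) = carrier R"
  proof
    show "carrier R \<subseteq> \<Union> (pre ` D)"
    proof
      fix x assume x: "x \<in> carrier R"
      hence "f x \<in> \<Union> D" using D(1) by (auto simp: is_cover_def)
      thus "x \<in> \<Union> (pre ` D)" using x by (auto simp: pre_def)
    qed
  qed (auto simp: pre_def)
  ultimately have "is_cover R (pre ` D)" by (auto simp: is_cover_def)
  moreover have "I \<subseteq> pre S" if "S \<in> D" for S
    using fI S(1)[OF that] I.a_subset by (auto simp: pre_def subrng_def)
  ultimately have "k \<le> card (pre ` D)" using D(2) by (intro C) auto
  thus "k \<le> card D" using card_image_le[OF D(2), of pre] by linarith
qed

theorem theorem5p7:
  fixes K1 K2 :: "('k::{field, finite}) set"
    and n a p d1 d2 d :: nat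
  assumes "n \<ge> 3"
    and "prime a" and "a dvd n" and "\<forall>r. prime r \<and> r dvd n \<longrightarrow> a \<le> r"
    and "prime p" and "d1 > 0" and "d2 > 0"
    and "is_subfield K1" and "card K1 = p ^ d1"
    and "is_subfield K2" and "card K2 = p ^ d2"
    and "card (UNIV :: 'k set) = p ^ lcm d1 d2"
    and "card (UNIV :: 'k set) = (p ^ d1) ^ d"
    and "d < n - n div a"
  shows "sigma (Aring n K1 K2) \<le> sigma (matring n K1)
     \<and> (sigma (Aring n K1 K2) = sigma (matring n K1) \<longrightarrow> n = 3 \<and> p ^ d1 = 2)
     \<and> ((n, p ^ d1) \<noteq> (3, 2) \<longrightarrow> sigma_elementary (Aring n K1 K2))"
proof -
  note A = assms
  define q where "q = p ^ d1"
  have q2: "q \<ge> 2" using one_less_power[OF prime_gt_1_nat[OF A(5)] A(6)] by (simp add: q_def)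
  have n2: "n \<ge> 2" using A(1) by simp
  have cU: "card (UNIV :: 'k set) = q ^ d" using A(13) by (simp add: q_def)
  have "d \<noteq> 0"
  proof
    assume "d = 0"
    hence "card (UNIV :: 'k set) = 1" using cU by simp
    moreover have "card {0, 1 :: 'k} \<le> card (UNIV :: 'k set)" by (rule card_mono) auto
    ultimately show False by simp
  qed
  hence d0: "d > 0" by simp
  obtain U where U: "is_cover (Aring n K1 K2) U" "finite U" "card U * (q ^ d - 1) \<le> (q ^ d) ^ (n + 1) - 1"
    using Aring_cover[OF n2 A(8,10)] unfolding cU by blast
  define u where "u = card U"
  have su: "sigma (Aring n K1 K2) \<le> enat u" unfolding u_def by (rule sigma_le[OF U(1,2)])
  have less: "u < c" if "(n, q) \<noteq> (3, 2)"
    "\<exists>m. m dvd n \<and> m \<ge> 2 \<and> (\<Prod>i\<in>{1..<n}. card K1 ^ n - card K1 ^ i) \<le> c * (m * card K1 ^ (n * (n div m - 1)))" for c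
    using upper_less_lower[OF A(1,2,3,4) d0 A(14) q2 _ _ _ U(3)[folded u_def] that(1)] that(2)
    by (auto simp: A(9) q_def)
  obtain T where T: "T \<subseteq> MH n K1"
    "\<And>C. finite C \<Longrightarrow> (\<And>S. S \<in> C \<Longrightarrow> mat_closed n S \<and> S \<subset> MH n K1) \<Longrightarrow> T \<subseteq> \<Union>C \<Longrightarrow>
      \<exists>m. m dvd n \<and> m \<ge> 2 \<and> (\<Prod>i\<in>{1..<n}. card K1 ^ n - card K1 ^ i) \<le> card C * (m * card K1 ^ (n * (n div m - 1)))"
    "\<And>C. n = 3 \<Longrightarrow> card K1 = 2 \<Longrightarrow> finite C \<Longrightarrow> (\<And>S. S \<in> C \<Longrightarrow> mat_closed n S \<and> S \<subset> MH n K1) \<Longrightarrow>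
      MH n K1 \<subseteq> \<Union>C \<Longrightarrow> 15 \<le> card C"
    using matrix_family_bound[OF A(8,9,6,5,12) n2] by metis
  have mat: "mat_closed n S \<and> S \<subset> MH n K1" if "is_cover (matring n K1) C" "S \<in> C" for C S
    using that subrng_mat_ring_iff[OF MH_closed[OF A(8), of n], of S]
    unfolding is_cover_def matring_eq by auto
  have mat_cov: "MH n K1 \<subseteq> \<Union>C" if "is_cover (matring n K1) C" for C
    using that unfolding is_cover_def matring_eq by auto
  \<comment> \<open>\<open>Suc u\<close> turns \<open>u < card C\<close> for all finite covers into
    a bound on the infimum that stays strict, also when there is no finite cover.\<close>
  have strict: "enat (Suc u) \<le> sigma (matring n K1)" if ne: "(n, q) \<noteq> (3, 2)"
  proof (rule sigma_ge)
    fix C assume C: "is_cover (matring n K1) C" "finite C"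
    have "u < card C" by (rule less[OF ne T(2)[OF C(2)]]) (use mat[OF C(1)] mat_cov[OF C(1)] T(1) in auto)
    thus "Suc u \<le> card C" by simp
  qed
  have small: "enat 15 \<le> sigma (matring n K1)" if eq: "n = 3" "q = 2"
  proof (rule sigma_ge)
    fix C assume C: "is_cover (matring n K1) C" "finite C"
    show "15 \<le> card C"
      by (rule T(3)[OF eq(1) _ C(2)]) (use mat[OF C(1)] mat_cov[OF C(1)] eq A(9) in \<open>auto simp: q_def\<close>)
  qed
  \<comment> \<open>Here \<open>a = 3\<close> and \<open>d < 2\<close>, so \<open>d = 1\<close>, and
    15 is the number of points of the projective space of dimension 3 over the field of order
    2.\<close>
  have u15: "u \<le> 15" if eq: "n = 3" "q = 2"
  proof -
    have "a = 3" using A(2,3) eq primes_dvd_imp_eq[of a 3] by simp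
    hence "d = 1" using A(14) d0 eq by simp
    thus ?thesis using U(3) eq by (simp add: u_def)
  qed
  have lt: "sigma (Aring n K1 K2) < sigma (matring n K1)" if "(n, q) \<noteq> (3, 2)"
    using su strict[OF that] by (metis enat_ord_simps(2) lessI order_le_less_trans order_less_le_trans)
  have "sigma (Aring n K1 K2) \<le> sigma (matring n K1)"
  proof (cases "(n, q) = (3, 2)")
    case True
    hence "enat u \<le> enat 15" using u15 by simp
    thus ?thesis using su small True by (meson Pair_inject order_trans)
  qed (use lt in auto)
  moreover have "sigma (Aring n K1 K2) = sigma (matring n K1) \<longrightarrow> n = 3 \<and> p ^ d1 = 2"
  proof
    assume "sigma (Aring n K1 K2) = sigma (matring n K1)"
    hence "(n, q) = (3, 2)" using lt by (metis less_irrefl)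
    thus "n = 3 \<and> p ^ d1 = 2" by (simp add: q_def)
  qed
  moreover have "sigma_elementary (Aring n K1 K2)" if ne: "(n, p ^ d1) \<noteq> (3, 2)"
    unfolding sigma_elementary_def
  proof (intro allI impI)
    fix I assume "ideal_rng (Aring n K1 K2) I \<and> I \<noteq> {\<zero>\<^bsub>Aring n K1 K2\<^esub>}"
    hence I: "ideal_rng (Aring n K1 K2) I" "I \<noteq> {0\<^sub>m (n + 1) (n + 1)}"
      by (auto simp: Aring_eq ring_mat_def)
    note cl = AH_closed[OF A(8,10), of n]
    have R: "ring (Aring n K1 K2)" unfolding Aring_eq by (rule ring_mat_subset(1)[OF cl])
    have Icl: "mat_closed (n + 1) I"
      using I(1) subrng_mat_ring_iff[OF cl] by (simp only: ideal_rng_def Aring_eq)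
    have Imult: "M * B \<in> I \<and> B * M \<in> I" if "M \<in> AH n K1 K2" "B \<in> I" for M B
      using I(1) that by (auto simp: ideal_rng_def Aring_eq ring_mat_def)
    have col: "unit_mat (n + 1) i n z \<in> I" if "i < n" for i z
      by (rule ideal_contains_column[OF A(8,9,10,11,5,12) _ Icl Imult I(2) that]) (use A(1) in auto)
    have "enat (Suc u) \<le> sigma (Aring n K1 K2 Quot I)"
    proof (rule sigma_Quot_ge[OF R ideal_of_ideal_rng[OF R I(1)]])
      fix C assume C: "is_cover (Aring n K1 K2) C" "finite C" "\<And>S. S \<in> C \<Longrightarrow> I \<subseteq> S"
      \<comment> \<open>Every member contains \<open>I\<close> and therefore the last column, so the
        bound through the upper left blocks applies.\<close>
      have "u < card C"
        by (rule less[OF _ Aring_cover_bound[OF A(8,9,6,10,5,12) n2 C(1,2)]])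
          (use ne col C(3) in \<open>auto simp: q_def\<close>)
      thus "Suc u \<le> card C" by simp
    qed
    thus "sigma (Aring n K1 K2) < sigma (Aring n K1 K2 Quot I)"
      using su by (metis enat_ord_simps(2) lessI order_le_less_trans order_less_le_trans)
  qed
  ultimately show ?thesis by blast
qed

end
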